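(* Let $(E,\Phi,\Delta)$ be a simple based root system, and let $\lambda_1,\lambda_2,\mu_1,\mu_2$ be dominant regular weights such that each of $\mu_1,\mu_2$ is a positive integral multiple of $\rho$ or of $\tilde\rho$, and $\mu_i$ divides $\lambda_i$ for $i=1,2$. Suppose $S(\lambda_1)/S(\mu_1)=S(\lambda_2)/S(\mu_2)$ and that this quotient is not equal to $1$. Then $\lambda_1=\lambda_2$ and $\mu_1=\mu_2$. In particular, if $\lambda_1$ is a dominant regular weight which is neither a multiple of $\rho$ nor of $\tilde\rho$, $\lambda_2$ is dominant regular, and $C(\lambda_1)=C(\lambda_2)$, then $\lambda_1=\lambda_2$.
   Context: Notation: Weyl group $W$ with sign $\epsilon(w)=(-1)^{\ell(w)}$, coroots $\alpha^*$, weight lattice $P$, fundamental weights $\omega_\alpha$ ($\alpha\in\Delta$), $m_\alpha(\lambda)=\langle\alpha^*,\lambda\rangle$; dominant regular means $m_\alpha(\lambda)>0$ for all $\alpha\in\Delta$; $\rho=\sum_{\alpha\in\Delta}\omega_\alpha$; for a regular weight $\mu$, "$\mu$ divides $\lambda$" means $m_\alpha(\mu)\mid m_\alpha(\lambda)$ for all $\alpha\in\Delta$. $S(\lambda)=\sum_{w\in W}\epsilon(w)e^{w\lambda}$ in the group ring $\mathbb Z[P]$. $m(\Phi)$ is the ratio of the squared length of a long root to that of a short root; $\tilde\rho=\sum_{\alpha\in\Delta\text{ short}}m(\Phi)\omega_\alpha+\sum_{\alpha\in\Delta\text{ long}}\omega_\alpha$ ($=\rho$ if simply laced). For dominant regular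 $\lambda$, $D(\lambda)$ is the lcm in $\mathbb Z[P]^W$ (a polynomial ring over $\mathbb Z$) of all $S(d\rho)$ with $d\rho\mid\lambda$, $d\rho\ne\lambda$ and all $S(e\tilde\rho)$ with $e\tilde\rho\mid\lambda$, $e\tilde\rho\ne\lambda$, normalized to have positive leading coefficient for the dominance order, and $C(\lambda)=S(\lambda)/D(\lambda)$. *)

theory Defs
  imports "HOL-Analysis.Analysis" "HOL-Library.Poly_Mapping"
begin

definition coroot :: "'a::euclidean_space \<Rightarrow> 'a" where
  "coroot \<alpha> = (2 / (\<alpha> \<bullet> \<alpha>)) *\<^sub>R \<alpha>"

definition mult_at :: "'a::euclidean_space \<Rightarrow> 'a \<Rightarrow> real" where
  "mult_at \<alpha> lam = coroot \<alpha> \<bullet> lam"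

definition refl :: "'a::euclidean_space \<Rightarrow> 'a \<Rightarrow> 'a" where
  "refl \<alpha> x = x - mult_at \<alpha> x *\<^sub>R \<alpha>"

definition root_system :: "'a::euclidean_space set \<Rightarrow> bool" where
  "root_system \<Phi> \<longleftrightarrow>
     finite \<Phi> \<and> 0 \<notin> \<Phi> \<and> span \<Phi> = UNIV \<and>
     (\<forall>\<alpha>\<in>\<Phi>. refl \<alpha> ` \<Phi> = \<Phi>) \<and>
     (\<forall>\<alpha>\<in>\<Phi>. \<forall>\<beta>\<in>\<Phi>. mult_at \<alpha> \<beta> \<in> \<int>) \<and>
     (\<forall>\<alpha>\<in>\<Phi>. \<forall>c::real. c *\<^sub>R \<alpha> \<in> \<Phi> \<longrightarrow> c = 1 \<or> c = -1)"

definition irreducible_root_system :: "'a::euclidean_space set \<Rightarrow> bool" where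
  "irreducible_root_system \<Phi> \<longleftrightarrow>
     \<not> (\<exists>\<Phi>1 \<Phi>2. \<Phi>1 \<noteq> {} \<and> \<Phi>2 \<noteq> {} \<and> \<Phi>1 \<union> \<Phi>2 = \<Phi> \<and>
           (\<forall>\<alpha>\<in>\<Phi>1. \<forall>\<beta>\<in>\<Phi>2. \<alpha> \<bullet> \<beta> = 0))"

definition is_base :: "'a::euclidean_space set \<Rightarrow> 'a set \<Rightarrow> bool" where
  "is_base \<Phi> \<Delta> \<longleftrightarrow>
     \<Delta> \<subseteq> \<Phi> \<and> independent \<Delta> \<and>
     (\<forall>\<beta>\<in>\<Phi>. \<exists>c :: 'a \<Rightarrow> int.
        \<beta> = (\<Sum>\<alpha>\<in>\<Delta>. of_int (c \<alpha>) *\<^sub>R \<alpha>) \<and>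
        ((\<forall>\<alpha>\<in>\<Delta>. c \<alpha> \<ge> 0) \<or> (\<forall>\<alpha>\<in>\<Delta>. c \<alpha> \<le> 0)))"

definition simple_based_root_system :: "'a::euclidean_space set \<Rightarrow> 'a set \<Rightarrow> bool" where
  "simple_based_root_system \<Phi> \<Delta> \<longleftrightarrow>
     root_system \<Phi> \<and> irreducible_root_system \<Phi> \<and> is_base \<Phi> \<Delta>"

definition refl_prod :: "'a::euclidean_space list \<Rightarrow> 'a \<Rightarrow> 'a" where
  "refl_prod xs = foldr (\<lambda>\<alpha> w. refl \<alpha> \<circ> w) xs id"

definition weyl_group :: "'a::euclidean_space set \<Rightarrow> ('a \<Rightarrow> 'a) set" where
  "weyl_group \<Phi> = {refl_prod xs | xs. set xs \<subseteq> \<Phi>}"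

definition weyl_length :: "'a::euclidean_space set \<Rightarrow> ('a \<Rightarrow> 'a) \<Rightarrow> nat" where
  "weyl_length \<Delta> w = (LEAST n. \<exists>xs. length xs = n \<and> set xs \<subseteq> \<Delta> \<and> w = refl_prod xs)"

definition weyl_sign :: "'a::euclidean_space set \<Rightarrow> ('a \<Rightarrow> 'a) \<Rightarrow> int" where
  "weyl_sign \<Delta> w = (-1) ^ weyl_length \<Delta> w"

definition weight_lattice :: "'a::euclidean_space set \<Rightarrow> 'a set" where
  "weight_lattice \<Phi> = {lam. \<forall>\<alpha>\<in>\<Phi>. mult_at \<alpha> lam \<in> \<int>}"

definition dominant_regular :: "'a::euclidean_space set \<Rightarrow> 'a set \<Rightarrow> 'a \<Rightarrow> bool" where
  "dominant_regular \<Phi> \<Delta> lam \<longleftrightarrow> lam \<in> weight_lattice \<Phi> \<and> (\<forall>\<alpha>\<in>\<Delta>. mult_at \<alpha> lam > 0)"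

text \<open>For regular mu: mu divides lambda iff m_alpha(mu) | m_alpha(lambda) for all simple alpha.\<close>

definition weight_dvd :: "'a::euclidean_space set \<Rightarrow> 'a \<Rightarrow> 'a \<Rightarrow> bool" where
  "weight_dvd \<Delta> mu lam \<longleftrightarrow> (\<forall>\<alpha>\<in>\<Delta>. \<exists>k::int. mult_at \<alpha> lam = of_int k * mult_at \<alpha> mu)"

definition fund_weight :: "'a::euclidean_space set \<Rightarrow> 'a \<Rightarrow> 'a" where
  "fund_weight \<Delta> \<alpha> = (THE v. \<forall>\<beta>\<in>\<Delta>. mult_at \<beta> v = (if \<beta> = \<alpha> then 1 else 0))"

definition rho :: "'a::euclidean_space set \<Rightarrow> 'a" where
  "rho \<Delta> = (\<Sum>\<alpha>\<in>\<Delta>. fund_weight \<Delta> \<alpha>)"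

definition long_sqlen :: "'a::euclidean_space set \<Rightarrow> real" where
  "long_sqlen \<Phi> = Max ((\<lambda>\<alpha>. \<alpha> \<bullet> \<alpha>) ` \<Phi>)"

definition short_sqlen :: "'a::euclidean_space set \<Rightarrow> real" where
  "short_sqlen \<Phi> = Min ((\<lambda>\<alpha>. \<alpha> \<bullet> \<alpha>) ` \<Phi>)"

definition mPhi :: "'a::euclidean_space set \<Rightarrow> real" where
  "mPhi \<Phi> = long_sqlen \<Phi> / short_sqlen \<Phi>"

text \<open>rho-tilde: coefficient m(Phi) on short simple roots, 1 on long simple roots
  (in the simply laced case all roots are long and rho-tilde = rho).\<close>

definition rho_tilde :: "'a::euclidean_space set \<Rightarrow> 'a set \<Rightarrow> 'a" where
  "rho_tilde \<Phi> \<Delta> = (\<Sum>\<alpha>\<in>\<Delta>. (if \<alpha> \<bullet> \<alpha> = long_sqlen \<Phi> then 1 else mPhi \<Phi>) *\<^sub>R fund_weight \<Delta> \<alpha>)"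

text \<open>Z[P] is realised inside the group ring Z[E] (finitely supported int functions) of E (convolution product),
  as the elements supported in the weight lattice; e^lambda = single lambda 1.\<close>

definition in_ZP :: "'a::euclidean_space set \<Rightarrow> ('a \<Rightarrow>\<^sub>0 int) \<Rightarrow> bool" where
  "in_ZP \<Phi> f \<longleftrightarrow> Poly_Mapping.keys f \<subseteq> weight_lattice \<Phi>"

definition altsum :: "'a::euclidean_space set \<Rightarrow> 'a set \<Rightarrow> 'a \<Rightarrow> ('a \<Rightarrow>\<^sub>0 int)" where
  "altsum \<Phi> \<Delta> lam = (\<Sum>w\<in>weyl_group \<Phi>. Poly_Mapping.single (w lam) (weyl_sign \<Delta> w))"

definition anti_invariant :: "'a::euclidean_space set \<Rightarrow> 'a set \<Rightarrow> ('a \<Rightarrow>\<^sub>0 int) \<Rightarrow> bool" where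
  "anti_invariant \<Phi> \<Delta> f \<longleftrightarrow>
     (\<forall>w\<in>weyl_group \<Phi>. \<forall>mu. Poly_Mapping.lookup f (w mu) = weyl_sign \<Delta> w * Poly_Mapping.lookup f mu)"

definition dom_le :: "'a::euclidean_space set \<Rightarrow> 'a \<Rightarrow> 'a \<Rightarrow> bool" where
  "dom_le \<Delta> nu mu \<longleftrightarrow> (\<exists>c :: 'a \<Rightarrow> nat. mu - nu = (\<Sum>\<alpha>\<in>\<Delta>. of_nat (c \<alpha>) *\<^sub>R \<alpha>))"

definition pos_lead_coeff :: "'a::euclidean_space set \<Rightarrow> ('a \<Rightarrow>\<^sub>0 int) \<Rightarrow> bool" where
  "pos_lead_coeff \<Delta> f \<longleftrightarrow>
     (\<exists>mu. Poly_Mapping.lookup f mu > 0 \<and> (\<forall>nu\<in>Poly_Mapping.keys f. dom_le \<Delta> nu mu))"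

definition D_generators :: "'a::euclidean_space set \<Rightarrow> 'a set \<Rightarrow> 'a \<Rightarrow> ('a \<Rightarrow>\<^sub>0 int) set" where
  "D_generators \<Phi> \<Delta> lam =
     {altsum \<Phi> \<Delta> (real d *\<^sub>R rho \<Delta>) | d::nat. d > 0 \<and>
        weight_dvd \<Delta> (real d *\<^sub>R rho \<Delta>) lam \<and> real d *\<^sub>R rho \<Delta> \<noteq> lam} \<union>
     {altsum \<Phi> \<Delta> (real e *\<^sub>R rho_tilde \<Phi> \<Delta>) | e::nat. e > 0 \<and>
        weight_dvd \<Delta> (real e *\<^sub>R rho_tilde \<Phi> \<Delta>) lam \<and> real e *\<^sub>R rho_tilde \<Phi> \<Delta> \<noteq> lam}"

text \<open>Divisibility between anti-invariant elements, with W-invariant cofactor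
  (i.e. divisibility in the sense of Z[P]^W).\<close>

definition inv_dvd :: "'a::euclidean_space set \<Rightarrow> ('a \<Rightarrow>\<^sub>0 int) \<Rightarrow> ('a \<Rightarrow>\<^sub>0 int) \<Rightarrow> bool" where
  "inv_dvd \<Phi> f g \<longleftrightarrow> (\<exists>q. in_ZP \<Phi> q \<and> (\<forall>w\<in>weyl_group \<Phi>. \<forall>mu. Poly_Mapping.lookup q (w mu) = Poly_Mapping.lookup q mu) \<and> g = f * q)"

text \<open>D is D(lambda): the normalised lcm of the generators (the empty lcm being 1).
  The lcm is taken among anti-invariant elements, with W-invariant cofactors.\<close>

definition is_D :: "'a::euclidean_space set \<Rightarrow> 'a set \<Rightarrow> 'a \<Rightarrow> ('a \<Rightarrow>\<^sub>0 int) \<Rightarrow> bool" where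
  "is_D \<Phi> \<Delta> lam D \<longleftrightarrow>
     (if D_generators \<Phi> \<Delta> lam = {} then D = 1 else
     in_ZP \<Phi> D \<and> anti_invariant \<Phi> \<Delta> D \<and>
     (\<forall>g\<in>D_generators \<Phi> \<Delta> lam. inv_dvd \<Phi> g D) \<and>
     (\<forall>M. in_ZP \<Phi> M \<and> anti_invariant \<Phi> \<Delta> M \<and> (\<forall>g\<in>D_generators \<Phi> \<Delta> lam. inv_dvd \<Phi> g M)
          \<longrightarrow> inv_dvd \<Phi> D M) \<and>
     pos_lead_coeff \<Delta> D)"

end

theory Submission
  imports Defs
begin

text \<open>
  Write \<open>S(\<lambda>)\<close> for the alternating sum. From \<open>S(\<lambda>\<^sub>1) S(\<mu>\<^sub>2) = S(\<lambda>\<^sub>2) S(\<mu>\<^sub>1)\<close> we read off coefficients close to the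
  leading exponent: near \<open>\<lambda>\<close> the only terms of \<open>S(\<lambda>)\<close> are
  \<open>(-1)\<^bsup>|I|\<^esup> e\<^bsup>\<lambda> - \<Sum> m\<^sub>\<alpha>(\<lambda>) \<alpha>\<^esup>\<close> with \<open>I\<close> a set of pairwise orthogonal simple roots. Single roots give
  \<open>{m\<^sub>\<alpha>(\<lambda>\<^sub>1), m\<^sub>\<alpha>(\<mu>\<^sub>2)} = {m\<^sub>\<alpha>(\<lambda>\<^sub>2), m\<^sub>\<alpha>(\<mu>\<^sub>1)}\<close> for all \<open>\<alpha>\<close>, and a shortest path in the Dynkin diagram between two
  nodes at which these multisets are matched differently gives a coefficient that is nonzero on exactly one side.

  For the second part, the generators of a weight that is no multiple of \<open>\<rho>\<close> or of its variant for the dual root system have a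
  greatest element \<open>\<mu>\<close> for divisibility, so that the least common multiple is \<open>S(\<mu>)\<close> and the first part applies. If
  \<open>\<lambda>\<^sub>2\<close> is a multiple, restricting to the edges of the Newton polytope and comparing zeros at roots of
  unity shows that its generators have a greatest element as well.
\<close>

subsection \<open>Group rings\<close>

text \<open>Exponents are treated as arbitrary vectors, with degrees measured by heights
  \<open>\<kappa> \<bullet> h\<close> for strictly dominant \<open>h\<close>. Cancellation and
  bounds on cofactors come from the unique highest term of an alternating sum. For
  \<open>S(\<mu>)\<close> to divide \<open>S(\<lambda>)\<close>, the weights divisible by
  \<open>\<mu>\<close> should form a lattice stable under the Weyl group. Multiples of \<rho> have
  this property because reflections act through the Cartan matrix; multiples of its variant have it
  because they act through the transposed matrix. The obstacle in the second part is a multiple of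
  \<rho>, say by \<open>n\<close>: its generators include the multiples by all proper divisors of
  \<open>n\<close>, and these need not have a greatest element, so the least common multiple is not
  visibly an alternating sum. Two facts about it suffice: every generator divides it, and its
  product with \<open>S(\<lambda>\<^sub>1)\<close> is \<open>S(\<mu>) S(\<lambda>\<^sub>2)\<close>.
  The elementary arithmetic rests on the ratio of squared root lengths being 1 or a prime.\<close>

abbreviation "lookup \<equiv> Poly_Mapping.lookup"
abbreviation "keys \<equiv> Poly_Mapping.keys"
abbreviation "single \<equiv> Poly_Mapping.single"

lemma poly_mapping_eq_sum_single:
  fixes f :: "'k \<Rightarrow>\<^sub>0 int"
  shows "f = (\<Sum>k\<in>keys f. single k (lookup f k))"
proof (rule poly_mapping_eqI)
  fix k
  have "(\<Sum>x\<in>keys f. lookup (single x (lookup f x)) k)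
      = (\<Sum>x\<in>keys f. if x = k then lookup f x else 0)"
    by (intro sum.cong) (auto simp: lookup_single)
  then show "lookup f k = lookup
      (\<Sum>k\<in>keys f. single k (lookup f k)) k"
    by (simp add: lookup_sum in_keys_iff)
qed

text \<open>The linear extension of a function on exponents. An indicator extracts a coefficient, a
  multiplicative function evaluates the element, and \<open>face_weight\<close> combines the
  two.\<close>

definition weighted_sum :: "('k \<Rightarrow> 'b::comm_ring_1) \<Rightarrow> ('k \<Rightarrow>\<^sub>0 int) \<Rightarrow> 'b" where
  "weighted_sum \<phi> f = (\<Sum>k\<in>keys f. of_int (lookup f k) * \<phi> k)"

lemma weighted_sum_superset:
  assumes "finite A" "keys f \<subseteq> A"
  shows "weighted_sum \<phi> f = (\<Sum>k\<in>A. of_int (lookup f k) * \<phi> k)"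
  unfolding weighted_sum_def using assms
  by (intro sum.mono_neutral_left) (auto simp: in_keys_iff)

lemma weighted_sum_zero [simp]: "weighted_sum \<phi> 0 = 0"
  by (simp add: weighted_sum_def)

lemma weighted_sum_add: "weighted_sum \<phi> (f + g) = weighted_sum \<phi> f + weighted_sum \<phi> g"
proof -
  let ?A = "keys f \<union> keys g"
  have "keys (f + g) \<subseteq> ?A"
    by (rule keys_add)
  then show ?thesis
    by (simp add: weighted_sum_superset[of ?A] lookup_add algebra_simps sum.distrib)
qed

lemma weighted_sum_sum: "weighted_sum \<phi> (sum f A) = (\<Sum>x\<in>A. weighted_sum \<phi> (f x))"
  by (induction A rule: infinite_finite_induct) (auto simp: weighted_sum_add)

lemma weighted_sum_single [simp]: "weighted_sum \<phi> (single k c) = of_int c * \<phi> k"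
  by (simp add: weighted_sum_superset[of "{k}"])

lemma lookup_eq_weighted_sum:
  "lookup f k = weighted_sum (\<lambda>x. if x = k then 1 else 0) f"
proof -
  have "weighted_sum (\<lambda>x. if x = k then 1 else (0::int)) f
      = (\<Sum>x\<in>insert k (keys f). if x = k then lookup f x else 0)"
    by (subst weighted_sum_superset[OF finite.insertI[OF finite_keys] subset_insertI])
       (intro sum.cong, auto)
  then show ?thesis by simp
qed

lemma mult_eq_sum_single:
  fixes f g :: "'k::comm_monoid_add \<Rightarrow>\<^sub>0 int"
  shows "f * g = (\<Sum>a\<in>keys f. \<Sum>b\<in>keys g.
    single (a + b) (lookup f a * lookup g b))"
  by (subst (1) poly_mapping_eq_sum_single[of f], subst (1) poly_mapping_eq_sum_single[of g])
     (simp add: sum_product mult_single)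

lemma weighted_sum_mult:
  fixes f g :: "'k::comm_monoid_add \<Rightarrow>\<^sub>0 int"
  shows "weighted_sum \<phi> (f * g) = (\<Sum>a\<in>keys f. \<Sum>b\<in>keys g.
    of_int (lookup f a) * of_int (lookup g b) * \<phi> (a + b))"
  by (simp add: mult_eq_sum_single weighted_sum_sum)

lemma weighted_sum_mult_split:
  fixes f g :: "'k::comm_monoid_add \<Rightarrow>\<^sub>0 int"
  assumes "\<And>a b. a \<in> keys f \<Longrightarrow> b \<in> keys g \<Longrightarrow> \<phi> (a + b) = \<phi>1 a * \<phi>2 b"
  shows "weighted_sum \<phi> (f * g) = weighted_sum \<phi>1 f * weighted_sum \<phi>2 g"
proof -
  have "weighted_sum \<phi> (f * g) = (\<Sum>a\<in>keys f. \<Sum>b\<in>keys g.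
    (of_int (lookup f a) * \<phi>1 a) * (of_int (lookup g b) * \<phi>2 b))"
    unfolding weighted_sum_mult by (intro sum.cong) (auto simp: assms algebra_simps)
  then show ?thesis
    by (simp add: weighted_sum_def sum_product)
qed

lemma lookup_mult_superset:
  fixes f g :: "'k::ab_group_add \<Rightarrow>\<^sub>0 int"
  assumes "finite A" "keys f \<subseteq> A"
  shows "lookup (f * g) k
    = (\<Sum>a\<in>A. lookup f a * lookup g (k - a))"
proof -
  have "lookup (f * g) k = (\<Sum>a\<in>keys f. \<Sum>b\<in>keys g.
    lookup f a * lookup g b * (if a + b = k then 1 else 0))"
    by (simp add: lookup_eq_weighted_sum[of _ k] weighted_sum_mult)
  also have "\<dots> = (\<Sum>a\<in>keys f. \<Sum>b\<in>keys g.
    if b = k - a then lookup f a * lookup g b else 0)"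
    by (intro sum.cong) (auto simp: algebra_simps)
  also have "\<dots> = (\<Sum>a\<in>keys f. lookup f a * lookup g (k - a))"
    by (intro sum.cong) (auto simp: in_keys_iff)
  also have "\<dots> = (\<Sum>a\<in>A. lookup f a * lookup g (k - a))"
    using assms by (intro sum.mono_neutral_left) (auto simp: in_keys_iff)
  finally show ?thesis .
qed

lemma keys_sum_single_subset:
  "keys (\<Sum>x\<in>A. single (f x) (c x)) \<subseteq> f ` A"
  by (induction A rule: infinite_finite_induct)
     (auto dest!: keys_add[THEN subsetD] split: if_splits)

text \<open>No cancellation can occur at \<open>a + \<tau>\<close>: every other exponent of
  \<open>f\<close> is lower in direction \<open>h\<close>, so its partner in \<open>q\<close> would
  have to be higher than \<open>\<tau>\<close>.\<close>

lemma lookup_mult_top: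
  fixes f q :: "'a::real_inner \<Rightarrow>\<^sub>0 int"
  assumes f: "\<And>\<kappa>. \<kappa> \<in> keys f \<Longrightarrow> \<kappa> \<noteq> a \<Longrightarrow> \<kappa> \<bullet> h < a \<bullet> h"
    and q: "\<And>\<kappa>. \<kappa> \<in> keys q \<Longrightarrow> \<kappa> \<bullet> h \<le> \<tau> \<bullet> h"
  shows "lookup (f * q) (a + \<tau>) = lookup f a * lookup q \<tau>"
proof -
  let ?A = "insert a (keys f)"
  have "lookup (f * q) (a + \<tau>)
      = (\<Sum>b\<in>?A. lookup f b * lookup q (a + \<tau> - b))"
    by (intro lookup_mult_superset) auto
  also have "\<dots> = (\<Sum>b\<in>{a}. lookup f b * lookup q (a + \<tau> - b))"
  proof (rule sum.mono_neutral_right)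
    show "\<forall>b\<in>?A - {a}. lookup f b * lookup q (a + \<tau> - b) = 0"
    proof
      fix b assume "b \<in> ?A - {a}"
      then have "b \<bullet> h < a \<bullet> h" using f by auto
      then have "\<not> (a + \<tau> - b) \<bullet> h \<le> \<tau> \<bullet> h"
        by (simp add: inner_diff_left inner_add_left)
      then have "lookup q (a + \<tau> - b) = 0"
        using q in_keys_iff by metis
      then show "lookup f b * lookup q (a + \<tau> - b) = 0" by simp
    qed
  qed auto
  finally show ?thesis by simp
qed

text \<open>A highest exponent of \<open>q\<close> added to \<open>a\<close> survives in the product
  by \<open>lookup_mult_top\<close>, so a height bound on the product is inherited by the
  cofactor.\<close>

lemma keys_cofactor_bound:
  fixes f q :: "'a::real_inner \<Rightarrow>\<^sub>0 int"
  assumes "\<And>\<kappa>. \<kappa> \<in> keys f \<Longrightarrow> \<kappa> \<noteq> a \<Longrightarrow> \<kappa> \<bullet> h < a \<bullet> h" "a \<in> keys f"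
    and "\<And>\<kappa>. \<kappa> \<in> keys (f * q) \<Longrightarrow> \<kappa> \<bullet> h \<le> c"
    and "\<tau> \<in> keys q"
  shows "(a + \<tau>) \<bullet> h \<le> c"
proof -
  have fin: "finite ((\<lambda>\<kappa>. \<kappa> \<bullet> h) ` keys q)" by simp
  obtain \<tau>' where \<tau>': "\<tau>' \<in> keys q" "\<And>\<kappa>. \<kappa> \<in> keys q \<Longrightarrow> \<kappa> \<bullet> h \<le> \<tau>' \<bullet> h"
    using Max_in[OF fin] Max_ge[OF fin] assms(4) by (metis (no_types, lifting) empty_iff image_iff)
  have "a + \<tau>' \<in> keys (f * q)"
    using lookup_mult_top[OF assms(1) \<tau>'(2)] \<tau>'(1) assms(2) by (simp add: in_keys_iff)
  then have "(a + \<tau>') \<bullet> h \<le> c" by (rule assms(3))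
  then show ?thesis using \<tau>'(2)[OF assms(4)] by (simp add: inner_add_left)
qed

subsection \<open>Reflections\<close>

lemma mult_at_eq: "mult_at \<alpha> x = 2 * (\<alpha> \<bullet> x) / (\<alpha> \<bullet> \<alpha>)"
  by (simp add: mult_at_def coroot_def)

lemma mult_at_add: "mult_at \<alpha> (x + y) = mult_at \<alpha> x + mult_at \<alpha> y"
  and mult_at_diff: "mult_at \<alpha> (x - y) = mult_at \<alpha> x - mult_at \<alpha> y"
  and mult_at_scale: "mult_at \<alpha> (c *\<^sub>R x) = c * mult_at \<alpha> x"
  by (simp_all add: mult_at_def algebra_simps)

lemma mult_at_sum: "mult_at \<alpha> (sum f A) = (\<Sum>x\<in>A. mult_at \<alpha> (f x))"
  by (simp add: mult_at_def inner_sum_right)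

lemma mult_at_self [simp]: "\<alpha> \<noteq> 0 \<Longrightarrow> mult_at \<alpha> \<alpha> = 2"
  by (simp add: mult_at_eq)

lemma mult_at_pos_iff:
  assumes "\<alpha> \<noteq> 0"
  shows "mult_at \<alpha> x > 0 \<longleftrightarrow> \<alpha> \<bullet> x > 0"
proof -
  obtain c where "c = 2 / (\<alpha> \<bullet> \<alpha>)" "c > 0" using assms by simp
  then show ?thesis by (simp add: mult_at_def coroot_def zero_less_mult_iff flip: \<open>c = _\<close>)
qed

lemma mult_at_nonneg_iff:
  assumes "\<alpha> \<noteq> 0"
  shows "mult_at \<alpha> x \<ge> 0 \<longleftrightarrow> \<alpha> \<bullet> x \<ge> 0"
proof -
  have "2 / (\<alpha> \<bullet> \<alpha>) > 0" using assms by simp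
  then show ?thesis by (simp only: mult_at_def coroot_def inner_scaleR_left zero_le_mult_iff) linarith
qed

lemma linear_refl: "linear (refl \<alpha>)"
  by (rule linearI) (simp_all add: refl_def mult_at_add mult_at_scale algebra_simps)

lemma inner_refl_left: "refl \<alpha> x \<bullet> y = x \<bullet> refl \<alpha> y"
  by (simp add: refl_def mult_at_eq algebra_simps inner_commute)

lemma refl_refl [simp]: "refl \<alpha> (refl \<alpha> x) = x"
proof (cases "\<alpha> = 0")
  case False
  then show ?thesis
    by (simp add: refl_def mult_at_diff mult_at_scale algebra_simps)
qed (simp add: refl_def)

lemma inner_refl_refl: "refl \<alpha> x \<bullet> refl \<alpha> y = x \<bullet> y"
  by (simp add: inner_refl_left)

lemma refl_self: "refl \<alpha> \<alpha> = - \<alpha>"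
proof (cases "\<alpha> = 0")
  case False
  then show ?thesis
    by (simp add: refl_def scaleR_2)
qed (simp add: refl_def)

lemma refl_eq_self: "\<alpha> \<bullet> x = 0 \<Longrightarrow> refl \<alpha> x = x"
  by (simp add: refl_def mult_at_eq)

lemma refl_prod_Nil [simp]: "refl_prod [] = id"
  and refl_prod_Cons [simp]: "refl_prod (\<alpha> # xs) = refl \<alpha> \<circ> refl_prod xs"
  by (simp_all add: refl_prod_def)

lemma refl_prod_append: "refl_prod (xs @ ys) = refl_prod xs \<circ> refl_prod ys"
  by (induction xs) (auto simp: comp_assoc)

lemma linear_refl_prod: "linear (refl_prod xs)"
proof (induction xs)
  case Nil
  then show ?case by (simp add: linear_id[unfolded id_def] id_def)
next
  case (Cons a xs)
  then show ?case using linear_compose[OF Cons.IH linear_refl] by (simp only: refl_prod_Cons)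
qed

lemma inner_refl_prod: "refl_prod xs x \<bullet> refl_prod xs y = x \<bullet> y"
  by (induction xs arbitrary: x y) (auto simp: inner_refl_refl)

lemma refl_prod_rev_left [simp]: "refl_prod (rev xs) (refl_prod xs x) = x"
  by (induction xs arbitrary: x) (auto simp: refl_prod_append)

lemma refl_prod_rev_right [simp]: "refl_prod xs (refl_prod (rev xs) x) = x"
  using refl_prod_rev_left[of "rev xs" x] by simp

lemma inner_refl_prod_left: "refl_prod xs x \<bullet> y = x \<bullet> refl_prod (rev xs) y"
  using inner_refl_prod[of xs x "refl_prod (rev xs) y"] by simp

lemma refl_conj:
  assumes "linear w" "\<And>x y. w x \<bullet> w y = x \<bullet> y"
  shows "refl (w \<alpha>) (w x) = w (refl \<alpha> x)"
  by (simp add: refl_def mult_at_eq assms linear_diff[OF assms(1)] linear_cmul[OF assms(1)])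

lemma refl_refl_prod:
  "refl (refl_prod xs \<alpha>) = refl_prod (xs @ [\<alpha>] @ rev xs)"
proof
  fix x
  have "refl (refl_prod xs \<alpha>) (refl_prod xs (refl_prod (rev xs) x))
    = refl_prod xs (refl \<alpha> (refl_prod (rev xs) x))"
    by (rule refl_conj) (simp_all add: linear_refl_prod inner_refl_prod)
  then show "refl (refl_prod xs \<alpha>) x = refl_prod (xs @ [\<alpha>] @ rev xs) x"
    by (simp add: refl_prod_append)
qed

subsection \<open>Bases and fundamental weights\<close>

text \<open>Irreducibility is added where it enters: for connectedness of the simple roots and for
  the comparison of root lengths.\<close>

locale based_root_system =
  fixes \<Phi> \<Delta> :: "'a::euclidean_space set"
  assumes root_system: "root_system \<Phi>" and base: "is_base \<Phi> \<Delta>"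
begin

abbreviation W where "W \<equiv> weyl_group \<Phi>"
abbreviation S where "S \<equiv> altsum \<Phi> \<Delta>"
abbreviation sgn_W where "sgn_W \<equiv> weyl_sign \<Delta>"
abbreviation \<omega> where "\<omega> \<equiv> fund_weight \<Delta>"
abbreviation \<rho> where "\<rho> \<equiv> rho \<Delta>"
abbreviation \<rho>t where "\<rho>t \<equiv> rho_tilde \<Phi> \<Delta>"

lemma finite_roots: "finite \<Phi>"
  and root_nonzero: "\<alpha> \<in> \<Phi> \<Longrightarrow> \<alpha> \<noteq> 0"
  and span_roots: "span \<Phi> = UNIV"
  and root_integral: "\<alpha> \<in> \<Phi> \<Longrightarrow> \<beta> \<in> \<Phi> \<Longrightarrow> mult_at \<alpha> \<beta> \<in> \<int>"
  and root_reduced: "\<alpha> \<in> \<Phi> \<Longrightarrow> c *\<^sub>R \<alpha> \<in> \<Phi> \<Longrightarrow> c = 1 \<or> c = -1"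
  using root_system by (auto simp: root_system_def)

lemma refl_root: "\<alpha> \<in> \<Phi> \<Longrightarrow> \<beta> \<in> \<Phi> \<Longrightarrow> refl \<alpha> \<beta> \<in> \<Phi>"
  using root_system by (auto simp: root_system_def)

lemma minus_root: "\<alpha> \<in> \<Phi> \<Longrightarrow> - \<alpha> \<in> \<Phi>"
  using refl_root[of \<alpha> \<alpha>] by (simp add: refl_self)

lemma simple_root: "\<alpha> \<in> \<Delta> \<Longrightarrow> \<alpha> \<in> \<Phi>"
  and independent_base: "independent \<Delta>"
  using base by (auto simp: is_base_def)

lemma simple_nonzero: "\<alpha> \<in> \<Delta> \<Longrightarrow> \<alpha> \<noteq> 0"
  using simple_root root_nonzero by blast

lemma finite_base: "finite \<Delta>"
  using finite_subset[OF _ finite_roots] simple_root by blast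

lemma inner_simple_pos: "\<alpha> \<in> \<Delta> \<Longrightarrow> \<alpha> \<bullet> \<alpha> > 0"
  using simple_nonzero by auto

lemma span_simple_roots: "span \<Delta> = UNIV"
proof -
  have "\<Phi> \<subseteq> span \<Delta>"
  proof
    fix \<beta> assume "\<beta> \<in> \<Phi>"
    then obtain c :: "'a \<Rightarrow> int" where "\<beta> = (\<Sum>\<alpha>\<in>\<Delta>. of_int (c \<alpha>) *\<^sub>R \<alpha>)"
      using base unfolding is_base_def by metis
    then show "\<beta> \<in> span \<Delta>"
      by (auto intro: span_sum span_scale span_base)
  qed
  then show ?thesis
    using span_minimal[OF _ subspace_span, of \<Phi> \<Delta>] span_roots by auto
qed

lemma eq_if_inner_base_eq:
  assumes "\<And>\<alpha>. \<alpha> \<in> \<Delta> \<Longrightarrow> \<alpha> \<bullet> x = \<alpha> \<bullet> y"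
  shows "x = y"
proof -
  have "\<Delta> \<subseteq> {v. v \<bullet> (x - y) = 0}"
    using assms by (auto simp: inner_diff_right)
  moreover have "subspace {v. v \<bullet> (x - y) = 0}"
    by (auto simp: subspace_def algebra_simps)
  ultimately have "x - y \<in> {v. v \<bullet> (x - y) = 0}"
    using span_minimal[of \<Delta> "{v. v \<bullet> (x - y) = 0}"] span_simple_roots by blast
  then have "(x - y) \<bullet> (x - y) = 0" by (rule CollectD)
  then show ?thesis by (simp only: inner_eq_zero_iff right_minus_eq)
qed

lemma eq_if_mult_at_eq:
  assumes "\<And>\<alpha>. \<alpha> \<in> \<Delta> \<Longrightarrow> mult_at \<alpha> x = mult_at \<alpha> y"
  shows "x = y"
proof (rule eq_if_inner_base_eq)
  fix \<alpha> assume "\<alpha> \<in> \<Delta>"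
  then show "\<alpha> \<bullet> x = \<alpha> \<bullet> y"
    using assms[of \<alpha>] simple_nonzero[of \<alpha>] by (simp add: mult_at_eq)
qed

text \<open>The definite description is legitimate: prescribed values on the independent set extend
  to a linear functional, which is represented by a vector, and that vector is unique because the
  simple roots span.\<close>

lemma mult_at_fund_weight:
  assumes "\<alpha> \<in> \<Delta>" "\<beta> \<in> \<Delta>"
  shows "mult_at \<beta> (\<omega> \<alpha>) = (if \<beta> = \<alpha> then 1 else 0)"
proof -
  obtain f :: "'a \<Rightarrow> real" where f: "linear f"
    "\<And>x. x \<in> \<Delta> \<Longrightarrow> f x = (if x = \<alpha> then x \<bullet> x / 2 else 0)"
    using linear_independent_extend[OF independent_base, of "\<lambda>x. if x = \<alpha> then x \<bullet> x / 2 else 0"]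
    by auto
  \<comment> \<open>The adjoint of a functional into the reals, applied to 1, is the vector
    representing it.\<close>
  define v where "v = adjoint f 1"
  have "x \<bullet> v = f x" for x
    using adjoint_works[OF f(1), of x 1] by (simp add: v_def)
  then have v: "\<forall>\<beta>\<in>\<Delta>. mult_at \<beta> v = (if \<beta> = \<alpha> then 1 else 0)"
    using f(2) simple_nonzero by (auto simp: mult_at_eq)
  then have "\<forall>\<beta>\<in>\<Delta>. mult_at \<beta> (\<omega> \<alpha>) = (if \<beta> = \<alpha> then 1 else 0)"
    unfolding fund_weight_def
  proof (rule theI)
    fix u assume "\<forall>\<beta>\<in>\<Delta>. mult_at \<beta> u = (if \<beta> = \<alpha> then 1 else 0)"
    with v show "u = v"
      by (intro eq_if_mult_at_eq) simp
  qed
  then show ?thesis using assms by auto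
qed

lemma mult_at_rho: "\<alpha> \<in> \<Delta> \<Longrightarrow> mult_at \<alpha> \<rho> = 1"
  by (simp add: rho_def mult_at_sum mult_at_fund_weight finite_base)

lemma rho_pos: "\<alpha> \<in> \<Delta> \<Longrightarrow> \<alpha> \<bullet> \<rho> > 0"
  using mult_at_rho mult_at_pos_iff simple_nonzero by (metis zero_less_one)

text \<open>The coordinate at \<open>\<gamma>\<close> with respect to the base: the fundamental
  weights are dual to the simple coroots, hence after rescaling to the simple roots.\<close>

definition coef :: "'a \<Rightarrow> 'a \<Rightarrow> real" where
  "coef \<gamma> v = 2 * (\<omega> \<gamma> \<bullet> v) / (\<gamma> \<bullet> \<gamma>)"

lemma coef_add: "coef \<gamma> (x + y) = coef \<gamma> x + coef \<gamma> y"
  and coef_diff: "coef \<gamma> (x - y) = coef \<gamma> x - coef \<gamma> y"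
  and coef_minus: "coef \<gamma> (- x) = - coef \<gamma> x"
  and coef_scale: "coef \<gamma> (c *\<^sub>R x) = c * coef \<gamma> x"
  and coef_zero [simp]: "coef \<gamma> 0 = 0"
  by (simp_all add: coef_def algebra_simps add_divide_distrib diff_divide_distrib)

lemma coef_sum: "coef \<gamma> (sum f A) = (\<Sum>x\<in>A. coef \<gamma> (f x))"
  by (induction A rule: infinite_finite_induct) (auto simp: coef_add)

lemma coef_simple: "\<gamma> \<in> \<Delta> \<Longrightarrow> \<beta> \<in> \<Delta> \<Longrightarrow> coef \<gamma> \<beta> = (if \<beta> = \<gamma> then 1 else 0)"
  using mult_at_fund_weight[of \<gamma> \<beta>] inner_simple_pos[of \<beta>]
  by (auto simp: coef_def mult_at_eq inner_commute)

lemma coef_sum_base: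
  assumes "\<gamma> \<in> \<Delta>" "A \<subseteq> \<Delta>"
  shows "coef \<gamma> (\<Sum>\<alpha>\<in>A. c \<alpha> *\<^sub>R \<alpha>) = (if \<gamma> \<in> A then c \<gamma> else 0)"
proof -
  have fin: "finite A" using assms(2) finite_base finite_subset by blast
  have "coef \<gamma> (\<Sum>\<alpha>\<in>A. c \<alpha> *\<^sub>R \<alpha>) = (\<Sum>\<alpha>\<in>A. if \<alpha> = \<gamma> then c \<alpha> else 0)"
    using assms by (auto simp: coef_sum coef_scale coef_simple subset_iff intro!: sum.cong)
  then show ?thesis using fin by auto
qed

lemma sum_coef: "v = (\<Sum>\<gamma>\<in>\<Delta>. coef \<gamma> v *\<^sub>R \<gamma>)"
proof -
  have "v \<in> span \<Delta>" by (simp add: span_simple_roots)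
  then obtain c where c: "v = (\<Sum>\<alpha>\<in>\<Delta>. c \<alpha> *\<^sub>R \<alpha>)"
    using span_finite[OF finite_base] by auto
  then have "coef \<gamma> v = c \<gamma>" if "\<gamma> \<in> \<Delta>" for \<gamma>
    using coef_sum_base[OF that order_refl, of c] that by simp
  then show ?thesis using c by simp
qed

lemma eq_if_coef_eq:
  assumes "\<And>\<gamma>. \<gamma> \<in> \<Delta> \<Longrightarrow> coef \<gamma> x = coef \<gamma> y"
  shows "x = y"
  using assms sum_coef[of x] sum_coef[of y] by (metis (no_types, lifting) sum.cong)

lemma inner_eq_sum_coef: "v \<bullet> x = (\<Sum>\<gamma>\<in>\<Delta>. coef \<gamma> v * (\<gamma> \<bullet> x))"
  by (subst sum_coef) (simp add: inner_sum_left)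

lemma inner_nonneg_if_coef_nonneg:
  assumes "\<And>\<gamma>. \<gamma> \<in> \<Delta> \<Longrightarrow> coef \<gamma> v \<ge> 0" "\<And>\<gamma>. \<gamma> \<in> \<Delta> \<Longrightarrow> \<gamma> \<bullet> x \<ge> 0"
  shows "v \<bullet> x \<ge> 0"
  unfolding inner_eq_sum_coef[of v] using assms by (intro sum_nonneg) auto

lemma inner_pos_if_coef_nonneg:
  assumes "\<And>\<gamma>. \<gamma> \<in> \<Delta> \<Longrightarrow> coef \<gamma> v \<ge> 0" "\<And>\<gamma>. \<gamma> \<in> \<Delta> \<Longrightarrow> \<gamma> \<bullet> x > 0" "v \<noteq> 0"
  shows "v \<bullet> x > 0"
proof -
  obtain \<gamma> where \<gamma>: "\<gamma> \<in> \<Delta>" "coef \<gamma> v \<noteq> 0"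
    using assms(3) eq_if_coef_eq[of v 0] by auto
  have "(\<Sum>\<gamma>\<in>\<Delta>. coef \<gamma> v * (\<gamma> \<bullet> x)) > 0"
    using assms(1)[of \<gamma>] assms(2)[of \<gamma>] \<gamma> assms(1,2)
    by (intro sum_pos2[OF finite_base \<gamma>(1)]) (auto simp: less_le)
  then show ?thesis by (simp add: inner_eq_sum_coef[of v])
qed

text \<open>Positivity is tested by the pairing with \<rho>, a single inequality;
  \<open>positive_root_coef_nonneg\<close> recovers the description by coordinates.\<close>

definition positive_root where "positive_root \<beta> \<longleftrightarrow> \<beta> \<in> \<Phi> \<and> \<beta> \<bullet> \<rho> > 0"

lemma root_coef_sign:
  assumes "\<beta> \<in> \<Phi>"
  shows "(\<forall>\<gamma>\<in>\<Delta>. coef \<gamma> \<beta> \<ge> 0) \<or> (\<forall>\<gamma>\<in>\<Delta>. coef \<gamma> \<beta> \<le> 0)"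
proof -
  obtain c :: "'a \<Rightarrow> int" where c: "\<beta> = (\<Sum>\<alpha>\<in>\<Delta>. of_int (c \<alpha>) *\<^sub>R \<alpha>)"
    "(\<forall>\<alpha>\<in>\<Delta>. c \<alpha> \<ge> 0) \<or> (\<forall>\<alpha>\<in>\<Delta>. c \<alpha> \<le> 0)"
    using base assms unfolding is_base_def by metis
  have "coef \<gamma> \<beta> = of_int (c \<gamma>)" if "\<gamma> \<in> \<Delta>" for \<gamma>
    using coef_sum_base[OF that order_refl, of "\<lambda>x. of_int (c x)"] that c(1) by simp
  then show ?thesis using c(2) by auto
qed

lemma positive_root_or_minus:
  assumes "\<beta> \<in> \<Phi>"
  shows "positive_root \<beta> \<or> positive_root (- \<beta>)"
proof -
  consider "\<forall>\<gamma>\<in>\<Delta>. coef \<gamma> \<beta> \<ge> 0" | "\<forall>\<gamma>\<in>\<Delta>. coef \<gamma> (- \<beta>) \<ge> 0"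
    using root_coef_sign[OF assms] by (auto simp: coef_minus)
  then show ?thesis
  proof cases
    case 1
    then show ?thesis
      using inner_pos_if_coef_nonneg[of \<beta> \<rho>] rho_pos root_nonzero assms by (auto simp: positive_root_def)
  next
    case 2
    then show ?thesis
      using inner_pos_if_coef_nonneg[of "- \<beta>" \<rho>] rho_pos root_nonzero assms minus_root
      by (auto simp: positive_root_def)
  qed
qed

lemma positive_root_coef_nonneg:
  assumes "positive_root \<beta>" "\<gamma> \<in> \<Delta>"
  shows "coef \<gamma> \<beta> \<ge> 0"
proof (rule ccontr)
  assume neg: "\<not> coef \<gamma> \<beta> \<ge> 0"
  then have "\<forall>\<gamma>\<in>\<Delta>. coef \<gamma> (- \<beta>) \<ge> 0"
    using root_coef_sign[of \<beta>] assms by (auto simp: positive_root_def coef_minus)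
  then have "(- \<beta>) \<bullet> \<rho> \<ge> 0"
    using inner_nonneg_if_coef_nonneg[of "- \<beta>" \<rho>] rho_pos by (auto simp: less_imp_le)
  then show False using assms by (auto simp: positive_root_def)
qed

lemma positive_rootI: "\<beta> \<in> \<Phi> \<Longrightarrow> \<gamma> \<in> \<Delta> \<Longrightarrow> coef \<gamma> \<beta> > 0 \<Longrightarrow> positive_root \<beta>"
  using positive_root_or_minus[of \<beta>] positive_root_coef_nonneg[of "- \<beta>" \<gamma>]
  by (auto simp: coef_minus)

lemma positive_root_simple: "\<alpha> \<in> \<Delta> \<Longrightarrow> positive_root \<alpha>"
  using rho_pos simple_root by (auto simp: positive_root_def)

text \<open>The reflection changes only the coordinate at \<alpha>. As the system is reduced, a
  positive root other than \<alpha> has a positive coordinate elsewhere, and one positive coordinate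
  makes a root positive.\<close>

lemma positive_root_refl:
  assumes "\<alpha> \<in> \<Delta>" "positive_root \<beta>" "\<beta> \<noteq> \<alpha>"
  shows "positive_root (refl \<alpha> \<beta>)"
proof -
  have b: "\<beta> \<in> \<Phi>" using assms by (simp add: positive_root_def)
  have "\<exists>\<gamma>\<in>\<Delta>. \<gamma> \<noteq> \<alpha> \<and> coef \<gamma> \<beta> > 0"
  proof (rule ccontr)
    assume "\<not> ?thesis"
    then have *: "coef \<gamma> \<beta> = 0" if "\<gamma> \<in> \<Delta>" "\<gamma> \<noteq> \<alpha>" for \<gamma>
      using that positive_root_coef_nonneg[OF assms(2), of \<gamma>] by force
    have "\<beta> = coef \<alpha> \<beta> *\<^sub>R \<alpha>"
      by (rule eq_if_coef_eq) (use * assms(1) in \<open>auto simp: coef_scale coef_simple\<close>)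
    moreover from this have "coef \<alpha> \<beta> = 1 \<or> coef \<alpha> \<beta> = -1"
      using root_reduced[of \<alpha> "coef \<alpha> \<beta>"] b simple_root[OF assms(1)] by simp
    ultimately show False
      using positive_root_coef_nonneg[OF assms(2,1)] assms(3) by auto
  qed
  then obtain \<gamma> where \<gamma>: "\<gamma> \<in> \<Delta>" "\<gamma> \<noteq> \<alpha>" "coef \<gamma> \<beta> > 0" by auto
  then have "coef \<gamma> (refl \<alpha> \<beta>) > 0"
    using assms(1) by (simp add: refl_def coef_diff coef_scale coef_simple)
  then show ?thesis
    using \<gamma> refl_root[of \<alpha> \<beta>] b simple_root[OF assms(1)] positive_rootI by blast
qed


subsection \<open>The Weyl group\<close>

text \<open>Descent on the height: since \<open>\<beta> \<bullet> \<beta> > 0\<close>, some simple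
  root has positive inner product with \<open>\<beta>\<close>, and reflecting in it lowers the
  pairing with \<rho> while keeping \<open>\<beta>\<close> positive unless \<open>\<beta>\<close> is
  simple.\<close>

lemma root_conj_simple_positive:
  assumes "positive_root \<beta>"
  shows "\<exists>xs \<alpha>. set xs \<subseteq> \<Delta> \<and> \<alpha> \<in> \<Delta> \<and> \<beta> = refl_prod xs \<alpha>"
  using assms
proof (induction "card {\<gamma>\<in>\<Phi>. \<gamma> \<bullet> \<rho> < \<beta> \<bullet> \<rho>}" arbitrary: \<beta> rule: less_induct)
  case less
  have b: "\<beta> \<in> \<Phi>" using less.prems by (simp add: positive_root_def)
  show ?case
  proof (cases "\<beta> \<in> \<Delta>")
    case True
    then show ?thesis by (intro exI[of _ "[]"] exI[of _ \<beta>]) auto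
  next
    case False
    have "\<not> (\<forall>\<gamma>\<in>\<Delta>. coef \<gamma> \<beta> * (\<gamma> \<bullet> \<beta>) \<le> 0)"
    proof
      assume "\<forall>\<gamma>\<in>\<Delta>. coef \<gamma> \<beta> * (\<gamma> \<bullet> \<beta>) \<le> 0"
      then have "\<beta> \<bullet> \<beta> \<le> 0"
        unfolding inner_eq_sum_coef[of \<beta> \<beta>] by (intro sum_nonpos) auto
      then show False using root_nonzero[OF b] by (metis inner_gt_zero_iff not_le)
    qed
    then obtain \<gamma> where \<gamma>: "\<gamma> \<in> \<Delta>" "\<gamma> \<bullet> \<beta> > 0"
      using positive_root_coef_nonneg[OF less.prems] by (metis linorder_not_le mult_nonneg_nonpos)
    let ?b = "refl \<gamma> \<beta>"
    have pos: "positive_root ?b"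
      using positive_root_refl[OF \<gamma>(1) less.prems] False \<gamma>(1) by auto
    have lt: "?b \<bullet> \<rho> < \<beta> \<bullet> \<rho>"
      using \<gamma> rho_pos[OF \<gamma>(1)] mult_at_pos_iff[OF simple_nonzero[OF \<gamma>(1)], of \<beta>]
      by (simp add: refl_def inner_diff_left)
    have "card {\<gamma>\<in>\<Phi>. \<gamma> \<bullet> \<rho> < ?b \<bullet> \<rho>} < card {\<gamma>\<in>\<Phi>. \<gamma> \<bullet> \<rho> < \<beta> \<bullet> \<rho>}"
      using lt pos finite_roots by (intro psubset_card_mono) (auto simp: positive_root_def)
    from less.hyps[OF this pos] obtain xs \<alpha> where
      "set xs \<subseteq> \<Delta>" "\<alpha> \<in> \<Delta>" "?b = refl_prod xs \<alpha>" by auto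
    then show ?thesis
      using \<gamma>(1) by (intro exI[of _ "\<gamma> # xs"] exI[of _ \<alpha>]) (auto simp flip: \<open>?b = _\<close>)
  qed
qed

lemma root_conj_simple:
  assumes "\<beta> \<in> \<Phi>"
  shows "\<exists>xs \<alpha>. set xs \<subseteq> \<Delta> \<and> \<alpha> \<in> \<Delta> \<and> \<beta> = refl_prod xs \<alpha>"
proof (cases "positive_root \<beta>")
  case False
  then obtain xs \<alpha> where xs: "set xs \<subseteq> \<Delta>" "\<alpha> \<in> \<Delta>" "- \<beta> = refl_prod xs \<alpha>"
    using positive_root_or_minus[OF assms] root_conj_simple_positive by blast
  then have "\<beta> = refl_prod xs (refl \<alpha> \<alpha>)"
    using linear_neg[OF linear_refl_prod, of xs \<alpha>] by (simp add: refl_self flip: xs(3))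
  then show ?thesis
    using xs by (intro exI[of _ "xs @ [\<alpha>]"] exI[of _ \<alpha>]) (auto simp: refl_prod_append)
qed (rule root_conj_simple_positive)

text \<open>Every root is an image of a simple root under a word in simple reflections, and the
  reflection in that image is a conjugate of the simple reflection by the word.\<close>

lemma weyl_group_simple: "W = {refl_prod xs | xs. set xs \<subseteq> \<Delta>}"
proof (intro equalityI subsetI)
  fix w assume "w \<in> W"
  then obtain xs where xs: "set xs \<subseteq> \<Phi>" "w = refl_prod xs"
    by (auto simp: weyl_group_def)
  have "\<exists>ys. set ys \<subseteq> \<Delta> \<and> refl_prod xs = refl_prod ys"
    using xs(1)
  proof (induction xs)
    case (Cons \<beta> xs)
    then obtain ys where ys: "set ys \<subseteq> \<Delta>" "refl_prod xs = refl_prod ys" by auto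
    obtain zs \<alpha> where zs: "set zs \<subseteq> \<Delta>" "\<alpha> \<in> \<Delta>" "\<beta> = refl_prod zs \<alpha>"
      using root_conj_simple[of \<beta>] Cons.prems by auto
    then have "refl_prod (\<beta> # xs) = refl_prod ((zs @ [\<alpha>] @ rev zs) @ ys)"
      unfolding refl_prod_append[of _ ys] by (simp add: refl_refl_prod ys)
    then show ?case
      using ys zs by (intro exI[of _ "(zs @ [\<alpha>] @ rev zs) @ ys"]) auto
  qed (auto intro: exI[of _ "[]"])
  then show "w \<in> {refl_prod xs | xs. set xs \<subseteq> \<Delta>}" using xs by auto
next
  fix w assume "w \<in> {refl_prod xs | xs. set xs \<subseteq> \<Delta>}"
  then show "w \<in> W" using simple_root by (auto simp: weyl_group_def)
qed

lemma id_weyl: "id \<in> W"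
  by (auto simp: weyl_group_def intro!: exI[of _ "[]"])

lemma refl_weyl: "\<alpha> \<in> \<Phi> \<Longrightarrow> refl \<alpha> \<in> W"
  by (auto simp: weyl_group_def intro!: exI[of _ "[\<alpha>]"])

lemma comp_weyl: "u \<in> W \<Longrightarrow> v \<in> W \<Longrightarrow> u \<circ> v \<in> W"
  unfolding weyl_group_def
  by (auto simp flip: refl_prod_append) (metis le_sup_iff set_append)

lemma linear_weyl: "w \<in> W \<Longrightarrow> linear w"
  and inner_weyl: "w \<in> W \<Longrightarrow> w x \<bullet> w y = x \<bullet> y"
  by (auto simp: weyl_group_def linear_refl_prod inner_refl_prod)

lemma norm_weyl: "w \<in> W \<Longrightarrow> norm (w x) = norm x"
  by (simp add: norm_eq_sqrt_inner inner_weyl)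

lemma weyl_inverse:
  assumes "w \<in> W"
  obtains v where "v \<in> W" "\<And>x. v (w x) = x" "\<And>x. w (v x) = x"
proof -
  from assms obtain xs where xs: "set xs \<subseteq> \<Phi>" "w = refl_prod xs" by (auto simp: weyl_group_def)
  then have "refl_prod (rev xs) \<in> W" unfolding weyl_group_def by (metis (mono_tags) mem_Collect_eq set_rev)
  then show ?thesis using xs by (intro that[of "refl_prod (rev xs)"]) auto
qed

lemma weyl_root: "w \<in> W \<Longrightarrow> \<beta> \<in> \<Phi> \<Longrightarrow> w \<beta> \<in> \<Phi>"
proof -
  assume "w \<in> W" "\<beta> \<in> \<Phi>"
  then obtain xs where xs: "set xs \<subseteq> \<Phi>" "w = refl_prod xs" by (auto simp: weyl_group_def)
  from xs(1) have "refl_prod xs \<beta> \<in> \<Phi>"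
    by (induction xs) (auto simp: refl_root \<open>\<beta> \<in> \<Phi>\<close>)
  then show ?thesis by (simp add: xs)
qed

lemma bij_weyl: "w \<in> W \<Longrightarrow> bij w"
  by (metis weyl_inverse bijI')

lemma bij_betw_comp_weyl:
  assumes "w \<in> W"
  shows "bij_betw (\<lambda>u. w \<circ> u) W W"
proof -
  obtain v where v: "v \<in> W" "\<And>x. v (w x) = x" "\<And>x. w (v x) = x"
    using weyl_inverse[OF assms] by metis
  show ?thesis
    by (rule bij_betw_byWitness[of _ "\<lambda>u. v \<circ> u"])
       (auto simp: fun_eq_iff v comp_weyl assms)
qed

text \<open>The group acts faithfully on the finite set of roots, because the roots span.\<close>

lemma finite_weyl: "finite W"
proof -
  have "inj_on (\<lambda>w. restrict w \<Phi>) W"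
  proof (rule inj_onI)
    fix u v assume uv: "u \<in> W" "v \<in> W" "restrict u \<Phi> = restrict v \<Phi>"
    then have "u x = v x" if "x \<in> \<Phi>" for x
      using that by (metis restrict_apply')
    then show "u = v"
      using linear_eq_on_span[OF linear_weyl[OF uv(1)] linear_weyl[OF uv(2)], of \<Phi>] span_roots
      by auto
  qed
  moreover have "(\<lambda>w. restrict w \<Phi>) ` W \<subseteq> PiE \<Phi> (\<lambda>_. \<Phi>)"
    using weyl_root by auto
  then have "finite ((\<lambda>w. restrict w \<Phi>) ` W)"
    using finite_subset finite_PiE finite_roots by metis
  ultimately show ?thesis
    using finite_image_iff by blast
qed

text \<open>The exchange property: reading the word from the right, the image of \<alpha> turns
  negative at some letter, and that letter can be deleted.\<close>

lemma refl_prod_exchange: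
  assumes "set xs \<subseteq> \<Delta>" "\<alpha> \<in> \<Delta>" "\<not> positive_root (refl_prod xs \<alpha>)"
  shows "\<exists>ys. set ys \<subseteq> \<Delta> \<and> Suc (length ys) = length xs \<and> refl_prod xs \<circ> refl \<alpha> = refl_prod ys"
  using assms(1,3)
proof (induction xs)
  case Nil
  then show ?case using positive_root_simple[OF assms(2)] by simp
next
  case (Cons \<beta> xs)
  show ?case
  proof (cases "positive_root (refl_prod xs \<alpha>)")
    case False
    then obtain ys where "set ys \<subseteq> \<Delta>" "Suc (length ys) = length xs"
      "refl_prod xs \<circ> refl \<alpha> = refl_prod ys"
      using Cons.IH Cons.prems(1) by (metis set_subset_Cons subset_trans)
    then show ?thesis
      using Cons.prems by (intro exI[of _ "\<beta> # ys"]) (auto simp: fun_eq_iff)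
  next
    case True
    \<comment> \<open>The letter \<open>\<beta>\<close> makes this positive root negative, and
      \<open>\<beta>\<close> is the only positive root for which its reflection does so.\<close>
    then have "refl_prod xs \<alpha> = \<beta>"
      using positive_root_refl[of \<beta> "refl_prod xs \<alpha>"] Cons.prems by auto
    then have "refl \<beta> = refl_prod xs \<circ> refl \<alpha> \<circ> refl_prod (rev xs)"
      using refl_refl_prod[of xs \<alpha>] by (auto simp: refl_prod_append)
    then have "refl_prod (\<beta> # xs) \<circ> refl \<alpha> = refl_prod xs"
      by (auto simp: fun_eq_iff)
    then show ?thesis using Cons.prems(1) by (intro exI[of _ xs]) (simp del: refl_prod_Cons)
  qed
qed

text \<open>The parity of the number of positive roots made negative. It is attached to the group
  element and not to a word, which is how the sign is shown to be multiplicative.\<close>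

definition inversion_sign :: "('a \<Rightarrow> 'a) \<Rightarrow> int" where
  "inversion_sign w = (\<Prod>\<beta>\<in>{\<beta>. positive_root \<beta>}. if w \<beta> \<bullet> \<rho> > 0 then 1 else -1)"

lemma finite_positive_roots: "finite {\<beta>. positive_root \<beta>}"
  using finite_subset[OF _ finite_roots] by (auto simp: positive_root_def)

text \<open>A simple reflection \<open>refl \<alpha>\<close> permutes the positive roots other than \<open>\<alpha>\<close>.\<close>

lemma inversion_sign_comp_refl:
  assumes "w \<in> W" "\<alpha> \<in> \<Delta>"
  shows "inversion_sign (w \<circ> refl \<alpha>) = - inversion_sign w"
proof -
  let ?P = "{\<beta>. positive_root \<beta>} - {\<alpha>}" and ?f = "\<lambda>w \<beta>. if w \<beta> \<bullet> \<rho> > 0 then 1 else (-1::int)"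
  have P: "{\<beta>. positive_root \<beta>} = insert \<alpha> ?P"
    using positive_root_simple[OF assms(2)] by auto
  have fin: "finite ?P" using finite_positive_roots by simp
  have split: "inversion_sign u = ?f u \<alpha> * prod (?f u) ?P" for u
    unfolding inversion_sign_def by (subst P, subst prod.insert) (use fin in auto)
  have refl_P: "refl \<alpha> \<beta> \<in> ?P" if "\<beta> \<in> ?P" for \<beta>
  proof -
    have "refl \<alpha> \<beta> \<noteq> \<alpha>"
    proof
      assume "refl \<alpha> \<beta> = \<alpha>"
      then have "\<beta> = - \<alpha>" using refl_refl[of \<alpha> \<beta>] by (simp add: refl_self)
      then show False
        using that rho_pos[OF assms(2)] by (auto simp: positive_root_def)
    qed
    then show ?thesis using positive_root_refl[OF assms(2)] that by auto
  qed
  have "prod (?f (w \<circ> refl \<alpha>)) ?P = prod (?f w) ?P"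
    by (rule prod.reindex_bij_witness[of _ "refl \<alpha>" "refl \<alpha>"]) (use refl_P in auto)
  moreover have "?f (w \<circ> refl \<alpha>) \<alpha> = - ?f w \<alpha>"
  proof -
    have "w \<alpha> \<in> \<Phi>" using weyl_root assms simple_root by blast
    then have "w \<alpha> \<bullet> \<rho> \<noteq> 0" using positive_root_or_minus[of "w \<alpha>"] by (auto simp: positive_root_def)
    then show ?thesis using linear_neg[OF linear_weyl[OF assms(1)], of \<alpha>] by (auto simp: refl_self)
  qed
  ultimately show ?thesis using split[of w] split[of "w \<circ> refl \<alpha>"] by simp
qed

lemma inversion_sign_refl_prod:
  "set xs \<subseteq> \<Delta> \<Longrightarrow> inversion_sign (refl_prod xs) = (-1) ^ length xs"
proof (induction xs rule: rev_induct)
  case Nil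
  then show ?case
    by (auto simp: inversion_sign_def positive_root_def intro!: prod.neutral)
next
  case (snoc \<alpha> xs)
  then have "refl_prod xs \<in> W" by (auto simp: weyl_group_simple)
  moreover have "refl_prod (xs @ [\<alpha>]) = refl_prod xs \<circ> refl \<alpha>"
    by (auto simp: refl_prod_append)
  ultimately show ?case
    using snoc inversion_sign_comp_refl[of "refl_prod xs" \<alpha>] by (simp del: comp_apply)
qed

lemma reduced_word:
  assumes "w \<in> W"
  obtains xs where "set xs \<subseteq> \<Delta>" "w = refl_prod xs" "length xs = weyl_length \<Delta> w"
    "\<And>ys. set ys \<subseteq> \<Delta> \<Longrightarrow> w = refl_prod ys \<Longrightarrow> length xs \<le> length ys"
proof -
  let ?P = "\<lambda>n. \<exists>xs. length xs = n \<and> set xs \<subseteq> \<Delta> \<and> w = refl_prod xs"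
  have "\<exists>n. ?P n" using assms by (auto simp: weyl_group_simple)
  then have "?P (weyl_length \<Delta> w)"
    unfolding weyl_length_def by (rule LeastI_ex)
  then obtain xs where xs: "length xs = weyl_length \<Delta> w" "set xs \<subseteq> \<Delta>" "w = refl_prod xs" by auto
  moreover have "weyl_length \<Delta> w \<le> length ys" if "set ys \<subseteq> \<Delta>" "w = refl_prod ys" for ys
    unfolding weyl_length_def using that by (intro Least_le) auto
  ultimately show ?thesis using that by metis
qed

text \<open>A given word and a shortest word for the same element have lengths of equal parity,
  since both parities are given by \<open>inversion_sign\<close>.\<close>

lemma weyl_sign_refl_prod:
  assumes "set xs \<subseteq> \<Delta>"
  shows "sgn_W (refl_prod xs) = (-1) ^ length xs"
proof -
  have "refl_prod xs \<in> W" using assms by (auto simp: weyl_group_simple)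
  then obtain ys where "set ys \<subseteq> \<Delta>" "refl_prod xs = refl_prod ys"
    "length ys = weyl_length \<Delta> (refl_prod xs)" using reduced_word by metis
  then show ?thesis
    using inversion_sign_refl_prod[of xs] inversion_sign_refl_prod[of ys] assms
    by (simp add: weyl_sign_def)
qed

lemma weyl_sign_id [simp]: "sgn_W id = 1" "sgn_W (\<lambda>x. x) = 1"
  using weyl_sign_refl_prod[of "[]"] by (simp_all add: id_def)

lemma weyl_sign_refl: "\<alpha> \<in> \<Delta> \<Longrightarrow> sgn_W (refl \<alpha>) = -1"
  using weyl_sign_refl_prod[of "[\<alpha>]"] by simp

lemma weyl_sign_comp:
  assumes "u \<in> W" "v \<in> W"
  shows "sgn_W (u \<circ> v) = sgn_W u * sgn_W v"
proof -
  obtain xs ys where "set xs \<subseteq> \<Delta>" "u = refl_prod xs" "set ys \<subseteq> \<Delta>" "v = refl_prod ys"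
    using assms by (auto simp: weyl_group_simple)
  then show ?thesis
    using weyl_sign_refl_prod[of xs] weyl_sign_refl_prod[of ys] weyl_sign_refl_prod[of "xs @ ys"]
    by (simp add: refl_prod_append power_add)
qed

section \<open>The Weyl group and the dominant chamber\<close>

definition strictly_dominant :: "'a \<Rightarrow> bool" where
  "strictly_dominant lam \<longleftrightarrow> (\<forall>\<alpha>\<in>\<Delta>. \<alpha> \<bullet> lam > 0)"

definition dominant :: "'a \<Rightarrow> bool" where
  "dominant lam \<longleftrightarrow> (\<forall>\<alpha>\<in>\<Delta>. \<alpha> \<bullet> lam \<ge> 0)"

lemma strictly_dominant_imp_dominant: "strictly_dominant lam \<Longrightarrow> dominant lam"
  by (auto simp: strictly_dominant_def dominant_def less_imp_le)

lemma strictly_dominant_iff: "strictly_dominant lam \<longleftrightarrow> (\<forall>\<alpha>\<in>\<Delta>. mult_at \<alpha> lam > 0)"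
  using mult_at_pos_iff simple_nonzero by (auto simp: strictly_dominant_def)

lemma strictly_dominant_rho: "strictly_dominant \<rho>"
  using rho_pos by (auto simp: strictly_dominant_def)

text \<open>Peeling off the first letter of a reduced word: by the exchange property the remaining
  element keeps \<open>\<alpha>\<close> on the positive side.\<close>

lemma weyl_induct [consumes 1, case_names id refl]:
  assumes "w \<in> W" "P id"
    and step: "\<And>\<alpha> v. v \<in> W \<Longrightarrow> \<alpha> \<in> \<Delta> \<Longrightarrow> (\<And>lam. strictly_dominant lam \<Longrightarrow> \<alpha> \<bullet> v lam > 0) \<Longrightarrow>
      (\<And>lam. dominant lam \<Longrightarrow> \<alpha> \<bullet> v lam \<ge> 0) \<Longrightarrow> P v \<Longrightarrow> P (refl \<alpha> \<circ> v)"
  shows "P w"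
  using assms(1)
proof (induction "weyl_length \<Delta> w" arbitrary: w rule: less_induct)
  case less
  obtain xs where xs: "set xs \<subseteq> \<Delta>" "w = refl_prod xs" "length xs = weyl_length \<Delta> w"
    "\<And>ys. set ys \<subseteq> \<Delta> \<Longrightarrow> w = refl_prod ys \<Longrightarrow> length xs \<le> length ys"
    using reduced_word[OF less.prems] by metis
  show ?case
  proof (cases xs)
    case Nil
    then show ?thesis using xs assms(2) by simp
  next
    case (Cons \<alpha> zs)
    let ?v = "refl_prod zs"
    have v: "?v \<in> W" and \<alpha>: "\<alpha> \<in> \<Delta>" and zs: "set zs \<subseteq> \<Delta>"
      using xs(1) Cons by (auto simp: weyl_group_simple)
    have "weyl_length \<Delta> ?v \<le> length zs"
      unfolding weyl_length_def using zs by (intro Least_le) auto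
    then have IH: "P ?v" using less.hyps[of ?v] v xs(3) Cons by auto
    \<comment> \<open>The composition of \<open>refl_prod (rev zs)\<close> with
      \<open>refl \<alpha>\<close> is the inverse of \<open>w\<close>. If the root were negative,
      exchange would give a shorter word for this inverse, and its reversal would contradict the
      minimality of \<open>xs\<close>.\<close>
    have pos: "positive_root (refl_prod (rev zs) \<alpha>)"
    proof (rule ccontr)
      assume "\<not> ?thesis"
      then obtain ys where ys: "set ys \<subseteq> \<Delta>" "Suc (length ys) = length zs"
        "refl_prod (rev zs) \<circ> refl \<alpha> = refl_prod ys"
        using refl_prod_exchange[of "rev zs" \<alpha>] zs \<alpha> by (metis length_rev set_rev)
      have "refl_prod (rev ys) x = refl_prod xs x" for x
      proof -
        have "refl_prod (rev zs) (refl \<alpha> (refl \<alpha> (refl_prod zs x))) = x" by simp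
        then have "refl_prod ys (refl_prod xs x) = x"
          using ys(3) Cons by (metis comp_apply refl_prod_Cons)
        then show ?thesis using refl_prod_rev_left[of ys "refl_prod xs x"] by simp
      qed
      then have "w = refl_prod (rev ys)" unfolding xs(2) by (intro ext) (rule sym)
      then have "length xs \<le> length (rev ys)"
        using ys(1) by (intro xs(4)) auto
      then show False using ys(2) Cons by simp
    qed
    have nz: "refl_prod (rev zs) \<alpha> \<noteq> 0"
      using pos root_nonzero unfolding positive_root_def by blast
    have eq: "\<alpha> \<bullet> ?v lam = refl_prod (rev zs) \<alpha> \<bullet> lam" for lam
      using inner_refl_prod_left[of "rev zs" \<alpha> lam] by (simp only: rev_rev_ident)
    have sd: "\<alpha> \<bullet> ?v lam > 0" if "strictly_dominant lam" for lam
    proof -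
      have "refl_prod (rev zs) \<alpha> \<bullet> lam > 0"
        using inner_pos_if_coef_nonneg[of "refl_prod (rev zs) \<alpha>" lam]
          positive_root_coef_nonneg[OF pos] that nz by (simp add: strictly_dominant_def)
      then show ?thesis by (simp only: eq)
    qed
    have d: "\<alpha> \<bullet> ?v lam \<ge> 0" if "dominant lam" for lam
    proof -
      have "refl_prod (rev zs) \<alpha> \<bullet> lam \<ge> 0"
        using inner_nonneg_if_coef_nonneg[of "refl_prod (rev zs) \<alpha>" lam]
          positive_root_coef_nonneg[OF pos] that by (simp add: dominant_def)
      then show ?thesis by (simp only: eq)
    qed
    have "P (refl \<alpha> \<circ> ?v)"
      by (rule step[OF v \<alpha> sd d IH])
    then show ?thesis using xs(2) Cons by (simp only: refl_prod_Cons)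
  qed
qed

lemma coef_refl_same: "\<alpha> \<in> \<Delta> \<Longrightarrow> coef \<alpha> (refl \<alpha> x) = coef \<alpha> x - mult_at \<alpha> x"
  and coef_refl_other: "\<alpha> \<in> \<Delta> \<Longrightarrow> \<gamma> \<in> \<Delta> \<Longrightarrow> \<gamma> \<noteq> \<alpha> \<Longrightarrow> coef \<gamma> (refl \<alpha> x) = coef \<gamma> x"
  by (simp_all add: refl_def coef_diff coef_scale coef_simple)

text \<open>Each step of \<open>weyl_induct\<close> subtracts
  \<open>mult_at \<alpha> (v lam)\<close> times \<alpha>, and this factor is nonnegative on dominant
  vectors.\<close>

lemma coef_diff_weyl_nonneg:
  assumes "w \<in> W" "dominant lam" "\<gamma> \<in> \<Delta>"
  shows "coef \<gamma> (lam - w lam) \<ge> 0"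
  using assms(1)
proof (induction rule: weyl_induct)
  case id
  then show ?case by simp
next
  case (refl \<alpha> v)
  have "mult_at \<alpha> (v lam) \<ge> 0"
    using refl(4)[OF assms(2)] mult_at_nonneg_iff[OF simple_nonzero[OF refl(2)]] by blast
  then show ?case
    using refl(2,5) assms(3) coef_refl_same[of \<alpha> "v lam"] coef_refl_other[of \<alpha> \<gamma> "v lam"]
    by (cases "\<gamma> = \<alpha>") (auto simp: coef_diff)
qed

text \<open>On strictly dominant vectors the outermost reflection of a reduced word subtracts a
  strictly positive multiple of its root, and nothing compensates for it.\<close>

lemma weyl_stabilizer_trivial:
  assumes "w \<in> W" "strictly_dominant lam" "w lam = lam"
  shows "w = id"
proof -
  have "w = id \<or> (\<exists>\<gamma>\<in>\<Delta>. coef \<gamma> (lam - w lam) > 0)"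
    using assms(1)
  proof (induction rule: weyl_induct)
    case (refl \<alpha> v)
    have "mult_at \<alpha> (v lam) > 0"
      using refl(3)[OF assms(2)] mult_at_pos_iff[OF simple_nonzero[OF refl(2)]] by blast
    moreover have "coef \<alpha> (lam - v lam) \<ge> 0"
      using coef_diff_weyl_nonneg refl strictly_dominant_imp_dominant assms(2) by blast
    ultimately show ?case
      using refl(2) coef_refl_same[of \<alpha> "v lam"] by (auto simp: coef_diff intro!: bexI[of _ \<alpha>])
  qed simp
  then show ?thesis using assms(3) by auto
qed

lemma weyl_eq_if_eq_at:
  assumes "u \<in> W" "v \<in> W" "strictly_dominant lam" "u lam = v lam"
  shows "u = v"
proof -
  obtain v' where v': "v' \<in> W" "\<And>x. v' (v x) = x" "\<And>x. v (v' x) = x"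
    using weyl_inverse[OF assms(2)] by metis
  have "v' \<circ> u = id"
    by (rule weyl_stabilizer_trivial[of _ lam]) (auto simp: comp_weyl v' assms)
  then have "v (v' (u x)) = v x" for x by (metis comp_apply id_apply)
  then show ?thesis using v'(3) by auto
qed

lemma weyl_inner_le:
  assumes "w \<in> W" "dominant lam" "dominant h"
  shows "w lam \<bullet> h \<le> lam \<bullet> h"
proof -
  have "(lam - w lam) \<bullet> h \<ge> 0"
    using coef_diff_weyl_nonneg[OF assms(1,2)] assms(3)
      inner_nonneg_if_coef_nonneg[of "lam - w lam" h] by (simp add: dominant_def)
  then show ?thesis by (simp add: inner_diff_left)
qed

lemma weyl_inner_eqD:
  assumes "w \<in> W" "dominant lam" "strictly_dominant h" "w lam \<bullet> h \<ge> lam \<bullet> h"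
  shows "w lam = lam"
proof (rule ccontr)
  assume "w lam \<noteq> lam"
  then have "(lam - w lam) \<bullet> h > 0"
    using coef_diff_weyl_nonneg[OF assms(1,2)] assms(3)
      inner_pos_if_coef_nonneg[of "lam - w lam" h] by (simp add: strictly_dominant_def)
  then show False using assms(4) by (simp add: inner_diff_left)
qed

end

text \<open>The length is minimised over all pairs of endpoints in \<open>U\<close> and
  \<open>V\<close>, which keeps the interior out of both sets. A forward chord or a repeated vertex
  would shorten the path.\<close>

lemma shortest_path_between:
  assumes "(u, v) \<in> E\<^sup>*" "u \<in> U" "v \<in> V" "U \<inter> V = {}"
  obtains n :: nat and f where "n > 0" "f 0 \<in> U" "f n \<in> V" "\<And>i. i < n \<Longrightarrow> (f i, f (Suc i)) \<in> E"
    "\<And>i. 0 < i \<Longrightarrow> i \<le> n \<Longrightarrow> f i \<notin> U" "\<And>i. i < n \<Longrightarrow> f i \<notin> V" "inj_on f {..n}"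
    "\<And>i j. i \<le> n \<Longrightarrow> j \<le> n \<Longrightarrow> (f i, f j) \<in> E \<Longrightarrow> j \<le> Suc i"
proof -
  let ?P = "\<lambda>n. \<exists>u\<in>U. \<exists>v\<in>V. (u, v) \<in> E ^^ n"
  define n where "n = (LEAST n. ?P n)"
  have ex: "\<exists>n. ?P n" using assms(1-3) by (auto simp: rtrancl_power)
  have least: "n \<le> m" if "u \<in> U" "v \<in> V" "(u, v) \<in> E ^^ m" for u v m
    unfolding n_def using that by (intro Least_le) auto
  have "?P n" unfolding n_def by (rule LeastI_ex[OF ex])
  then obtain f where f: "f 0 \<in> U" "f n \<in> V" "\<And>i. i < n \<Longrightarrow> (f i, f (Suc i)) \<in> E"
    by (auto simp: relpow_fun_conv)
  have segment: "(f i, f j) \<in> E ^^ (j - i)" if "i \<le> j" "j \<le> n" for i j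
    unfolding relpow_fun_conv using that f(3) by (intro exI[of _ "\<lambda>k. f (i + k)"]) auto
  have head: "(f 0, f i) \<in> E ^^ i" and tail: "(f i, f n) \<in> E ^^ (n - i)" if "i \<le> n" for i
    using segment[of 0 i] segment[of i n] that by auto
  have npos: "n > 0"
    using f(1,2) assms(4) by (cases n) auto
  have notU: "f i \<notin> U" if "0 < i" "i \<le> n" for i
    using least[OF _ f(2) tail[OF that(2)]] that by auto
  have notV: "f i \<notin> V" if "i < n" for i
    using least[OF f(1) _ head[of i]] that by auto
  have chord: "j \<le> Suc i" if "i \<le> n" "j \<le> n" "(f i, f j) \<in> E" for i j
  proof -
    have "(f 0, f j) \<in> E ^^ Suc i"
      using head[OF that(1)] that(3) by auto
    then have "(f 0, f n) \<in> E ^^ (Suc i + (n - j))"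
      using tail[OF that(2)] unfolding relpow_add by (rule relcompI)
    then have "n \<le> Suc i + (n - j)" using least[OF f(1,2)] by blast
    then show ?thesis using that by linarith
  qed
  have ne: "f i \<noteq> f j" if "i < j" "j \<le> n" for i j
  proof
    assume eq: "f i = f j"
    have "(f 0, f n) \<in> E ^^ (i + (n - j))"
      using head[of i] tail[of j] that eq unfolding relpow_add by (intro relcompI[of _ "f i"]) auto
    then have "n \<le> i + (n - j)" using least[OF f(1,2)] by blast
    then show False using that by linarith
  qed
  have "inj_on f {..n}"
    by (rule inj_onI) (metis atMost_iff linorder_neqE_nat ne)
  then show ?thesis
    using that npos f notU notV chord by blast
qed

context based_root_system
begin

subsection \<open>Alternating sums\<close>

lemma weighted_sum_altsum: "weighted_sum \<phi> (S lam) = (\<Sum>w\<in>W. of_int (sgn_W w) * \<phi> (w lam))"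
  by (simp add: altsum_def weighted_sum_sum)

lemma lookup_altsum: "lookup (S lam) \<kappa> = (\<Sum>w\<in>W. if w lam = \<kappa> then sgn_W w else 0)"
  by (simp add: altsum_def lookup_sum lookup_single when_def)

lemma keys_altsum: "keys (S lam) \<subseteq> (\<lambda>w. w lam) ` W"
  unfolding altsum_def by (rule keys_sum_single_subset)

lemma lookup_altsum_weyl:
  assumes "strictly_dominant lam" "w \<in> W"
  shows "lookup (S lam) (w lam) = sgn_W w"
proof -
  have "(\<Sum>u\<in>W. if u lam = w lam then sgn_W u else 0) = (\<Sum>u\<in>W. if u = w then sgn_W u else 0)"
    using weyl_eq_if_eq_at[OF _ assms(2,1)] by (intro sum.cong) auto
  then show ?thesis
    using assms(2) finite_weyl by (simp add: lookup_altsum)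
qed

lemma lookup_altsum_self: "strictly_dominant lam \<Longrightarrow> lookup (S lam) lam = 1"
  using lookup_altsum_weyl[OF _ id_weyl] by simp

lemma altsum_top:
  assumes "strictly_dominant lam" "strictly_dominant h" "\<kappa> \<in> keys (S lam)" "\<kappa> \<noteq> lam"
  shows "\<kappa> \<bullet> h < lam \<bullet> h"
proof -
  obtain w where w: "w \<in> W" "\<kappa> = w lam" using assms(3) keys_altsum by blast
  then show ?thesis
    using weyl_inner_eqD[OF w(1) _ assms(2), of lam] strictly_dominant_imp_dominant[OF assms(1)] assms(4)
    by (meson not_le)
qed

lemma lookup_altsum_mult_top:
  assumes "strictly_dominant lam" "strictly_dominant h"
    and "\<And>\<kappa>. \<kappa> \<in> keys q \<Longrightarrow> \<kappa> \<bullet> h \<le> \<tau> \<bullet> h"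
  shows "lookup (S lam * q) (lam + \<tau>) = lookup q \<tau>"
  using lookup_mult_top[of "S lam" lam h q \<tau>] altsum_top[OF assms(1,2)] assms(3)
  by (simp add: lookup_altsum_self[OF assms(1)])

lemma keys_altsum_cofactor_bound:
  assumes "strictly_dominant lam" "strictly_dominant h"
    and "\<And>\<kappa>. \<kappa> \<in> keys (S lam * q) \<Longrightarrow> \<kappa> \<bullet> h \<le> c"
    and "\<tau> \<in> keys q"
  shows "(lam + \<tau>) \<bullet> h \<le> c"
proof (rule keys_cofactor_bound[of "S lam" lam h q c \<tau>])
  show "lam \<in> keys (S lam)"
    using lookup_altsum_self[OF assms(1)] by (simp add: in_keys_iff)
qed (use altsum_top[OF assms(1,2)] assms(3,4) in auto)

text \<open>If \<open>p - q\<close> had a key, the unique highest term of \<open>S lam\<close> would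
  bound the height of a translate of this key by every bound valid for the product. The product is
  zero, so every real number is such a bound.\<close>

lemma altsum_mult_cancel:
  assumes "strictly_dominant lam" "S lam * p = S lam * q"
  shows "p = q"
proof (rule ccontr)
  assume "p \<noteq> q"
  then obtain \<tau> where \<tau>: "\<tau> \<in> keys (p - q)"
    by (metis all_not_in_conv keys_eq_empty right_minus_eq)
  have 0: "S lam * (p - q) = 0" using assms(2) by (simp add: right_diff_distrib)
  have "(lam + \<tau>) \<bullet> lam \<le> c" for c
    by (rule keys_altsum_cofactor_bound[OF assms(1,1) _ \<tau>]) (simp add: 0)
  from this[of "(lam + \<tau>) \<bullet> lam - 1"] show False by simp
qed

subsection \<open>The leading part of an alternating sum\<close>

lemma simple_inner_nonpos:
  assumes "\<alpha> \<in> \<Delta>" "\<beta> \<in> \<Delta>" "\<alpha> \<noteq> \<beta>"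
  shows "mult_at \<alpha> \<beta> \<le> 0"
proof -
  have "positive_root (refl \<alpha> \<beta>)"
    using assms by (intro positive_root_refl positive_root_simple) auto
  then have "coef \<alpha> (refl \<alpha> \<beta>) \<ge> 0" using positive_root_coef_nonneg assms by blast
  then show ?thesis using assms by (simp add: coef_refl_same coef_simple)
qed

text \<open>Along a reduced word the reflection in \<alpha> subtracts
  \<open>mult_at \<alpha> (v lam)\<close> times \<alpha>, while the bound allows only
  \<open>mult_at \<alpha> lam\<close> in this direction. Since the Cartan integers of distinct
  simple roots are nonpositive, the first use of \<alpha> subtracts at least that much, with
  equality only if \<alpha> is orthogonal to all roots used before.\<close>

lemma weyl_small_difference:
  assumes "w \<in> W" "strictly_dominant lam" "\<And>\<gamma>. \<gamma> \<in> \<Delta> \<Longrightarrow> coef \<gamma> (lam - w lam) \<le> mult_at \<gamma> lam"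
  shows "\<exists>I\<subseteq>\<Delta>. pairwise orthogonal I \<and> lam - w lam = (\<Sum>\<gamma>\<in>I. mult_at \<gamma> lam *\<^sub>R \<gamma>)
    \<and> sgn_W w = (-1) ^ card I"
  using assms(1,3)
proof (induction rule: weyl_induct)
  case id
  then show ?case by (intro exI[of _ "{}"]) auto
next
  case (refl \<alpha> v)
  note [simp] = refl(2)
  let ?m = "mult_at \<alpha> (v lam)"
  have m: "?m > 0"
    using refl(3)[OF assms(2)] mult_at_pos_iff[OF simple_nonzero[OF refl(2)]] by blast
  have ca: "coef \<alpha> (lam - v lam) + ?m \<le> mult_at \<alpha> lam"
    using refl(6)[of \<alpha>] by (simp add: coef_diff coef_refl_same)
  have "coef \<gamma> (lam - v lam) \<le> mult_at \<gamma> lam" if "\<gamma> \<in> \<Delta>" for \<gamma>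
    using refl(6)[of \<gamma>] that m by (cases "\<gamma> = \<alpha>") (auto simp: coef_diff coef_refl_same coef_refl_other)
  from refl(5)[OF this] obtain I where I: "I \<subseteq> \<Delta>" "pairwise orthogonal I"
    "lam - v lam = (\<Sum>\<gamma>\<in>I. mult_at \<gamma> lam *\<^sub>R \<gamma>)" "sgn_W v = (-1) ^ card I" by auto
  have fin: "finite I" using I(1) finite_base finite_subset by blast
  have "coef \<alpha> (lam - v lam) = (if \<alpha> \<in> I then mult_at \<alpha> lam else 0)"
    unfolding I(3) by (rule coef_sum_base) (use I in auto)
  \<comment> \<open>A root of \<open>I\<close> has exhausted its allowance, and the new subtraction
    \<open>?m\<close> is positive.\<close>
  then have notin: "\<alpha> \<notin> I" and c0: "coef \<alpha> (lam - v lam) = 0"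
    using ca m by (auto split: if_splits)
  have "v lam = lam - (\<Sum>\<gamma>\<in>I. mult_at \<gamma> lam *\<^sub>R \<gamma>)" using I(3) by (simp add: algebra_simps)
  then have mv: "?m = mult_at \<alpha> lam - (\<Sum>\<gamma>\<in>I. mult_at \<gamma> lam * mult_at \<alpha> \<gamma>)"
    by (simp add: mult_at_diff mult_at_sum mult_at_scale)
  have pos: "mult_at \<gamma> lam > 0" if "\<gamma> \<in> I" for \<gamma>
    using assms(2) I(1) that by (auto simp: strictly_dominant_iff)
  have np: "mult_at \<gamma> lam * mult_at \<alpha> \<gamma> \<le> 0" if "\<gamma> \<in> I" for \<gamma>
    using pos[OF that] simple_inner_nonpos[of \<alpha> \<gamma>] that notin I(1)
    by (intro mult_nonneg_nonpos) auto
  \<comment> \<open>One inequality is the sign of the Cartan integers, the other is the allowance at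
    \<alpha>.\<close>
  have s: "(\<Sum>\<gamma>\<in>I. mult_at \<gamma> lam * mult_at \<alpha> \<gamma>) = 0"
  proof (rule antisym)
    show "(\<Sum>\<gamma>\<in>I. mult_at \<gamma> lam * mult_at \<alpha> \<gamma>) \<le> 0" by (intro sum_nonpos np)
    show "(\<Sum>\<gamma>\<in>I. mult_at \<gamma> lam * mult_at \<alpha> \<gamma>) \<ge> 0" using ca mv c0 by simp
  qed
  have "mult_at \<gamma> lam * mult_at \<alpha> \<gamma> = 0" if "\<gamma> \<in> I" for \<gamma>
    using sum_nonneg_eq_0_iff[OF fin, of "\<lambda>\<gamma>. - (mult_at \<gamma> lam * mult_at \<alpha> \<gamma>)"] np s that
    by (simp add: sum_negf)
  then have "mult_at \<alpha> \<gamma> = 0" if "\<gamma> \<in> I" for \<gamma> using pos that by force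
  then have orth: "\<alpha> \<bullet> \<gamma> = 0" if "\<gamma> \<in> I" for \<gamma>
    using that simple_nonzero[of \<alpha>] by (auto simp: mult_at_eq)
  have "lam - (refl \<alpha> \<circ> v) lam = (lam - v lam) + mult_at \<alpha> lam *\<^sub>R \<alpha>"
    using mv s by (simp add: refl_def)
  then have "lam - (refl \<alpha> \<circ> v) lam = (\<Sum>\<gamma>\<in>insert \<alpha> I. mult_at \<gamma> lam *\<^sub>R \<gamma>)"
    using fin notin by (simp add: I(3))
  moreover have "sgn_W (refl \<alpha> \<circ> v) = (-1) ^ card (insert \<alpha> I)"
    using fin notin weyl_sign_comp[OF refl_weyl[OF simple_root] refl(1), of \<alpha>]
    by (simp add: weyl_sign_refl I(4) del: comp_apply)
  moreover have "pairwise orthogonal (insert \<alpha> I)"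
    using orth I(2) by (auto simp: pairwise_insert orthogonal_def inner_commute)
  ultimately show ?case using I(1) refl(2) by (intro exI[of _ "insert \<alpha> I"]) (simp del: comp_apply)
qed

text \<open>The converse of \<open>weyl_small_difference\<close>: reflecting in a root orthogonal to
  the earlier ones finds the coordinate \<open>mult_at\<close> at this root unchanged.\<close>

lemma weyl_orthogonal_product:
  assumes "I \<subseteq> \<Delta>" "pairwise orthogonal I"
  shows "\<exists>w\<in>W. lam - w lam = (\<Sum>\<gamma>\<in>I. mult_at \<gamma> lam *\<^sub>R \<gamma>) \<and> sgn_W w = (-1) ^ card I"
proof -
  have "finite I" using assms finite_base finite_subset by blast
  then show ?thesis using assms
  proof (induction I)
    case empty
    then show ?case using id_weyl by (intro bexI[of _ id]) auto
  next
    case (insert \<alpha> I)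
    then obtain v where v: "v \<in> W" "lam - v lam = (\<Sum>\<gamma>\<in>I. mult_at \<gamma> lam *\<^sub>R \<gamma>)"
      "sgn_W v = (-1) ^ card I" by (auto simp: pairwise_insert)
    have \<alpha>: "\<alpha> \<in> \<Delta>" using insert by auto
    have "\<alpha> \<bullet> \<gamma> = 0" if "\<gamma> \<in> I" for \<gamma>
      using insert.prems(2) insert.hyps that by (auto simp: pairwise_insert orthogonal_def)
    then have "\<alpha> \<bullet> (lam - v lam) = 0"
      unfolding v(2) by (simp add: inner_sum_right)
    then have "mult_at \<alpha> (v lam) = mult_at \<alpha> lam" by (simp add: mult_at_eq inner_diff_right)
    then have "lam - (refl \<alpha> \<circ> v) lam = (lam - v lam) + mult_at \<alpha> lam *\<^sub>R \<alpha>"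
      by (simp add: refl_def)
    then have "lam - (refl \<alpha> \<circ> v) lam = (\<Sum>\<gamma>\<in>insert \<alpha> I. mult_at \<gamma> lam *\<^sub>R \<gamma>)"
      using insert.hyps by (simp add: v(2))
    moreover have "sgn_W (refl \<alpha> \<circ> v) = (-1) ^ card (insert \<alpha> I)"
      using insert.hyps weyl_sign_comp[OF refl_weyl[OF simple_root[OF \<alpha>]] v(1)] \<alpha>
      by (simp add: weyl_sign_refl v(3) del: comp_apply)
    moreover have "refl \<alpha> \<circ> v \<in> W"
      by (intro comp_weyl refl_weyl simple_root \<alpha> v(1))
    ultimately show ?case by blast
  qed
qed

text \<open>Regularity determines the group element from its value at \<open>lam\<close>, so the
  coefficient is a single sign; the bound on the coordinates of \<open>v\<close> leaves only
  products of orthogonal reflections.\<close>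

lemma lookup_altsum_leading:
  assumes "strictly_dominant lam" "\<And>\<gamma>. \<gamma> \<in> \<Delta> \<Longrightarrow> coef \<gamma> v \<le> mult_at \<gamma> lam"
  defines "I \<equiv> {\<gamma>\<in>\<Delta>. coef \<gamma> v \<noteq> 0}"
  shows "lookup (S lam) (lam - v) =
    (if pairwise orthogonal I \<and> (\<forall>\<gamma>\<in>I. coef \<gamma> v = mult_at \<gamma> lam) then (-1) ^ card I else 0)"
proof (cases "pairwise orthogonal I \<and> (\<forall>\<gamma>\<in>I. coef \<gamma> v = mult_at \<gamma> lam)")
  case True
  have "I \<subseteq> \<Delta>" by (auto simp: I_def)
  from weyl_orthogonal_product[OF this, of lam] True obtain w where
    w: "w \<in> W" "lam - w lam = (\<Sum>\<gamma>\<in>I. mult_at \<gamma> lam *\<^sub>R \<gamma>)" "sgn_W w = (-1) ^ card I" by auto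
  have "v = (\<Sum>\<gamma>\<in>\<Delta>. coef \<gamma> v *\<^sub>R \<gamma>)" by (rule sum_coef)
  also have "\<dots> = (\<Sum>\<gamma>\<in>I. coef \<gamma> v *\<^sub>R \<gamma>)"
    using finite_base by (intro sum.mono_neutral_right) (auto simp: I_def)
  also have "\<dots> = lam - w lam" unfolding w(2) using True by (intro sum.cong) auto
  finally have "lam - v = w lam" by simp
  then show ?thesis using lookup_altsum_weyl[OF assms(1) w(1)] w(3) True by simp
next
  case False
  have "\<not> (\<exists>w\<in>W. lam - v = w lam)"
  proof
    assume "\<exists>w\<in>W. lam - v = w lam"
    then obtain w where w': "w \<in> W" "lam - v = w lam" by blast
    then have w: "w \<in> W" "lam - w lam = v" by (auto simp flip: w'(2))
    from weyl_small_difference[OF w(1) assms(1)] obtain J where J: "J \<subseteq> \<Delta>" "pairwise orthogonal J"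
      "v = (\<Sum>\<gamma>\<in>J. mult_at \<gamma> lam *\<^sub>R \<gamma>)" using assms(2) by (auto simp: w(2))
    have c: "coef \<gamma> v = (if \<gamma> \<in> J then mult_at \<gamma> lam else 0)" if "\<gamma> \<in> \<Delta>" for \<gamma>
      unfolding J(3) by (rule coef_sum_base) (use J that in auto)
    have "mult_at \<gamma> lam \<noteq> 0" if "\<gamma> \<in> \<Delta>" for \<gamma>
      using assms(1) that by (force simp: strictly_dominant_iff)
    then have "\<gamma> \<in> I \<longleftrightarrow> \<gamma> \<in> J" for \<gamma> using c[of \<gamma>] J(1) by (auto simp: I_def split: if_splits)
    then have "I = J" by blast
    then show False using False J(1,2) c by (auto simp: subset_iff)
  qed
  then have "lookup (S lam) (lam - v) = 0"
    using keys_altsum[of lam] by (auto simp: in_keys_iff)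
  then show ?thesis using False by simp
qed

text \<open>The ways to distribute the descent by \<open>t \<gamma>\<close> at the nodes
  \<open>\<gamma>\<close> of \<open>K\<close> over the two factors: on \<open>I\<close> from
  \<open>lam\<close>, on \<open>K - I\<close> from \<open>mu\<close>, each through orthogonal
  reflections.\<close>

definition leading_splits where
  "leading_splits lam mu K t = {I. I \<subseteq> K \<and> pairwise orthogonal I \<and> pairwise orthogonal (K - I) \<and>
    (\<forall>\<gamma>\<in>I. mult_at \<gamma> lam = t \<gamma>) \<and> (\<forall>\<gamma>\<in>K - I. mult_at \<gamma> mu = t \<gamma>)}"

text \<open>A split contributes the signs of \<open>I\<close> and of \<open>K - I\<close>, whose
  product depends only on \<open>K\<close>. Hence contributions never cancel and the coefficient
  counts splits.\<close>

lemma lookup_altsum_mult_leading: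
  assumes lam: "strictly_dominant lam" and mu: "strictly_dominant mu" and K: "K \<subseteq> \<Delta>"
    and t: "\<And>\<gamma>. \<gamma> \<in> K \<Longrightarrow> 0 < t \<gamma> \<and> t \<gamma> \<le> mult_at \<gamma> lam \<and> t \<gamma> \<le> mult_at \<gamma> mu"
  shows "lookup (S lam * S mu) (lam + mu - (\<Sum>\<gamma>\<in>K. t \<gamma> *\<^sub>R \<gamma>))
    = (-1) ^ card K * int (card (leading_splits lam mu K t))"
proof -
  have finK: "finite K" using K finite_base finite_subset by blast
  let ?s = "\<lambda>I. \<Sum>\<gamma>\<in>I. t \<gamma> *\<^sub>R \<gamma>"
  let ?g = "\<lambda>I. lam - ?s I"
  let ?F = "\<lambda>a. lookup (S lam) a * lookup (S mu) (lam + mu - ?s K - a)"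
  have coef_s: "coef \<gamma> (?s I) = (if \<gamma> \<in> I then t \<gamma> else 0)" if "\<gamma> \<in> \<Delta>" "I \<subseteq> K" for \<gamma> I
    by (rule coef_sum_base) (use that K in auto)
  have supp_s: "{\<gamma>\<in>\<Delta>. coef \<gamma> (?s I) \<noteq> 0} = I" if "I \<subseteq> K" for I
  proof (intro equalityI subsetI)
    fix \<gamma> assume "\<gamma> \<in> {\<gamma>\<in>\<Delta>. coef \<gamma> (?s I) \<noteq> 0}"
    then show "\<gamma> \<in> I" using coef_s[of \<gamma>, OF _ that] by (simp split: if_splits)
  next
    fix \<gamma> assume "\<gamma> \<in> I"
    then have "\<gamma> \<in> \<Delta>" "t \<gamma> > 0" using that K t by blast+
    with \<open>\<gamma> \<in> I\<close> show "\<gamma> \<in> {\<gamma>\<in>\<Delta>. coef \<gamma> (?s I) \<noteq> 0}"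
      using coef_s[of \<gamma>, OF _ that] by simp
  qed
  have pos: "mult_at \<gamma> lam > 0" "mult_at \<gamma> mu > 0" if "\<gamma> \<in> \<Delta>" for \<gamma>
    using lam mu that by (auto simp: strictly_dominant_iff)
  have le_lam: "coef \<gamma> (?s I) \<le> mult_at \<gamma> lam" and le_mu: "coef \<gamma> (?s I) \<le> mult_at \<gamma> mu"
    if "\<gamma> \<in> \<Delta>" "I \<subseteq> K" for \<gamma> I
    using coef_s[OF that] t[of \<gamma>] that(2) pos[OF that(1)] by (cases "\<gamma> \<in> I"; force)+
  have look: "lookup (S lam) (?g I) = 
      (if pairwise orthogonal I \<and> (\<forall>\<gamma>\<in>I. mult_at \<gamma> lam = t \<gamma>) then (-1) ^ card I else 0)"
    and look': "lookup (S mu) (mu - ?s I) =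
      (if pairwise orthogonal I \<and> (\<forall>\<gamma>\<in>I. mult_at \<gamma> mu = t \<gamma>) then (-1) ^ card I else 0)"
    if "I \<subseteq> K" for I
  proof -
    have "coef \<gamma> (?s I) = t \<gamma>" if "\<gamma> \<in> I" for \<gamma>
      using coef_s[of \<gamma>, OF _ \<open>I \<subseteq> K\<close>] that \<open>I \<subseteq> K\<close> K by auto
    then have "(\<forall>\<gamma>\<in>I. coef \<gamma> (?s I) = c \<gamma>) \<longleftrightarrow> (\<forall>\<gamma>\<in>I. c \<gamma> = t \<gamma>)" for c
      by (metis (full_types))
    then show "lookup (S lam) (?g I) = (if pairwise orthogonal I \<and> (\<forall>\<gamma>\<in>I. mult_at \<gamma> lam = t \<gamma>) then (-1) ^ card I else 0)"
      and "lookup (S mu) (mu - ?s I) = (if pairwise orthogonal I \<and> (\<forall>\<gamma>\<in>I. mult_at \<gamma> mu = t \<gamma>) then (-1) ^ card I else 0)"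
      using lookup_altsum_leading[OF lam, of "?s I"] lookup_altsum_leading[OF mu, of "?s I"]
        le_lam[OF _ that] le_mu[OF _ that]
      by (simp_all only: supp_s[OF that])
  qed
  have val: "?F (?g I) = (if I \<in> leading_splits lam mu K t then (-1) ^ card K else 0)" if "I \<subseteq> K" for I
  proof -
    have fin: "finite I" using that finK finite_subset by blast
    have "lam + mu - ?s K - ?g I = mu - ?s (K - I)"
      using sum_diff[OF finK that, of "\<lambda>\<gamma>. t \<gamma> *\<^sub>R \<gamma>"] by (simp add: algebra_simps)
    then have F: "?F (?g I) = lookup (S lam) (?g I) * lookup (S mu) (mu - ?s (K - I))"
      by (simp only:)
    have sgn: "(-1 :: int) ^ card I * (-1) ^ card (K - I) = (-1) ^ card K"
      using card_Diff_subset[OF fin that] card_mono[OF finK that] by (simp flip: power_add)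
    show ?thesis
      unfolding F unfolding look[OF that] look'[OF Diff_subset] using that sgn by (auto simp: leading_splits_def)
  qed
  have inj: "inj_on ?g (Pow K)"
  proof (rule inj_onI)
    fix I J assume IJ: "I \<in> Pow K" "J \<in> Pow K" "?g I = ?g J"
    have s: "?s I = ?s J" using IJ(3) by (rule diff_left_imp_eq)
    have "I = {\<gamma>\<in>\<Delta>. coef \<gamma> (?s I) \<noteq> 0}"
      by (rule supp_s[symmetric]) (use IJ(1) in auto)
    also have "\<dots> = {\<gamma>\<in>\<Delta>. coef \<gamma> (?s J) \<noteq> 0}"
      by (simp only: s)
    also have "\<dots> = J"
      by (rule supp_s) (use IJ(2) in auto)
    finally show "I = J" .
  qed
  \<comment> \<open>Candidates that are no keys are added to the range, so that the sum can be
    restricted to exactly the subsets of \<open>K\<close>.\<close>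
  let ?A = "keys (S lam) \<union> ?g ` Pow K"
  have "lookup (S lam * S mu) (lam + mu - ?s K) = sum ?F ?A"
    using finK by (intro lookup_mult_superset) auto
  also have "\<dots> = sum ?F (?g ` Pow K)"
  proof (rule sum.mono_neutral_right)
    show "\<forall>a\<in>?A - ?g ` Pow K. ?F a = 0"
    proof (rule ballI, rule ccontr)
      fix a assume a: "a \<in> ?A - ?g ` Pow K" "?F a \<noteq> 0"
      define v where "v = lam - a"
      have av: "a = lam - v" by (simp add: v_def)
      have "a \<in> keys (S lam)" "lam + mu - ?s K - a \<in> keys (S mu)"
        using a(2) by (auto simp: in_keys_iff)
      then obtain w u where w: "w \<in> W" "a = w lam" and u: "u \<in> W" "lam + mu - ?s K - a = u mu"
        using keys_altsum by blast
      have v0: "coef \<gamma> v \<ge> 0" if "\<gamma> \<in> \<Delta>" for \<gamma>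
        using coef_diff_weyl_nonneg[OF w(1) strictly_dominant_imp_dominant[OF lam] that]
        by (simp add: v_def w(2))
      have vle: "coef \<gamma> v \<le> coef \<gamma> (?s K)" if "\<gamma> \<in> \<Delta>" for \<gamma>
      proof -
        have "?s K - v = mu - u mu" using u(2) by (simp add: v_def algebra_simps)
        then have "coef \<gamma> (?s K - v) \<ge> 0"
          using coef_diff_weyl_nonneg[OF u(1) strictly_dominant_imp_dominant[OF mu] that] by simp
        then show ?thesis by (simp add: coef_diff)
      qed
      let ?I = "{\<gamma>\<in>\<Delta>. coef \<gamma> v \<noteq> 0}"
      have IK: "?I \<subseteq> K"
      proof
        fix \<gamma> assume "\<gamma> \<in> ?I"
        then show "\<gamma> \<in> K"
          using v0[of \<gamma>] vle[of \<gamma>] coef_s[of \<gamma> K] by (cases "\<gamma> \<in> K") auto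
      qed
      have "coef \<gamma> v \<le> mult_at \<gamma> lam" if "\<gamma> \<in> \<Delta>" for \<gamma>
        using vle[OF that] le_lam[OF that order_refl] by simp
      from lookup_altsum_leading[OF lam this] have "\<forall>\<gamma>\<in>?I. coef \<gamma> v = mult_at \<gamma> lam"
        using a(2) unfolding av by (auto split: if_splits)
      \<comment> \<open>On its support \<open>v\<close> has coordinate
        \<open>mult_at \<gamma> lam\<close>, which is at least \<open>t \<gamma>\<close>; the second
        factor permits at most \<open>t \<gamma>\<close>.\<close>
      then have eq: "coef \<gamma> v = t \<gamma>" if "\<gamma> \<in> ?I" for \<gamma>
      proof -
        have *: "\<gamma> \<in> \<Delta>" "\<gamma> \<in> K" using that IK by auto
        have "coef \<gamma> v \<le> t \<gamma>"
          using vle[OF *(1)] coef_s[OF *(1) order_refl] *(2) by simp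
        moreover have "coef \<gamma> v = mult_at \<gamma> lam"
          using \<open>\<forall>\<gamma>\<in>?I. coef \<gamma> v = mult_at \<gamma> lam\<close> that by (rule bspec)
        ultimately show ?thesis using t[OF *(2)] by linarith
      qed
      have "v = ?s ?I"
      proof (rule eq_if_coef_eq)
        fix \<gamma> assume "\<gamma> \<in> \<Delta>"
        then show "coef \<gamma> v = coef \<gamma> (?s ?I)"
          unfolding coef_s[OF \<open>\<gamma> \<in> \<Delta>\<close> IK] using eq[of \<gamma>] by (cases "coef \<gamma> v = 0") simp_all
      qed
      then have "a = ?g ?I" by (simp add: av)
      then show False using a(1) IK by blast
    qed
  qed (use finK in auto)
  also have "\<dots> = (\<Sum>I\<in>Pow K. ?F (?g I))"
    by (rule sum.reindex_cong[OF inj refl refl])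
  also have "\<dots> = (\<Sum>I\<in>Pow K. if I \<in> leading_splits lam mu K t then (-1) ^ card K else 0)"
    by (rule sum.cong[OF refl], rule val) simp
  also have "\<dots> = (\<Sum>I\<in>Pow K \<inter> leading_splits lam mu K t. (-1) ^ card K)"
    by (rule sum.inter_restrict[symmetric]) (simp add: finK)
  also have "Pow K \<inter> leading_splits lam mu K t = leading_splits lam mu K t"
    by (auto simp: leading_splits_def)
  finally show ?thesis by simp
qed


subsection \<open>Comparison of two products\<close>

text \<open>The sum of the two weights is the highest exponent of each product. Being also a key of
  the other product it is a sum of Weyl images, and comparing heights in both directions forces
  these images to be the weights themselves.\<close>

lemma altsum_mult_eq_sum:
  assumes eq: "S l1 * S m2 = S l2 * S m1"
    and sd: "strictly_dominant l1" "strictly_dominant l2" "strictly_dominant m1" "strictly_dominant m2"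
  shows "l1 + m2 = l2 + m1"
proof -
  note dom = sd[THEN strictly_dominant_imp_dominant]
  have key: "l1 + m2 \<in> keys (S l1 * S m2)"
    if "strictly_dominant l1" "strictly_dominant m2" for l1 m2
  proof -
    have "\<kappa> \<bullet> \<rho> \<le> m2 \<bullet> \<rho>" if \<kappa>: "\<kappa> \<in> keys (S m2)" for \<kappa>
    proof -
      obtain w where "w \<in> W" "\<kappa> = w m2" using keys_altsum \<kappa> by blast
      then show ?thesis
        using weyl_inner_le[of w m2 \<rho>] strictly_dominant_imp_dominant strictly_dominant_rho
          \<open>strictly_dominant m2\<close> by simp
    qed
    then show ?thesis
      using lookup_altsum_mult_top[OF that(1) strictly_dominant_rho] lookup_altsum_self[OF that(2)]
      by (simp add: in_keys_iff)
  qed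
  have bound: "\<exists>w\<in>W. \<exists>u\<in>W. \<kappa> = w l2 + u m1" if \<kappa>: "\<kappa> \<in> keys (S l2 * S m1)" for \<kappa> l2 m1
  proof -
    obtain a b where "a \<in> keys (S l2)" "b \<in> keys (S m1)" "\<kappa> = a + b"
      using keys_mult[of "S l2" "S m1"] \<kappa> by blast
    then show ?thesis using keys_altsum by blast
  qed
  obtain w u where wu: "w \<in> W" "u \<in> W" "l1 + m2 = w l2 + u m1"
    using bound key[OF sd(1,4)] unfolding eq by blast
  obtain w' u' where wu': "w' \<in> W" "u' \<in> W" "l2 + m1 = w' l1 + u' m2"
    using bound key[OF sd(2,3)] unfolding eq[symmetric] by blast
  have rho: "dominant \<rho>" using strictly_dominant_rho strictly_dominant_imp_dominant by blast
  have "(l2 + m1) \<bullet> \<rho> \<le> (l1 + m2) \<bullet> \<rho>"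
    using weyl_inner_le[OF wu'(1) dom(1) rho] weyl_inner_le[OF wu'(2) dom(4) rho]
    by (simp add: wu'(3) inner_add_left)
  then have "l2 \<bullet> \<rho> + m1 \<bullet> \<rho> \<le> w l2 \<bullet> \<rho> + u m1 \<bullet> \<rho>"
    by (simp add: wu(3) inner_add_left)
  moreover have le: "w l2 \<bullet> \<rho> \<le> l2 \<bullet> \<rho>" "u m1 \<bullet> \<rho> \<le> m1 \<bullet> \<rho>"
    using weyl_inner_le[OF wu(1) dom(2) rho] weyl_inner_le[OF wu(2) dom(3) rho] .
  ultimately have "w l2 \<bullet> \<rho> \<ge> l2 \<bullet> \<rho>" "u m1 \<bullet> \<rho> \<ge> m1 \<bullet> \<rho>" by linarith+
  then have "w l2 = l2" "u m1 = m1"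
    using weyl_inner_eqD[OF wu(1) dom(2) strictly_dominant_rho]
      weyl_inner_eqD[OF wu(2) dom(3) strictly_dominant_rho] by auto
  then show ?thesis using wu(3) by simp
qed

lemma card_leading_splits_eq:
  assumes eq: "S l1 * S m2 = S l2 * S m1"
    and sd: "strictly_dominant l1" "strictly_dominant l2" "strictly_dominant m1" "strictly_dominant m2"
    and "K \<subseteq> \<Delta>" and "\<And>\<gamma>. \<gamma> \<in> K \<Longrightarrow> 0 < t \<gamma>"
    and "\<And>\<gamma>. \<gamma> \<in> K \<Longrightarrow> t \<gamma> \<le> mult_at \<gamma> l1 \<and> t \<gamma> \<le> mult_at \<gamma> l2 \<and> t \<gamma> \<le> mult_at \<gamma> m1 \<and> t \<gamma> \<le> mult_at \<gamma> m2"
  shows "card (leading_splits l1 m2 K t) = card (leading_splits l2 m1 K t)"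
proof -
  have "lookup (S l1 * S m2) (l1 + m2 - (\<Sum>\<gamma>\<in>K. t \<gamma> *\<^sub>R \<gamma>))
    = lookup (S l2 * S m1) (l2 + m1 - (\<Sum>\<gamma>\<in>K. t \<gamma> *\<^sub>R \<gamma>))"
    using altsum_mult_eq_sum[OF eq sd] eq by simp
  moreover have "lookup (S l1 * S m2) (l1 + m2 - (\<Sum>\<gamma>\<in>K. t \<gamma> *\<^sub>R \<gamma>))
    = (-1) ^ card K * int (card (leading_splits l1 m2 K t))"
    by (rule lookup_altsum_mult_leading) (use assms in auto)
  moreover have "lookup (S l2 * S m1) (l2 + m1 - (\<Sum>\<gamma>\<in>K. t \<gamma> *\<^sub>R \<gamma>))
    = (-1) ^ card K * int (card (leading_splits l2 m1 K t))"
    by (rule lookup_altsum_mult_leading) (use assms in auto)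
  ultimately show ?thesis by simp
qed

lemma card_leading_splits_single:
  "card (leading_splits l m {\<alpha>} t) = (if mult_at \<alpha> l = t \<alpha> then 1 else 0) + (if mult_at \<alpha> m = t \<alpha> then 1 else 0)"
proof -
  have "leading_splits l m {\<alpha>} t = (if mult_at \<alpha> l = t \<alpha> then {{\<alpha>}} else {}) \<union> (if mult_at \<alpha> m = t \<alpha> then {{}} else {})"
    by (auto simp: leading_splits_def subset_singleton_iff)
  then show ?thesis by simp
qed

text \<open>With \<open>t\<close> the minimum of the four coordinates, the coefficient at a single
  root counts how often the minimum is attained on each side. Both sides thus share their minimum,
  and equal sums give equal remaining values.\<close>

lemma mult_at_swap:
  assumes eq: "S l1 * S m2 = S l2 * S m1"
    and sd: "strictly_dominant l1" "strictly_dominant l2" "strictly_dominant m1" "strictly_dominant m2"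
    and \<alpha>: "\<alpha> \<in> \<Delta>"
  shows "mult_at \<alpha> l1 = mult_at \<alpha> l2 \<and> mult_at \<alpha> m1 = mult_at \<alpha> m2 \<or>
    mult_at \<alpha> l1 = mult_at \<alpha> m1 \<and> mult_at \<alpha> l2 = mult_at \<alpha> m2"
proof -
  define t where "t = (\<lambda>\<gamma>. min (min (mult_at \<gamma> l1) (mult_at \<gamma> m2)) (min (mult_at \<gamma> l2) (mult_at \<gamma> m1)))"
  have pos: "mult_at \<alpha> l1 > 0" "mult_at \<alpha> l2 > 0" "mult_at \<alpha> m1 > 0" "mult_at \<alpha> m2 > 0"
    using sd \<alpha> by (auto simp: strictly_dominant_iff)
  have "card (leading_splits l1 m2 {\<alpha>} t) = card (leading_splits l2 m1 {\<alpha>} t)"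
    by (rule card_leading_splits_eq[OF eq sd]) (use \<alpha> pos in \<open>auto simp: t_def\<close>)
  then have "(if mult_at \<alpha> l1 = t \<alpha> then 1 else 0) + (if mult_at \<alpha> m2 = t \<alpha> then 1 else 0) =
     (if mult_at \<alpha> l2 = t \<alpha> then 1 else 0) + (if mult_at \<alpha> m1 = t \<alpha> then 1 else (0::nat))"
    by (simp only: card_leading_splits_single)
  moreover have "t \<alpha> = min (min (mult_at \<alpha> l1) (mult_at \<alpha> m2)) (min (mult_at \<alpha> l2) (mult_at \<alpha> m1))"
    by (simp add: t_def)
  moreover have "mult_at \<alpha> l1 + mult_at \<alpha> m2 = mult_at \<alpha> l2 + mult_at \<alpha> m1"
    using altsum_mult_eq_sum[OF eq sd] by (metis mult_at_add)
  ultimately show ?thesis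
    unfolding min_def by (auto split: if_splits)
qed

text \<open>Along a chordless path the only splits are the two colour classes, and the inequality at the
  initial node excludes one of them.\<close>

lemma path_contradiction:
  fixes f :: "nat \<Rightarrow> 'a"
  assumes eq: "S l1 * S m2 = S l2 * S m1"
    and sd: "strictly_dominant l1" "strictly_dominant l2" "strictly_dominant m1" "strictly_dominant m2"
    and n: "n > 0" and inj: "inj_on f {..n}" and base: "f ` {..n} \<subseteq> \<Delta>"
    and adj: "\<And>i. i < n \<Longrightarrow> f i \<bullet> f (Suc i) \<noteq> 0"
    and chordless: "\<And>i j. i \<le> n \<Longrightarrow> j \<le> n \<Longrightarrow> f i \<bullet> f j \<noteq> 0 \<Longrightarrow> i \<noteq> j \<Longrightarrow> j = Suc i \<or> i = Suc j"
    and start: "mult_at (f 0) l1 = mult_at (f 0) l2" "mult_at (f 0) m1 = mult_at (f 0) m2"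
      "mult_at (f 0) m1 < mult_at (f 0) l1"
    and mid: "\<And>i. 0 < i \<Longrightarrow> i < n \<Longrightarrow> mult_at (f i) l1 = mult_at (f i) l2 \<and>
      mult_at (f i) l1 = mult_at (f i) m1 \<and> mult_at (f i) l1 = mult_at (f i) m2"
    and final: "mult_at (f n) l1 = mult_at (f n) m1" "mult_at (f n) l2 = mult_at (f n) m2"
      "mult_at (f n) l1 \<noteq> mult_at (f n) l2"
  shows False
proof -
  define t where "t = (\<lambda>\<gamma>. min (min (mult_at \<gamma> l1) (mult_at \<gamma> m2)) (min (mult_at \<gamma> l2) (mult_at \<gamma> m1)))"
  define K where "K = f ` {..n}"
  define J where "J = f ` {i. i \<le> n \<and> odd i}"
  have pos: "mult_at \<gamma> l1 > 0" "mult_at \<gamma> l2 > 0" "mult_at \<gamma> m1 > 0" "mult_at \<gamma> m2 > 0"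
    if "\<gamma> \<in> K" for \<gamma>
    using sd base that by (auto simp: strictly_dominant_iff K_def)
  have cards: "card (leading_splits l1 m2 K t) = card (leading_splits l2 m1 K t)"
    by (rule card_leading_splits_eq[OF eq sd])
       (use base pos in \<open>auto simp: K_def t_def\<close>)
  have fJ: "f i \<in> J \<longleftrightarrow> odd i" if "i \<le> n" for i
    using inj that by (auto simp: J_def inj_on_def)
  \<comment> \<open>The strict inequality excludes \<open>f 0\<close> from \<open>I\<close>;
    neighbours are not orthogonal, so they lie on different sides of the split, and membership
    alternates along the path.\<close>
  have only: "I = J" if I: "I \<in> leading_splits l m K t" and gt: "mult_at (f 0) l > t (f 0)" for I l m
  proof -
    have "f i \<in> I \<longleftrightarrow> odd i" if "i \<le> n" for i
      using that
    proof (induction i)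
      case 0
      then show ?case using I gt by (auto simp: leading_splits_def)
    next
      case (Suc i)
      have ne: "f i \<noteq> f (Suc i)" using inj Suc.prems by (auto dest: inj_onD)
      have K2: "f i \<in> K" "f (Suc i) \<in> K" using Suc.prems by (auto simp: K_def)
      have no: "\<not> orthogonal (f i) (f (Suc i))"
        using adj[of i] Suc.prems by (simp add: orthogonal_def)
      have "\<not> (f i \<in> I \<and> f (Suc i) \<in> I)"
        using I no ne by (auto simp: leading_splits_def pairwise_def)
      moreover have "\<not> (f i \<in> K - I \<and> f (Suc i) \<in> K - I)"
        using I no ne by (auto simp: leading_splits_def pairwise_def)
      ultimately show ?case using Suc K2 by auto
    qed
    moreover have "I \<subseteq> K" using I by (simp add: leading_splits_def)
    ultimately show ?thesis by (auto simp: J_def K_def)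
  qed
  have orth: "pairwise orthogonal (f ` A)" if "A \<subseteq> {..n}" "\<And>i j. i \<in> A \<Longrightarrow> j \<in> A \<Longrightarrow> even i = even j" for A
  proof (rule pairwiseI)
    fix x y assume "x \<in> f ` A" "y \<in> f ` A" "x \<noteq> y"
    then obtain i j where ij: "i \<in> A" "j \<in> A" "x = f i" "y = f j" "i \<noteq> j" by auto
    have "f i \<bullet> f j = 0"
    proof (rule ccontr)
      assume "f i \<bullet> f j \<noteq> 0"
      then have "j = Suc i \<or> i = Suc j" using chordless[of i j] ij that(1) by auto
      then show False using that(2)[OF ij(1,2)] by auto
    qed
    then show "orthogonal x y" by (simp add: ij orthogonal_def)
  qed
  have KJ: "K - J = f ` {i. i \<le> n \<and> even i}"
    using fJ by (auto simp: K_def)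
  have orthJ: "pairwise orthogonal J" "pairwise orthogonal (K - J)"
    unfolding KJ unfolding J_def by (rule orth; auto)+
  have JK: "J \<subseteq> K" by (auto simp: J_def K_def)
  have split_iff: "J \<in> leading_splits l m K t \<longleftrightarrow> (\<forall>i\<le>n. if odd i then mult_at (f i) l = t (f i) else mult_at (f i) m = t (f i))"
    for l m
  proof -
    have "J \<in> leading_splits l m K t \<longleftrightarrow> (\<forall>\<gamma>\<in>J. mult_at \<gamma> l = t \<gamma>) \<and> (\<forall>\<gamma>\<in>K - J. mult_at \<gamma> m = t \<gamma>)"
      unfolding leading_splits_def using JK orthJ by blast
    also have "\<dots> \<longleftrightarrow> (\<forall>i\<le>n. if odd i then mult_at (f i) l = t (f i) else mult_at (f i) m = t (f i))"
      unfolding KJ unfolding J_def by auto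
    finally show ?thesis .
  qed
  have t0: "t (f 0) = mult_at (f 0) m1" "t (f 0) < mult_at (f 0) l1" "t (f 0) < mult_at (f 0) l2"
    using start by (auto simp: t_def)
  have tmid: "t (f i) = mult_at (f i) l1" if "0 < i" "i < n" for i
    using mid[OF that] by (auto simp: t_def)
  have red: "J \<in> leading_splits l m K t \<longleftrightarrow> (if odd n then mult_at (f n) l = t (f n) else mult_at (f n) m = t (f n))"
    if "l = l1 \<and> m = m2 \<or> l = l2 \<and> m = m1" for l m
  proof -
    have "(if odd i then mult_at (f i) l = t (f i) else mult_at (f i) m = t (f i))" if "i < n" for i
      using \<open>l = l1 \<and> m = m2 \<or> l = l2 \<and> m = m1\<close> t0 start tmid[of i] mid[of i] that by (cases "i = 0") auto
    then show ?thesis unfolding split_iff by (metis order_le_less)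
  qed
  \<comment> \<open>All nodes before the last fit both sides. At \<open>f n\<close> the two sides
    offer two different values, and \<open>t\<close> is the smaller one, so exactly one side admits
    the split, whatever the parity of \<open>n\<close>.\<close>
  have "J \<in> leading_splits l1 m2 K t \<longleftrightarrow> \<not> J \<in> leading_splits l2 m1 K t"
    unfolding red[of l1 m2, simplified] red[of l2 m1, simplified] using final by (auto simp: t_def)
  moreover have "leading_splits l1 m2 K t = {} \<or> leading_splits l1 m2 K t = {J}"
    using only[OF _ t0(2)] by blast
  moreover have "leading_splits l2 m1 K t = {} \<or> leading_splits l2 m1 K t = {J}"
    using only[OF _ t0(3)] by blast
  ultimately show False using cards by (elim disjE) simp_all
qed

section \<open>Connectedness of the simple roots\<close>

lemma refl_prod_span_orthogonal:
  assumes "set xs \<subseteq> \<Delta>1 \<union> \<Delta>2" "\<And>a b. a \<in> \<Delta>1 \<Longrightarrow> b \<in> \<Delta>2 \<Longrightarrow> a \<bullet> b = 0" "x \<in> span \<Delta>1"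
  shows "refl_prod xs x \<in> span \<Delta>1"
  using assms(1)
proof (induction xs)
  case Nil
  then show ?case using assms(3) by simp
next
  case (Cons \<beta> xs)
  let ?y = "refl_prod xs x"
  have y: "?y \<in> span \<Delta>1" using Cons by auto
  show ?case
  proof (cases "\<beta> \<in> \<Delta>1")
    case True
    then show ?thesis using y by (simp add: refl_def span_diff span_scale span_base)
  next
    case False
    then have "\<beta> \<in> \<Delta>2" using Cons.prems by auto
    then have "\<beta> \<bullet> ?y = 0"
      using orthogonal_to_span[OF y, of \<beta>] assms(2) by (auto simp: orthogonal_def inner_commute)
    then show ?thesis using y by (simp add: refl_eq_self)
  qed
qed

text \<open>A connected component and its complement are orthogonal. Every root arises from a simple
  root by simple reflections, which preserve the spans of both parts, so a proper component would
  decompose the root system.\<close>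

lemma base_connected:
  assumes irr: "irreducible_root_system \<Phi>" and "u \<in> \<Delta>" "v \<in> \<Delta>"
  shows "(u, v) \<in> {(a, b). a \<in> \<Delta> \<and> b \<in> \<Delta> \<and> a \<bullet> b \<noteq> 0}\<^sup>*"
proof (rule ccontr)
  define E where "E = {(a, b). a \<in> \<Delta> \<and> b \<in> \<Delta> \<and> a \<bullet> b \<noteq> 0}"
  assume "(u, v) \<notin> {(a, b). a \<in> \<Delta> \<and> b \<in> \<Delta> \<and> a \<bullet> b \<noteq> 0}\<^sup>*"
  then have uv: "(u, v) \<notin> E\<^sup>*" by (simp add: E_def)
  define \<Delta>1 where "\<Delta>1 = {x\<in>\<Delta>. (u, x) \<in> E\<^sup>*}"
  define \<Delta>2 where "\<Delta>2 = \<Delta> - \<Delta>1"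
  have orth: "a \<bullet> b = 0" if "a \<in> \<Delta>1" "b \<in> \<Delta>2" for a b
  proof (rule ccontr)
    assume "a \<bullet> b \<noteq> 0"
    then have "(a, b) \<in> E" using that by (auto simp: E_def \<Delta>1_def \<Delta>2_def)
    then have "(u, b) \<in> E\<^sup>*" using that by (auto simp: \<Delta>1_def intro: rtrancl_into_rtrancl)
    then show False using that by (auto simp: \<Delta>1_def \<Delta>2_def)
  qed
  have orth': "b \<bullet> a = 0" if "b \<in> \<Delta>2" "a \<in> \<Delta>1" for a b
    using orth[OF that(2,1)] by (simp add: inner_commute)
  have un: "\<Delta>1 \<union> \<Delta>2 = \<Delta>" by (auto simp: \<Delta>1_def \<Delta>2_def)
  define \<Phi>1 where "\<Phi>1 = \<Phi> \<inter> span \<Delta>1"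
  define \<Phi>2 where "\<Phi>2 = \<Phi> \<inter> span \<Delta>2"
  have "\<Phi> \<subseteq> \<Phi>1 \<union> \<Phi>2"
  proof
    fix \<beta> assume b: "\<beta> \<in> \<Phi>"
    then obtain xs \<alpha> where xs: "set xs \<subseteq> \<Delta>" "\<alpha> \<in> \<Delta>" "\<beta> = refl_prod xs \<alpha>"
      using root_conj_simple by metis
    show "\<beta> \<in> \<Phi>1 \<union> \<Phi>2"
    proof (cases "\<alpha> \<in> \<Delta>1")
      case True
      then have "refl_prod xs \<alpha> \<in> span \<Delta>1"
        by (intro refl_prod_span_orthogonal[of xs \<Delta>1 \<Delta>2]) (use xs un orth in \<open>auto intro: span_base\<close>)
      then show ?thesis using b xs by (simp add: \<Phi>1_def)
    next
      case False
      then have "\<alpha> \<in> \<Delta>2" using xs un by auto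
      then have "refl_prod xs \<alpha> \<in> span \<Delta>2"
        by (intro refl_prod_span_orthogonal[of xs \<Delta>2 \<Delta>1]) (use xs un orth' in \<open>auto intro: span_base\<close>)
      then show ?thesis using b xs by (simp add: \<Phi>2_def)
    qed
  qed
  then have "\<Phi>1 \<union> \<Phi>2 = \<Phi>" by (auto simp: \<Phi>1_def \<Phi>2_def)
  moreover have "u \<in> \<Phi>1" "v \<in> \<Phi>2"
    using assms(2,3) uv simple_root by (auto simp: \<Phi>1_def \<Phi>2_def \<Delta>1_def \<Delta>2_def intro!: span_base)
  moreover have "\<alpha> \<bullet> \<beta> = 0" if ab: "\<alpha> \<in> \<Phi>1" "\<beta> \<in> \<Phi>2" for \<alpha> \<beta>
  proof -
    have "orthogonal b \<alpha>" if "b \<in> \<Delta>2" for b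
      using orthogonal_to_span[of \<alpha> \<Delta>1 b] ab(1) orth that by (auto simp: \<Phi>1_def orthogonal_def inner_commute)
    then have "orthogonal \<alpha> \<beta>"
      using orthogonal_to_span[of \<beta> \<Delta>2 \<alpha>] ab(2) by (auto simp: \<Phi>2_def orthogonal_def inner_commute)
    then show ?thesis by (simp add: orthogonal_def)
  qed
  ultimately show False using irr unfolding irreducible_root_system_def by blast
qed

theorem altsum_mult_eq_imp:
  assumes irr: "irreducible_root_system \<Phi>"
    and eq: "S l1 * S m2 = S l2 * S m1"
    and sd: "strictly_dominant l1" "strictly_dominant l2" "strictly_dominant m1" "strictly_dominant m2"
  shows "l1 = l2 \<and> m1 = m2 \<or> l1 = m1 \<and> l2 = m2"
proof -
  \<comment> \<open>By \<open>mult_at_swap\<close> the two sets of nodes are disjoint, and at a node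
    outside both all four weights have the same coordinate.\<close>
  define U where "U = {\<gamma>\<in>\<Delta>. mult_at \<gamma> l1 \<noteq> mult_at \<gamma> m1}"
  define V where "V = {\<gamma>\<in>\<Delta>. mult_at \<gamma> l1 \<noteq> mult_at \<gamma> l2}"
  note swap = mult_at_swap[OF eq sd]
  have sum: "l1 + m2 = l2 + m1" by (rule altsum_mult_eq_sum[OF eq sd])
  have "U = {} \<or> V = {}"
  proof (rule ccontr)
    assume "\<not> ?thesis"
    then obtain u v where uv: "u \<in> U" "v \<in> V" by auto
    define E where "E = {(a, b). a \<in> \<Delta> \<and> b \<in> \<Delta> \<and> a \<bullet> b \<noteq> 0}"
    have conn: "(u, v) \<in> E\<^sup>*"
      unfolding E_def using base_connected[OF irr] uv by (auto simp: U_def V_def)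
    have disj: "U \<inter> V = {}" using swap by (auto simp: U_def V_def)
    obtain n f where f: "n > 0" "f 0 \<in> U" "f n \<in> V" "\<And>i. i < n \<Longrightarrow> (f i, f (Suc i)) \<in> E"
      "\<And>i. 0 < i \<Longrightarrow> i \<le> n \<Longrightarrow> f i \<notin> U" "\<And>i. i < n \<Longrightarrow> f i \<notin> V" "inj_on f {..n}"
      "\<And>i j. i \<le> n \<Longrightarrow> j \<le> n \<Longrightarrow> (f i, f j) \<in> E \<Longrightarrow> j \<le> Suc i"
      using shortest_path_between[OF conn uv disj] by metis
    have base: "f i \<in> \<Delta>" if "i \<le> n" for i
      using f(4)[of i] f(3) that by (cases "i = n") (auto simp: E_def V_def)
    have im: "f ` {..n} \<subseteq> \<Delta>" using base by auto
    have adj: "f i \<bullet> f (Suc i) \<noteq> 0" if "i < n" for i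
      using f(4)[OF that] by (auto simp: E_def)
    have chordless: "j = Suc i \<or> i = Suc j" if "i \<le> n" "j \<le> n" "f i \<bullet> f j \<noteq> 0" "i \<noteq> j" for i j
    proof -
      have "(f i, f j) \<in> E" "(f j, f i) \<in> E"
        using that base by (auto simp: E_def inner_commute)
      then have "j \<le> Suc i" "i \<le> Suc j" using f(8) that by auto
      then show ?thesis using that(4) by linarith
    qed
    have start: "mult_at (f 0) l1 = mult_at (f 0) l2" "mult_at (f 0) m1 = mult_at (f 0) m2"
      "mult_at (f 0) l1 \<noteq> mult_at (f 0) m1"
      using f(2) swap[of "f 0"] by (auto simp: U_def)
    have mid: "mult_at (f i) l1 = mult_at (f i) l2 \<and> mult_at (f i) l1 = mult_at (f i) m1 \<and> mult_at (f i) l1 = mult_at (f i) m2"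
      if "0 < i" "i < n" for i
      using f(5)[of i] f(6)[of i] base[of i] that swap[of "f i"] by (auto simp: U_def V_def)
    have final: "mult_at (f n) l1 = mult_at (f n) m1" "mult_at (f n) l2 = mult_at (f n) m2"
      "mult_at (f n) l1 \<noteq> mult_at (f n) l2"
      using f(3) swap[of "f n"] by (auto simp: V_def)
    show False
    proof (cases "mult_at (f 0) m1 < mult_at (f 0) l1")
      case True
      show False
        by (rule path_contradiction[OF eq sd f(1,7) im adj chordless start(1,2) True mid final])
    next
      case False
      \<comment> \<open>Exchanging \<open>l1\<close> with \<open>m2\<close> and \<open>l2\<close>
        with \<open>m1\<close> preserves the equation and reverses the inequality at the initial
        node.\<close>
      have eq': "S m2 * S l1 = S m1 * S l2" using eq by (simp add: mult.commute)
      have lt: "mult_at (f 0) l2 < mult_at (f 0) m2" using False start by linarith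
      have mid': "mult_at (f i) m2 = mult_at (f i) m1 \<and> mult_at (f i) m2 = mult_at (f i) l2 \<and> mult_at (f i) m2 = mult_at (f i) l1"
        if "0 < i" "i < n" for i
        using mid[OF that] by metis
      have final': "mult_at (f n) m2 = mult_at (f n) l2" "mult_at (f n) m1 = mult_at (f n) l1"
        "mult_at (f n) m2 \<noteq> mult_at (f n) m1"
        using final by metis+
      show False
        by (rule path_contradiction[OF eq' sd(4,3,2,1) f(1,7) im adj chordless start(2)[symmetric]
              start(1)[symmetric] lt mid' final'])
    qed
  qed
  then consider "U = {}" | "V = {}" by blast
  then show ?thesis
  proof cases
    case 1
    then have "l1 = m1" by (intro eq_if_mult_at_eq) (auto simp: U_def)
    then show ?thesis using sum by simp
  next
    case 2
    then have "l1 = l2" by (intro eq_if_mult_at_eq) (auto simp: V_def)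
    then show ?thesis using sum by simp
  qed
qed


subsection \<open>Divisibility of anti-invariant elements\<close>

definition weyl_invariant :: "('a \<Rightarrow>\<^sub>0 int) \<Rightarrow> bool" where
  "weyl_invariant q \<longleftrightarrow> (\<forall>w\<in>W. \<forall>mu. lookup q (w mu) = lookup q mu)"

lemma lookup_mult_twisted:
  fixes f q :: "'a \<Rightarrow>\<^sub>0 int"
  assumes w: "w \<in> W" and c: "c \<noteq> 0"
    and f: "\<And>x. lookup f (w x) = c * lookup f x"
    and q: "\<And>x. lookup q (w x) = d * lookup q x"
  shows "lookup (f * q) (w \<kappa>) = c * d * lookup (f * q) \<kappa>"
proof -
  have bij: "bij_betw w (keys f) (keys f)"
  proof (rule bij_betw_imageI)
    show "inj_on w (keys f)"
      using bij_weyl[OF w] by (auto simp: bij_def intro: inj_on_subset)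
    show "w ` keys f = keys f"
    proof (intro equalityI subsetI)
      fix x assume "x \<in> w ` keys f"
      then show "x \<in> keys f" using f c by (auto simp: in_keys_iff)
    next
      fix x assume x: "x \<in> keys f"
      obtain y where "x = w y" using bij_weyl[OF w] by (metis bij_pointE)
      then show "x \<in> w ` keys f" using f x by (auto simp: in_keys_iff)
    qed
  qed
  have "lookup (f * q) (w \<kappa>)
      = (\<Sum>a\<in>keys f. lookup f a * lookup q (w \<kappa> - a))"
    by (intro lookup_mult_superset) auto
  also have "\<dots> = (\<Sum>a\<in>keys f. lookup f (w a) * lookup q (w \<kappa> - w a))"
    by (rule sum.reindex_bij_betw[OF bij, symmetric])
  also have "\<dots> = (\<Sum>a\<in>keys f. c * d * (lookup f a * lookup q (\<kappa> - a)))"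
    using linear_diff[OF linear_weyl[OF w]] by (intro sum.cong) (auto simp: f q simp flip: linear_diff[OF linear_weyl[OF w]])
  also have "\<dots> = c * d * lookup (f * q) \<kappa>"
    by (simp add: lookup_mult_superset[OF finite_keys order_refl] sum_distrib_left)
  finally show ?thesis .
qed

lemma weyl_sign_cases: "sgn_W w = 1 \<or> sgn_W w = -1"
  by (simp add: weyl_sign_def minus_one_power_iff)

lemma anti_invariant_mult:
  assumes "anti_invariant \<Phi> \<Delta> f" "weyl_invariant q"
  shows "anti_invariant \<Phi> \<Delta> (f * q)"
  unfolding anti_invariant_def
proof (intro ballI allI)
  fix w x assume w: "w \<in> W"
  have "lookup (f * q) (w x) = sgn_W w * 1 * lookup (f * q) x"
    by (rule lookup_mult_twisted[OF w])
       (use assms w weyl_sign_cases[of w] in \<open>auto simp: anti_invariant_def weyl_invariant_def\<close>)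
  then show "lookup (f * q) (w x) = sgn_W w * lookup (f * q) x" by simp
qed

lemma anti_invariant_diff:
  "anti_invariant \<Phi> \<Delta> f \<Longrightarrow> anti_invariant \<Phi> \<Delta> g \<Longrightarrow> anti_invariant \<Phi> \<Delta> (f - g)"
  by (auto simp: anti_invariant_def lookup_minus algebra_simps)

lemma weyl_invariant_add: "weyl_invariant f \<Longrightarrow> weyl_invariant g \<Longrightarrow> weyl_invariant (f + g)"
  by (auto simp: weyl_invariant_def lookup_add)

lemma anti_invariant_altsum: "anti_invariant \<Phi> \<Delta> (S lam)"
  unfolding anti_invariant_def
proof (intro ballI allI)
  fix w \<kappa> assume w: "w \<in> W"
  have "lookup (S lam) (w \<kappa>) = (\<Sum>u\<in>W. if u lam = w \<kappa> then sgn_W u else 0)"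
    by (rule lookup_altsum)
  also have "\<dots> = (\<Sum>u\<in>W. if (w \<circ> u) lam = w \<kappa> then sgn_W (w \<circ> u) else 0)"
    by (rule sum.reindex_bij_betw[OF bij_betw_comp_weyl[OF w], symmetric])
  also have "\<dots> = (\<Sum>u\<in>W. sgn_W w * (if u lam = \<kappa> then sgn_W u else 0))"
  proof (rule sum.cong[OF refl])
    fix u assume u: "u \<in> W"
    have "(w \<circ> u) lam = w \<kappa> \<longleftrightarrow> u lam = \<kappa>"
      using bij_weyl[OF w] by (simp add: bij_def inj_eq)
    then show "(if (w \<circ> u) lam = w \<kappa> then sgn_W (w \<circ> u) else 0) = sgn_W w * (if u lam = \<kappa> then sgn_W u else 0)"
      unfolding weyl_sign_comp[OF w u] by simp
  qed
  also have "\<dots> = sgn_W w * lookup (S lam) \<kappa>"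
    by (simp add: lookup_altsum sum_distrib_left)
  finally show "lookup (S lam) (w \<kappa>) = sgn_W w * lookup (S lam) \<kappa>" .
qed

text \<open>The sum runs over the orbit as a set, so every point has coefficient \<open>c\<close>
  whatever its stabilizer.\<close>

definition orbit_sum :: "int \<Rightarrow> 'a \<Rightarrow> ('a \<Rightarrow>\<^sub>0 int)" where
  "orbit_sum c \<nu> = (\<Sum>\<eta>\<in>(\<lambda>w. w \<nu>) ` W. single \<eta> c)"

lemma lookup_orbit_sum: "lookup (orbit_sum c \<nu>) \<eta> = (if \<eta> \<in> (\<lambda>w. w \<nu>) ` W then c else 0)"
proof -
  have "lookup (orbit_sum c \<nu>) \<eta> = (\<Sum>x\<in>(\<lambda>w. w \<nu>) ` W. if x = \<eta> then c else 0)"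
    unfolding orbit_sum_def lookup_sum by (intro sum.cong) (auto simp: lookup_single)
  then show ?thesis using finite_weyl by simp
qed

lemma keys_orbit_sum: "keys (orbit_sum c \<nu>) \<subseteq> (\<lambda>w. w \<nu>) ` W"
  by (auto simp: in_keys_iff lookup_orbit_sum split: if_splits)

lemma weyl_invariant_orbit_sum: "weyl_invariant (orbit_sum c \<nu>)"
proof -
  have "w \<eta> \<in> (\<lambda>w. w \<nu>) ` W \<longleftrightarrow> \<eta> \<in> (\<lambda>w. w \<nu>) ` W" if w: "w \<in> W" for w \<eta>
  proof
    obtain v where v: "v \<in> W" "\<And>x. v (w x) = x" using weyl_inverse[OF w] by metis
    assume "w \<eta> \<in> (\<lambda>w. w \<nu>) ` W"
    then obtain u where "u \<in> W" "w \<eta> = u \<nu>" by auto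
    then have "\<eta> = (v \<circ> u) \<nu>" using v(2)[of \<eta>] by simp
    then show "\<eta> \<in> (\<lambda>w. w \<nu>) ` W" using comp_weyl[OF v(1) \<open>u \<in> W\<close>] by blast
  next
    assume "\<eta> \<in> (\<lambda>w. w \<nu>) ` W"
    then obtain u where "u \<in> W" "w \<eta> = (w \<circ> u) \<nu>" by auto
    then show "w \<eta> \<in> (\<lambda>w. w \<nu>) ` W" using comp_weyl[OF w \<open>u \<in> W\<close>] by blast
  qed
  then show ?thesis by (simp add: weyl_invariant_def lookup_orbit_sum)
qed

definition multiples_lattice :: "'a \<Rightarrow> 'a set" where
  "multiples_lattice mu = {lam. \<forall>\<alpha>\<in>\<Delta>. mult_at \<alpha> lam / mult_at \<alpha> mu \<in> \<int>}"

text \<open>Integrality of the simple reflections in the basis of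
  \<open>multiples_lattice mu\<close> formed by the fundamental weights scaled by
  \<open>mult_at \<alpha> mu\<close>. For multiples of \<rho> the entries are the Cartan integers,
  for multiples of \<open>\<rho>t\<close> the transposed ones.\<close>

definition refl_compatible :: "'a \<Rightarrow> bool" where
  "refl_compatible mu \<longleftrightarrow> (\<forall>\<alpha>\<in>\<Delta>. \<forall>\<beta>\<in>\<Delta>. mult_at \<alpha> \<beta> * mult_at \<beta> mu / mult_at \<alpha> mu \<in> \<int>)"

lemma multiples_lattice_add: "x \<in> multiples_lattice mu \<Longrightarrow> y \<in> multiples_lattice mu \<Longrightarrow> x + y \<in> multiples_lattice mu"
  and multiples_lattice_diff: "x \<in> multiples_lattice mu \<Longrightarrow> y \<in> multiples_lattice mu \<Longrightarrow> x - y \<in> multiples_lattice mu"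
  by (auto simp: multiples_lattice_def mult_at_add mult_at_diff add_divide_distrib diff_divide_distrib)

lemma multiples_lattice_self: "strictly_dominant mu \<Longrightarrow> mu \<in> multiples_lattice mu"
  by (force simp: multiples_lattice_def strictly_dominant_iff)

lemma multiples_lattice_weyl:
  assumes "strictly_dominant mu" "refl_compatible mu" "w \<in> W" "x \<in> multiples_lattice mu"
  shows "w x \<in> multiples_lattice mu"
  using assms(3)
proof (induction rule: weyl_induct)
  case id
  then show ?case using assms(4) by simp
next
  case (refl \<beta> v)
  have "mult_at \<alpha> (refl \<beta> (v x)) / mult_at \<alpha> mu \<in> \<int>" if \<alpha>: "\<alpha> \<in> \<Delta>" for \<alpha>
  proof -
    have nz: "mult_at \<beta> mu \<noteq> 0"
      using assms(1) refl(2) by (force simp: strictly_dominant_iff)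
    have "mult_at \<alpha> (v x) / mult_at \<alpha> mu
      - (mult_at \<beta> (v x) / mult_at \<beta> mu) * (mult_at \<alpha> \<beta> * mult_at \<beta> mu / mult_at \<alpha> mu) \<in> \<int>"
      using refl(2,5) \<alpha> assms(2) by (intro Ints_diff Ints_mult) (auto simp: multiples_lattice_def refl_compatible_def)
    moreover have "mult_at \<alpha> (refl \<beta> (v x)) / mult_at \<alpha> mu = mult_at \<alpha> (v x) / mult_at \<alpha> mu
      - (mult_at \<beta> (v x) / mult_at \<beta> mu) * (mult_at \<alpha> \<beta> * mult_at \<beta> mu / mult_at \<alpha> mu)"
      using nz by (simp add: refl_def mult_at_diff mult_at_scale diff_divide_distrib)
    ultimately show ?thesis by simp
  qed
  then show ?case by (simp add: multiples_lattice_def)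
qed

text \<open>Discreteness of the lattice: its coordinates are integers, bounded on a ball by the
  Cauchy-Schwarz inequality.\<close>

lemma finite_multiples_lattice_ball:
  assumes "strictly_dominant mu"
  shows "finite {x \<in> multiples_lattice mu. norm x \<le> R}"
proof -
  let ?A = "{x \<in> multiples_lattice mu. norm x \<le> R}"
  let ?g = "\<lambda>x. restrict (\<lambda>\<alpha>. mult_at \<alpha> x / mult_at \<alpha> mu) \<Delta>"
  let ?B = "\<lambda>\<alpha>. norm (coroot \<alpha>) * R / mult_at \<alpha> mu"
  have pos: "mult_at \<alpha> mu > 0" if "\<alpha> \<in> \<Delta>" for \<alpha>
    using assms that by (simp add: strictly_dominant_iff)
  have "inj_on ?g ?A"
  proof (rule inj_onI)
    fix x y assume "?g x = ?g y"
    then have "mult_at \<alpha> x / mult_at \<alpha> mu = mult_at \<alpha> y / mult_at \<alpha> mu" if "\<alpha> \<in> \<Delta>" for \<alpha>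
      using that by (metis (no_types, lifting) restrict_apply')
    then show "x = y"
      using pos by (intro eq_if_mult_at_eq) (metis divide_cancel_right less_irrefl)
  qed
  moreover have "?g ` ?A \<subseteq> PiE \<Delta> (\<lambda>\<alpha>. {z \<in> \<int>. - ?B \<alpha> \<le> z \<and> z \<le> ?B \<alpha>})"
  proof (rule image_subsetI)
    fix x assume x: "x \<in> ?A"
    have "mult_at \<alpha> x / mult_at \<alpha> mu \<in> {z \<in> \<int>. - ?B \<alpha> \<le> z \<and> z \<le> ?B \<alpha>}" if \<alpha>: "\<alpha> \<in> \<Delta>" for \<alpha>
    proof -
      have "\<bar>mult_at \<alpha> x\<bar> \<le> norm (coroot \<alpha>) * norm x"
        unfolding mult_at_def by (rule Cauchy_Schwarz_ineq2)
      also have "\<dots> \<le> norm (coroot \<alpha>) * R"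
        using x by (intro mult_left_mono) auto
      finally have "\<bar>mult_at \<alpha> x / mult_at \<alpha> mu\<bar> \<le> ?B \<alpha>"
        using pos[OF \<alpha>] by (simp add: divide_right_mono)
      then have "- ?B \<alpha> \<le> mult_at \<alpha> x / mult_at \<alpha> mu" "mult_at \<alpha> x / mult_at \<alpha> mu \<le> ?B \<alpha>"
        by (rule abs_le_D2[THEN minus_le_iff[THEN iffD1]], rule abs_le_D1)
      moreover have "mult_at \<alpha> x / mult_at \<alpha> mu \<in> \<int>" using x \<alpha> by (simp add: multiples_lattice_def)
      ultimately show ?thesis by blast
    qed
    then show "?g x \<in> PiE \<Delta> (\<lambda>\<alpha>. {z \<in> \<int>. - ?B \<alpha> \<le> z \<and> z \<le> ?B \<alpha>})" by auto
  qed
  moreover have "finite (PiE \<Delta> (\<lambda>\<alpha>. {z \<in> \<int>. - ?B \<alpha> \<le> z \<and> z \<le> ?B \<alpha>}))"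
    by (intro finite_PiE finite_base finite_int_segment)
  ultimately show ?thesis
    using finite_imageD finite_subset by blast
qed

text \<open>The point of the orbit with the largest pairing with \<rho> is dominant. It lies on no
  wall, since the reflection in a wall fixes it but changes the sign of its coefficient.\<close>

lemma anti_invariant_dominant_key:
  assumes "anti_invariant \<Phi> \<Delta> g" "\<kappa> \<in> keys g"
  obtains w where "w \<in> W" "strictly_dominant (w \<kappa>)"
proof -
  let ?f = "\<lambda>w. w \<kappa> \<bullet> \<rho>"
  have fin: "finite (?f ` W)" using finite_weyl by simp
  have ne: "?f ` W \<noteq> {}" using id_weyl by blast
  from Max_in[OF fin ne] obtain w where w1: "w \<in> W" "Max (?f ` W) = ?f w" by blast
  have w: "w \<in> W" "\<And>u. u \<in> W \<Longrightarrow> u \<kappa> \<bullet> \<rho> \<le> w \<kappa> \<bullet> \<rho>"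
    using w1(1) Max_ge[OF fin imageI] unfolding w1(2) by blast+
  have "mult_at \<alpha> (w \<kappa>) > 0" if \<alpha>: "\<alpha> \<in> \<Delta>" for \<alpha>
  proof -
    have "refl \<alpha> (w \<kappa>) \<bullet> \<rho> \<le> w \<kappa> \<bullet> \<rho>"
      using w(2)[OF comp_weyl[OF refl_weyl[OF simple_root[OF \<alpha>]] w(1)]] by simp
    then have "mult_at \<alpha> (w \<kappa>) * (\<alpha> \<bullet> \<rho>) \<ge> 0"
      by (simp add: refl_def inner_diff_left)
    then have ge: "mult_at \<alpha> (w \<kappa>) \<ge> 0"
      using rho_pos[OF \<alpha>] by (simp add: zero_le_mult_iff)
    have "mult_at \<alpha> (w \<kappa>) \<noteq> 0"
    proof
      assume "mult_at \<alpha> (w \<kappa>) = 0"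
      then have "refl \<alpha> (w \<kappa>) = w \<kappa>" by (simp add: refl_def)
      then have "lookup g (w \<kappa>) = - lookup g (w \<kappa>)"
        using assms(1) refl_weyl[OF simple_root[OF \<alpha>]] weyl_sign_refl[OF \<alpha>]
        by (metis anti_invariant_def mult_minus1)
      then have "lookup g (w \<kappa>) = 0" by simp
      then show False
        using assms w(1) weyl_sign_cases[of w] by (auto simp: anti_invariant_def in_keys_iff)
    qed
    then show ?thesis using ge by simp
  qed
  then show ?thesis using that w(1) by (simp add: strictly_dominant_iff)
qed

text \<open>After applying the inverse of \<open>w\<close> only the inner product of
  \<open>mu\<close> with a Weyl image of \<open>\<nu>\<close> matters. It is largest at
  \<open>\<nu>\<close> itself, and strictly smaller at any other image because \<open>mu\<close> is
  strictly dominant.\<close>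

lemma norm_weyl_sum:
  assumes "w \<in> W" "u \<in> W" "strictly_dominant mu" "dominant \<nu>"
  shows "norm (w mu + u \<nu>) < norm (mu + \<nu>) \<or> w mu + u \<nu> = w (mu + \<nu>)"
proof -
  obtain v where v: "v \<in> W" "\<And>x. v (w x) = x" "\<And>x. w (v x) = x"
    using weyl_inverse[OF assms(1)] by metis
  have vu: "v \<circ> u \<in> W" by (intro comp_weyl v assms)
  have "w mu \<bullet> u \<nu> = v (w mu) \<bullet> v (u \<nu>)" by (simp add: inner_weyl[OF v(1)])
  then have eq: "w mu \<bullet> u \<nu> = (v \<circ> u) \<nu> \<bullet> mu" by (simp add: v inner_commute)
  show ?thesis
  proof (cases "(v \<circ> u) \<nu> \<bullet> mu < \<nu> \<bullet> mu")
    case True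
    have "(norm (w mu + u \<nu>))\<^sup>2 < (norm (mu + \<nu>))\<^sup>2"
      using True eq inner_weyl[OF assms(1), of mu mu] inner_weyl[OF assms(2), of \<nu> \<nu>]
      by (simp add: power2_norm_eq_inner inner_add_left inner_add_right inner_commute)
    then show ?thesis using power_less_imp_less_base norm_ge_zero by blast
  next
    case False
    then have "(v \<circ> u) \<nu> = \<nu>"
      by (intro weyl_inner_eqD[OF vu assms(4,3)]) simp
    then have "u \<nu> = w \<nu>" using v(3)[of "u \<nu>"] by simp
    then show ?thesis by (simp add: linear_add[OF linear_weyl[OF assms(1)]])
  qed
qed

text \<open>Subtracting the product of \<open>S mu\<close> with an orbit sum removes a key of maximal norm together
  with its orbit and otherwise only affects keys of smaller norm.\<close>

lemma altsum_dvd_anti_invariant_aux: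
  assumes mu: "strictly_dominant mu" "refl_compatible mu"
  shows "finite F \<Longrightarrow> anti_invariant \<Phi> \<Delta> g \<Longrightarrow> keys g \<subseteq> F \<Longrightarrow> F \<subseteq> multiples_lattice mu \<Longrightarrow>
    (\<And>\<kappa> \<nu>. \<kappa> \<in> F \<Longrightarrow> \<nu> \<in> multiples_lattice mu \<Longrightarrow> norm \<nu> < norm \<kappa> \<Longrightarrow> \<nu> \<in> F) \<Longrightarrow>
    \<exists>q. weyl_invariant q \<and> keys q \<subseteq> multiples_lattice mu \<and> g = S mu * q"
proof (induction "card F" arbitrary: F g)
  case 0
  then have "g = 0" by simp
  then show ?case by (intro exI[of _ 0]) (simp add: weyl_invariant_def)
next
  case (Suc n)
  note fin = \<open>finite F\<close> and anti = \<open>anti_invariant \<Phi> \<Delta> g\<close> and keys = \<open>keys g \<subseteq> F\<close>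
    and FL = \<open>F \<subseteq> multiples_lattice mu\<close>
  have down: "\<nu> \<in> F" if "\<kappa> \<in> F" "\<nu> \<in> multiples_lattice mu" "norm \<nu> < norm \<kappa>" for \<kappa> \<nu>
    using Suc.prems(5) that by blast
  have "F \<noteq> {}" using Suc.hyps(2) by auto
  then have ne: "norm ` F \<noteq> {}" and finN: "finite (norm ` F)" using fin by auto
  \<comment> \<open>\<open>F\<close> is closed under passing to lattice points of smaller norm.
    Removing a point of maximal norm preserves this and decreases the cardinality, which is the
    measure of the induction.\<close>
  obtain \<kappa> where \<kappa>: "\<kappa> \<in> F" "\<And>\<nu>. \<nu> \<in> F \<Longrightarrow> norm \<nu> \<le> norm \<kappa>"
    using Max_in[OF finN ne] Max_ge[OF finN] by (metis (no_types, lifting) image_iff)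
  let ?F = "F - {\<kappa>}"
  have IH: "\<exists>q. weyl_invariant q \<and> keys q \<subseteq> multiples_lattice mu \<and> g' = S mu * q"
    if "anti_invariant \<Phi> \<Delta> g'" "keys g' \<subseteq> ?F" for g'
  proof (rule Suc.hyps(1))
    show "n = card ?F" using Suc.hyps(2) \<kappa>(1) fin by simp
    show "\<nu> \<in> ?F" if "\<kappa>' \<in> ?F" "\<nu> \<in> multiples_lattice mu" "norm \<nu> < norm \<kappa>'" for \<kappa>' \<nu>
      using down[of \<kappa>' \<nu>] that \<kappa>(2)[of \<kappa>'] by auto
  qed (use fin FL that in auto)
  show ?case
  proof (cases "\<kappa> \<in> keys g")
    case False
    then show ?thesis using IH[OF anti] keys by blast
  next
    case True
    obtain w where w: "w \<in> W" "strictly_dominant (w \<kappa>)"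
      using anti_invariant_dominant_key[OF anti True] .
    let ?k = "w \<kappa>"
    define \<nu> where "\<nu> = ?k - mu"
    define c where "c = lookup g ?k"
    have k_key: "?k \<in> keys g"
      using anti True w(1) weyl_sign_cases[of w] by (auto simp: anti_invariant_def in_keys_iff)
    then have kL: "?k \<in> multiples_lattice mu" using keys FL by blast
    have nk: "norm ?k = norm \<kappa>" by (rule norm_weyl[OF w(1)])
    have \<nu>L: "\<nu> \<in> multiples_lattice mu"
      unfolding \<nu>_def by (intro multiples_lattice_diff kL multiples_lattice_self mu)
    \<comment> \<open>Both weights are strictly dominant and the quotient of their coordinates is an
      integer, so it is at least 1.\<close>
    have \<nu>dom: "dominant \<nu>"
      unfolding dominant_def
    proof
      fix \<alpha> assume \<alpha>: "\<alpha> \<in> \<Delta>"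
      have pos: "mult_at \<alpha> mu > 0" "mult_at \<alpha> ?k > 0"
        using mu(1) w(2) \<alpha> by (auto simp: strictly_dominant_iff)
      obtain z where z: "mult_at \<alpha> ?k / mult_at \<alpha> mu = of_int z"
        using kL \<alpha> by (auto simp: multiples_lattice_def elim: Ints_cases)
      have "(of_int z :: real) > 0" using pos unfolding z[symmetric] by simp
      then have "z \<ge> 1" by simp
      then have "mult_at \<alpha> ?k / mult_at \<alpha> mu \<ge> 1" unfolding z by simp
      then have "mult_at \<alpha> \<nu> \<ge> 0"
        using pos by (simp add: \<nu>_def mult_at_diff field_simps)
      then show "\<alpha> \<bullet> \<nu> \<ge> 0" using mult_at_nonneg_iff[OF simple_nonzero[OF \<alpha>]] by blast
    qed
    have k_eq: "mu + \<nu> = ?k" by (simp add: \<nu>_def)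
    define T where "T = S mu * orbit_sum c \<nu>"
    have antiT: "anti_invariant \<Phi> \<Delta> T"
      unfolding T_def by (intro anti_invariant_mult anti_invariant_altsum weyl_invariant_orbit_sum)
    have "\<eta> \<bullet> \<rho> \<le> \<nu> \<bullet> \<rho>" if \<eta>: "\<eta> \<in> keys (orbit_sum c \<nu>)" for \<eta>
    proof -
      obtain u where "u \<in> W" "\<eta> = u \<nu>" using \<eta> keys_orbit_sum by blast
      then show ?thesis
        using weyl_inner_le[OF _ \<nu>dom strictly_dominant_imp_dominant[OF strictly_dominant_rho]] by blast
    qed
    then have "lookup T (mu + \<nu>) = lookup (orbit_sum c \<nu>) \<nu>"
      unfolding T_def by (intro lookup_altsum_mult_top[OF mu(1) strictly_dominant_rho]) auto
    also have "\<dots> = c"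
      using image_eqI[of \<nu> "\<lambda>w. w \<nu>" id, OF _ id_weyl] by (simp add: lookup_orbit_sum)
    finally have lookT: "lookup T ?k = c" by (simp add: k_eq)
    have keysT: "\<eta> \<in> F" if \<eta>: "\<eta> \<in> keys T" for \<eta>
    proof -
      have "\<eta> \<in> {a + b |a b. a \<in> keys (S mu) \<and> b \<in> keys (orbit_sum c \<nu>)}"
        using \<eta> keys_mult unfolding T_def by blast
      then obtain u v where uv: "u \<in> W" "v \<in> W" "\<eta> = u mu + v \<nu>"
        using keys_altsum[of mu] keys_orbit_sum[of c \<nu>] by blast
      have \<eta>L: "\<eta> \<in> multiples_lattice mu"
        unfolding uv(3)
        by (rule multiples_lattice_add[OF multiples_lattice_weyl[OF mu uv(1) multiples_lattice_self[OF mu(1)]]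
              multiples_lattice_weyl[OF mu uv(2) \<nu>L]])
      from norm_weyl_sum[OF uv(1,2) mu(1) \<nu>dom] show ?thesis
      proof
        assume "norm (u mu + v \<nu>) < norm (mu + \<nu>)"
        then show ?thesis using down[OF \<kappa>(1) \<eta>L] by (simp add: uv(3) k_eq nk)
      next
        assume "u mu + v \<nu> = u (mu + \<nu>)"
        then have "\<eta> = u ?k" by (simp add: uv(3) k_eq)
        then have "\<eta> \<in> keys g"
          using anti k_key uv(1) weyl_sign_cases[of u] by (auto simp: anti_invariant_def in_keys_iff)
        then show ?thesis using keys by blast
      qed
    qed
    have anti': "anti_invariant \<Phi> \<Delta> (g - T)" by (intro anti_invariant_diff anti antiT)
    have "lookup (g - T) ?k = 0" by (simp add: lookup_minus lookT c_def)
    then have "lookup (g - T) \<kappa> = 0"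
      using anti' w(1) weyl_sign_cases[of w] by (auto simp: anti_invariant_def)
    moreover have "keys (g - T) \<subseteq> F"
      using keys_diff[of g T] keys keysT by blast
    ultimately have "keys (g - T) \<subseteq> ?F" by (auto simp: in_keys_iff)
    from IH[OF anti' this] obtain q where q: "weyl_invariant q" "keys q \<subseteq> multiples_lattice mu"
      "g - T = S mu * q" by auto
    show ?thesis
    proof (intro exI conjI)
      show "weyl_invariant (q + orbit_sum c \<nu>)" by (intro weyl_invariant_add q weyl_invariant_orbit_sum)
      show "g = S mu * (q + orbit_sum c \<nu>)" using q(3) by (simp add: T_def algebra_simps)
      have "keys (orbit_sum c \<nu>) \<subseteq> multiples_lattice mu"
        using keys_orbit_sum[of c \<nu>] multiples_lattice_weyl[OF mu _ \<nu>L] by blast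
      then show "keys (q + orbit_sum c \<nu>) \<subseteq> multiples_lattice mu"
        using q(2) keys_add[of q "orbit_sum c \<nu>"] by blast
    qed
  qed
qed

text \<open>For \<open>mu = \<rho>\<close> this is the divisibility of anti-invariant elements by
  the Weyl denominator; in general it is the same statement for the rescaled lattice.\<close>

lemma altsum_dvd_anti_invariant:
  assumes mu: "strictly_dominant mu" "refl_compatible mu"
    and g: "anti_invariant \<Phi> \<Delta> g" "keys g \<subseteq> multiples_lattice mu"
  shows "\<exists>q. weyl_invariant q \<and> keys q \<subseteq> multiples_lattice mu \<and> g = S mu * q"
proof -
  define R where "R = Max (insert 0 (norm ` keys g))"
  let ?F = "{x \<in> multiples_lattice mu. norm x \<le> R}"
  have "norm \<kappa> \<le> R" if "\<kappa> \<in> keys g" for \<kappa>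
    unfolding R_def using that by (intro Max_ge) auto
  then have "keys g \<subseteq> ?F" using g(2) by auto
  then show ?thesis
    using finite_multiples_lattice_ball[OF mu(1)] g(1)
    by (intro altsum_dvd_anti_invariant_aux[OF mu, of ?F]) auto
qed

lemma mult_at_refl_prod: "mult_at (refl_prod xs \<alpha>) x = mult_at \<alpha> (refl_prod (rev xs) x)"
  by (simp add: mult_at_eq inner_refl_prod inner_refl_prod_left)

lemma refl_compatible_rho: "refl_compatible \<rho>"
  using root_integral simple_root by (auto simp: refl_compatible_def mult_at_rho)

text \<open>Every root is conjugate to a simple one, and the lattice defined by integrality at the
  simple roots is stable under the Weyl group.\<close>

lemma weight_latticeI:
  assumes "\<And>\<alpha>. \<alpha> \<in> \<Delta> \<Longrightarrow> mult_at \<alpha> lam \<in> \<int>"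
  shows "lam \<in> weight_lattice \<Phi>"
  unfolding weight_lattice_def
proof (intro CollectI ballI)
  fix \<beta> assume "\<beta> \<in> \<Phi>"
  then obtain xs \<alpha> where xs: "set xs \<subseteq> \<Delta>" "\<alpha> \<in> \<Delta>" "\<beta> = refl_prod xs \<alpha>"
    using root_conj_simple by metis
  have "lam \<in> multiples_lattice \<rho>" using assms by (simp add: multiples_lattice_def mult_at_rho)
  moreover have "refl_prod (rev xs) \<in> W"
    unfolding weyl_group_simple using xs(1) by (intro CollectI exI[of _ "rev xs"]) simp
  ultimately have "refl_prod (rev xs) lam \<in> multiples_lattice \<rho>"
    using multiples_lattice_weyl strictly_dominant_rho refl_compatible_rho by blast
  then show "mult_at \<beta> lam \<in> \<int>"
    using xs(2) by (simp add: xs(3) mult_at_refl_prod multiples_lattice_def mult_at_rho)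
qed

text \<open>Stability of the lattice of multiples of \<open>mu\<close> keeps all exponents of
  \<open>S lam\<close> in it. Integrality of \<open>mu\<close> then places the cofactor in the
  weight lattice.\<close>

lemma inv_dvd_altsum:
  assumes mu: "strictly_dominant mu" "refl_compatible mu" "\<And>\<alpha>. \<alpha> \<in> \<Delta> \<Longrightarrow> mult_at \<alpha> mu \<in> \<int>"
    and "weight_dvd \<Delta> mu lam"
  shows "inv_dvd \<Phi> (S mu) (S lam)"
proof -
  have "lam \<in> multiples_lattice mu"
    unfolding multiples_lattice_def
  proof (intro CollectI ballI)
    fix \<alpha> assume \<alpha>: "\<alpha> \<in> \<Delta>"
    then obtain k where "mult_at \<alpha> lam = of_int k * mult_at \<alpha> mu"
      using assms(4) by (auto simp: weight_dvd_def)
    moreover have "mult_at \<alpha> mu \<noteq> 0" using mu(1) \<alpha> by (force simp: strictly_dominant_iff)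
    ultimately show "mult_at \<alpha> lam / mult_at \<alpha> mu \<in> \<int>" by simp
  qed
  then have "keys (S lam) \<subseteq> multiples_lattice mu"
    using keys_altsum[of lam] multiples_lattice_weyl[OF mu(1,2)] by blast
  from altsum_dvd_anti_invariant[OF mu(1,2) anti_invariant_altsum this] obtain q where
    q: "weyl_invariant q" "keys q \<subseteq> multiples_lattice mu" "S lam = S mu * q" by auto
  have "multiples_lattice mu \<subseteq> weight_lattice \<Phi>"
  proof
    fix x assume x: "x \<in> multiples_lattice mu"
    show "x \<in> weight_lattice \<Phi>"
    proof (rule weight_latticeI)
      fix \<alpha> assume \<alpha>: "\<alpha> \<in> \<Delta>"
      have "mult_at \<alpha> x / mult_at \<alpha> mu * mult_at \<alpha> mu \<in> \<int>"
        using x mu(3)[OF \<alpha>] \<alpha> by (intro Ints_mult) (auto simp: multiples_lattice_def)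
      moreover have "mult_at \<alpha> mu \<noteq> 0" using mu(1) \<alpha> by (force simp: strictly_dominant_iff)
      ultimately show "mult_at \<alpha> x \<in> \<int>" by simp
    qed
  qed
  then show ?thesis
    using q unfolding inv_dvd_def in_ZP_def weyl_invariant_def by blast
qed


subsection \<open>Root lengths\<close>

text \<open>Otherwise the roots split into those in the span of the orbit and those orthogonal to
  it: a root not orthogonal to \<open>w \<alpha>\<close> is a multiple of the difference of
  \<open>w \<alpha>\<close> and its reflection, hence in the span.\<close>

lemma root_orbit_not_orthogonal:
  assumes irr: "irreducible_root_system \<Phi>" and "\<alpha> \<in> \<Phi>" "\<beta> \<in> \<Phi>"
  shows "\<exists>w\<in>W. w \<alpha> \<bullet> \<beta> \<noteq> 0"
proof (rule ccontr)
  assume "\<not> ?thesis"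
  then have orth: "w \<alpha> \<bullet> \<beta> = 0" if "w \<in> W" for w using that by auto
  let ?O = "(\<lambda>w. w \<alpha>) ` W"
  define \<Phi>1 where "\<Phi>1 = \<Phi> \<inter> span ?O"
  define \<Phi>2 where "\<Phi>2 = {\<gamma>\<in>\<Phi>. \<forall>x\<in>?O. x \<bullet> \<gamma> = 0}"
  have "\<gamma> \<in> \<Phi>1 \<union> \<Phi>2" if \<gamma>: "\<gamma> \<in> \<Phi>" for \<gamma>
  proof (cases "\<gamma> \<in> \<Phi>2")
    case False
    then obtain w where w: "w \<in> W" "w \<alpha> \<bullet> \<gamma> \<noteq> 0" using \<gamma> by (auto simp: \<Phi>2_def)
    let ?c = "mult_at \<gamma> (w \<alpha>)"
    have c: "?c \<noteq> 0" using w(2) root_nonzero[OF \<gamma>] by (simp add: mult_at_eq inner_commute)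
    have "refl \<gamma> (w \<alpha>) \<in> span ?O" "w \<alpha> \<in> span ?O"
      using comp_weyl[OF refl_weyl[OF \<gamma>] w(1)] w(1) by (auto intro!: span_base) (metis comp_apply image_eqI)
    then have "(1 / ?c) *\<^sub>R (w \<alpha> - refl \<gamma> (w \<alpha>)) \<in> span ?O"
      by (intro span_scale span_diff)
    moreover have "(1 / ?c) *\<^sub>R (w \<alpha> - refl \<gamma> (w \<alpha>)) = \<gamma>" using c by (simp add: refl_def)
    ultimately show ?thesis using \<gamma> by (simp add: \<Phi>1_def)
  qed simp
  then have "\<Phi>1 \<union> \<Phi>2 = \<Phi>" by (auto simp: \<Phi>1_def \<Phi>2_def)
  moreover have "\<alpha> \<in> \<Phi>1" using assms(2) image_eqI[of \<alpha> "\<lambda>w. w \<alpha>" id, OF _ id_weyl]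
    by (auto simp: \<Phi>1_def intro: span_base)
  moreover have "\<beta> \<in> \<Phi>2" using assms(3) orth by (auto simp: \<Phi>2_def)
  moreover have "a \<bullet> b = 0" if a: "a \<in> \<Phi>1" and b: "b \<in> \<Phi>2" for a b
  proof -
    have "orthogonal b a"
      using a b by (intro orthogonal_to_span[of a ?O b]) (auto simp: \<Phi>1_def \<Phi>2_def orthogonal_def inner_commute)
    then show ?thesis by (simp add: orthogonal_def inner_commute)
  qed
  ultimately show False using irr unfolding irreducible_root_system_def by blast
qed

text \<open>Both Cartan integers are positive. The positive squared length of
  \<open>\<beta> - \<gamma>\<close> forces \<open>mult_at \<beta> \<gamma>\<close> to be 1, so
  \<open>mult_at \<gamma> \<beta>\<close> is the ratio; that of
  \<open>\<beta> - 2 *\<^sub>R \<gamma>\<close>, nonzero because the system is reduced, keeps the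
  ratio below 4.\<close>

lemma sqlen_ratio_acute:
  assumes "\<gamma> \<in> \<Phi>" "\<beta> \<in> \<Phi>" "\<gamma> \<bullet> \<beta> > 0" "\<gamma> \<bullet> \<gamma> \<le> \<beta> \<bullet> \<beta>"
  shows "\<beta> \<bullet> \<beta> / (\<gamma> \<bullet> \<gamma>) \<in> {1, 2, 3}"
proof (cases "\<beta> = \<gamma>")
  case True
  then show ?thesis using root_nonzero[OF assms(1)] by simp
next
  case False
  have pos: "\<gamma> \<bullet> \<gamma> > 0" "\<beta> \<bullet> \<beta> > 0" using assms(1,2) root_nonzero by auto
  obtain x y :: int where x: "mult_at \<gamma> \<beta> = x" and y: "mult_at \<beta> \<gamma> = y"
    using root_integral[OF assms(1,2)] root_integral[OF assms(2,1)] by (auto elim!: Ints_cases)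
  define p where "p = \<gamma> \<bullet> \<beta>"
  define g where "g = \<gamma> \<bullet> \<gamma>"
  define b where "b = \<beta> \<bullet> \<beta>"
  have xy: "2 * p = x * g" "2 * p = y * b"
    using x y pos by (simp_all add: mult_at_eq p_def g_def b_def field_simps inner_commute)
  have pp: "p > 0" "g > 0" "b > 0" "g \<le> b" using assms pos by (auto simp: p_def g_def b_def)
  have "(\<beta> - \<gamma>) \<bullet> (\<beta> - \<gamma>) > 0" using False by simp
  then have d1: "b - 2 * p + g > 0" by (simp add: algebra_simps p_def g_def b_def inner_commute)
  have "\<beta> \<noteq> 2 *\<^sub>R \<gamma>" using root_reduced[OF assms(1), of 2] assms(2) by auto
  then have "(\<beta> - 2 *\<^sub>R \<gamma>) \<bullet> (\<beta> - 2 *\<^sub>R \<gamma>) > 0" by simp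
  then have d2: "b - 4 * p + 4 * g > 0" by (simp add: algebra_simps p_def g_def b_def inner_commute)
  have y0: "y > 0"
  proof (rule ccontr)
    assume "\<not> y > 0"
    then have "real_of_int y * b \<le> 0" using pp by (simp add: mult_nonpos_nonneg)
    then show False using xy pp by linarith
  qed
  have "y < 2"
  proof (rule ccontr)
    assume "\<not> y < 2"
    then have "real_of_int y * b \<ge> 2 * b" using pp by (intro mult_right_mono) auto
    then show False using xy d1 pp by linarith
  qed
  then have b: "2 * p = b" using y0 xy(2) by simp
  then have ratio: "b = x * g" using xy by simp
  have "x < 4"
  proof (rule ccontr)
    assume "\<not> x < 4"
    then have "real_of_int x * g \<ge> 4 * g" using pp by (intro mult_right_mono) auto
    then show False using b ratio d2 by linarith
  qed
  moreover have "x \<ge> 1"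
  proof (rule ccontr)
    assume "\<not> x \<ge> 1"
    then have "real_of_int x * g \<le> 0" using pp by (simp add: mult_nonpos_nonneg)
    then show False using ratio pp by linarith
  qed
  ultimately have "x = 1 \<or> x = 2 \<or> x = 3" by linarith
  moreover have "\<beta> \<bullet> \<beta> / (\<gamma> \<bullet> \<gamma>) = x" using ratio pp by (simp add: b_def g_def)
  ultimately show ?thesis by auto
qed

lemma sqlen_ratio:
  assumes irr: "irreducible_root_system \<Phi>" and "\<alpha> \<in> \<Phi>" "\<beta> \<in> \<Phi>" "\<alpha> \<bullet> \<alpha> \<le> \<beta> \<bullet> \<beta>"
  shows "\<beta> \<bullet> \<beta> / (\<alpha> \<bullet> \<alpha>) \<in> {1, 2, 3}"
proof -
  obtain w where w: "w \<in> W" "w \<alpha> \<bullet> \<beta> \<noteq> 0"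
    using root_orbit_not_orthogonal[OF irr assms(2,3)] by auto
  have len: "w \<alpha> \<bullet> w \<alpha> = \<alpha> \<bullet> \<alpha>" by (rule inner_weyl[OF w(1)])
  have root: "w \<alpha> \<in> \<Phi>" by (rule weyl_root[OF w(1) assms(2)])
  show ?thesis
  proof (cases "w \<alpha> \<bullet> \<beta> > 0")
    case True
    then show ?thesis using sqlen_ratio_acute[OF root assms(3)] assms(4) len by simp
  next
    case False
    then show ?thesis using sqlen_ratio_acute[OF minus_root[OF root] assms(3)] w(2) assms(4) len by simp
  qed
qed

lemma root_sqlen_simple:
  assumes "\<beta> \<in> \<Phi>"
  shows "\<exists>\<alpha>\<in>\<Delta>. \<alpha> \<bullet> \<alpha> = \<beta> \<bullet> \<beta>"
  using root_conj_simple[OF assms] inner_refl_prod by metis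

text \<open>There are at most two root lengths: the ratios of an intermediate length to the extreme
  ones would multiply to \<open>m\<close>, which is 1 or prime.\<close>

lemma root_lengths:
  assumes irr: "irreducible_root_system \<Phi>"
  obtains m :: nat where "m \<in> {1, 2, 3}" "mPhi \<Phi> = real m"
    "\<And>\<alpha>. \<alpha> \<in> \<Delta> \<Longrightarrow> \<alpha> \<bullet> \<alpha> = long_sqlen \<Phi> \<or> real m * (\<alpha> \<bullet> \<alpha>) = long_sqlen \<Phi>"
    "\<exists>\<alpha>\<in>\<Delta>. \<alpha> \<bullet> \<alpha> = long_sqlen \<Phi>" "\<exists>\<alpha>\<in>\<Delta>. real m * (\<alpha> \<bullet> \<alpha>) = long_sqlen \<Phi>"
proof -
  let ?l = "(\<lambda>\<alpha>. \<alpha> \<bullet> \<alpha>) ` \<Phi>"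
  have "\<Phi> \<noteq> {}"
  proof
    assume "\<Phi> = {}"
    then have "(UNIV :: 'a set) = {0}" using span_roots by simp
    then show False using nonempty_Basis nonzero_Basis by blast
  qed
  then have ne: "?l \<noteq> {}" and fin: "finite ?l" using finite_roots by auto
  obtain l where l: "l \<in> \<Phi>" "long_sqlen \<Phi> = l \<bullet> l"
    using Max_in[OF fin ne] by (auto simp: long_sqlen_def)
  obtain s where s: "s \<in> \<Phi>" "short_sqlen \<Phi> = s \<bullet> s"
    using Min_in[OF fin ne] by (auto simp: short_sqlen_def)
  have maxl: "\<alpha> \<bullet> \<alpha> \<le> l \<bullet> l" and mins: "s \<bullet> s \<le> \<alpha> \<bullet> \<alpha>" if "\<alpha> \<in> \<Phi>" for \<alpha>
    using Max_ge[OF fin, of "\<alpha> \<bullet> \<alpha>"] Min_le[OF fin, of "\<alpha> \<bullet> \<alpha>"] that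
    unfolding l(2)[symmetric] s(2)[symmetric] by (auto simp: long_sqlen_def short_sqlen_def)
  have pos: "\<alpha> \<bullet> \<alpha> > 0" if "\<alpha> \<in> \<Phi>" for \<alpha> using root_nonzero[OF that] by simp
  have "l \<bullet> l / (s \<bullet> s) \<in> {1, 2, 3}" by (rule sqlen_ratio[OF irr s(1) l(1) maxl[OF s(1)]])
  then obtain m :: nat where m: "m \<in> {1, 2, 3}" "l \<bullet> l / (s \<bullet> s) = real m"
    by (metis insert_iff empty_iff of_nat_1 of_nat_numeral)
  have ms: "real m * (s \<bullet> s) = l \<bullet> l" using m(2) pos[OF s(1)] by (simp add: field_simps)
  have "\<alpha> \<bullet> \<alpha> = l \<bullet> l \<or> real m * (\<alpha> \<bullet> \<alpha>) = l \<bullet> l" if "\<alpha> \<in> \<Delta>" for \<alpha>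
  proof -
    have \<alpha>: "\<alpha> \<in> \<Phi>" by (rule simple_root[OF that])
    have 1: "l \<bullet> l / (\<alpha> \<bullet> \<alpha>) \<in> {1, 2, 3}" by (rule sqlen_ratio[OF irr \<alpha> l(1) maxl[OF \<alpha>]])
    have 2: "\<alpha> \<bullet> \<alpha> / (s \<bullet> s) \<in> {1, 2, 3}" by (rule sqlen_ratio[OF irr s(1) \<alpha> mins[OF \<alpha>]])
    have "l \<bullet> l / (\<alpha> \<bullet> \<alpha>) * (\<alpha> \<bullet> \<alpha> / (s \<bullet> s)) = real m" using m(2) pos[OF \<alpha>] by simp
    moreover have "x = 1 \<or> y = 1" if "x * y = real m" "x \<in> {1, 2, 3}" "y \<in> {1, 2, 3}" for x y
      using that m(1) by auto
    ultimately have "l \<bullet> l / (\<alpha> \<bullet> \<alpha>) = 1 \<or> \<alpha> \<bullet> \<alpha> / (s \<bullet> s) = 1"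
      using 1 2 by blast
    then show ?thesis using ms pos[OF \<alpha>] pos[OF s(1)] by (auto simp: field_simps)
  qed
  moreover have "\<exists>\<alpha>\<in>\<Delta>. \<alpha> \<bullet> \<alpha> = l \<bullet> l" by (rule root_sqlen_simple[OF l(1)])
  moreover have "\<exists>\<alpha>\<in>\<Delta>. real m * (\<alpha> \<bullet> \<alpha>) = l \<bullet> l" using root_sqlen_simple[OF s(1)] ms by metis
  ultimately show ?thesis
    using that m l(2) s(2) by (simp add: mPhi_def)
qed

lemma mult_at_rho_tilde:
  assumes "\<alpha> \<in> \<Delta>"
  shows "mult_at \<alpha> \<rho>t = (if \<alpha> \<bullet> \<alpha> = long_sqlen \<Phi> then 1 else mPhi \<Phi>)"
proof -
  have "mult_at \<alpha> \<rho>t = (\<Sum>\<beta>\<in>\<Delta>. if \<alpha> = \<beta> then (if \<beta> \<bullet> \<beta> = long_sqlen \<Phi> then 1 else mPhi \<Phi>) else 0)"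
    unfolding rho_tilde_def mult_at_sum mult_at_scale
    by (intro sum.cong) (auto simp: mult_at_fund_weight assms)
  then show ?thesis using assms finite_base by simp
qed


subsection \<open>The least common multiple\<close>

definition special_weight :: "'a \<Rightarrow> bool" where
  "special_weight \<nu> \<longleftrightarrow> (\<exists>k::nat. k > 0 \<and> (\<nu> = real k *\<^sub>R \<rho> \<or> \<nu> = real k *\<^sub>R \<rho>t))"

definition generator_weights :: "'a \<Rightarrow> 'a set" where
  "generator_weights lam = {\<nu>. special_weight \<nu> \<and> weight_dvd \<Delta> \<nu> lam \<and> \<nu> \<noteq> lam}"

lemma D_generators_eq: "D_generators \<Phi> \<Delta> lam = S ` generator_weights lam"
  unfolding D_generators_def generator_weights_def special_weight_def by blast

text \<open>The coordinate of \<open>\<rho>t\<close> at \<alpha> is the long squared length divided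
  by \<open>\<alpha> \<bullet> \<alpha>\<close>. Rescaling \<open>mult_at \<alpha> \<beta>\<close>
  by these coordinates therefore yields the transposed Cartan integer
  \<open>mult_at \<beta> \<alpha>\<close>.\<close>

lemma special_weight_props:
  assumes irr: "irreducible_root_system \<Phi>" and "special_weight \<nu>"
  shows "strictly_dominant \<nu>" "refl_compatible \<nu>" "\<And>\<alpha>. \<alpha> \<in> \<Delta> \<Longrightarrow> mult_at \<alpha> \<nu> \<in> \<int>"
proof -
  obtain m :: nat where m: "m \<in> {1, 2, 3}" "mPhi \<Phi> = real m"
    "\<And>\<alpha>. \<alpha> \<in> \<Delta> \<Longrightarrow> \<alpha> \<bullet> \<alpha> = long_sqlen \<Phi> \<or> real m * (\<alpha> \<bullet> \<alpha>) = long_sqlen \<Phi>"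
    using root_lengths[OF irr] by metis
  have mt: "mult_at \<alpha> \<rho>t = long_sqlen \<Phi> / (\<alpha> \<bullet> \<alpha>)" if "\<alpha> \<in> \<Delta>" for \<alpha>
    using m(3)[OF that] m(2) inner_simple_pos[OF that]
    by (auto simp: mult_at_rho_tilde[OF that] field_simps)
  have mt_int: "mult_at \<alpha> \<rho>t \<in> \<int>" "mult_at \<alpha> \<rho>t > 0" if "\<alpha> \<in> \<Delta>" for \<alpha>
    using m(1,2) by (auto simp: mult_at_rho_tilde[OF that])
  obtain k :: nat where k: "k > 0" "\<nu> = real k *\<^sub>R \<rho> \<or> \<nu> = real k *\<^sub>R \<rho>t"
    using assms(2) by (auto simp: special_weight_def)
  show "strictly_dominant \<nu>"
    using k mt_int mult_at_rho by (auto simp: strictly_dominant_iff mult_at_scale)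
  show "mult_at \<alpha> \<nu> \<in> \<int>" if "\<alpha> \<in> \<Delta>" for \<alpha>
    using k mt_int(1)[OF that] mult_at_rho[OF that] by (auto simp: mult_at_scale)
  show "refl_compatible \<nu>"
    unfolding refl_compatible_def
  proof (intro ballI)
    fix \<alpha> \<beta> assume ab: "\<alpha> \<in> \<Delta>" "\<beta> \<in> \<Delta>"
    have int: "mult_at \<alpha> \<beta> \<in> \<int>" "mult_at \<beta> \<alpha> \<in> \<int>"
      using root_integral simple_root ab by blast+
    from k(2) show "mult_at \<alpha> \<beta> * mult_at \<beta> \<nu> / mult_at \<alpha> \<nu> \<in> \<int>"
    proof
      assume "\<nu> = real k *\<^sub>R \<rho>"
      then show ?thesis using int(1) k(1) ab by (simp add: mult_at_scale mult_at_rho)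
    next
      assume \<nu>: "\<nu> = real k *\<^sub>R \<rho>t"
      obtain l where l: "l = long_sqlen \<Phi>" "l > 0"
        using mt[OF ab(1)] mt_int(2)[OF ab(1)] inner_simple_pos[OF ab(1)] by (auto simp: zero_less_divide_iff)
      have "mult_at \<alpha> \<beta> * mult_at \<beta> \<nu> / mult_at \<alpha> \<nu> = mult_at \<beta> \<alpha>"
        using k(1) l(2) inner_simple_pos[OF ab(1)] inner_simple_pos[OF ab(2)]
        unfolding \<nu> mult_at_scale mt[OF ab(1)] mt[OF ab(2)] mult_at_eq[of \<alpha> \<beta>] mult_at_eq[of \<beta> \<alpha>] l(1)[symmetric]
        by (simp add: inner_commute)
      then show ?thesis using int(2) by simp
    qed
  qed
qed

text \<open>The sum over an orbit is fixed by every simple reflection, hence orthogonal to all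
  simple roots.\<close>

lemma sum_weyl_zero: "(\<Sum>w\<in>W. w x) = 0"
proof (rule eq_if_mult_at_eq)
  fix \<alpha> assume \<alpha>: "\<alpha> \<in> \<Delta>"
  let ?u = "\<Sum>w\<in>W. w x"
  have "refl \<alpha> ?u = (\<Sum>w\<in>W. (refl \<alpha> \<circ> w) x)"
    by (simp add: linear_sum[OF linear_refl])
  also have "\<dots> = ?u"
    by (rule sum.reindex_bij_betw[OF bij_betw_comp_weyl[OF refl_weyl[OF simple_root[OF \<alpha>]]]])
  finally show "mult_at \<alpha> ?u = mult_at \<alpha> 0"
    using simple_nonzero[OF \<alpha>] by (simp add: refl_def mult_at_eq)
qed

text \<open>The orbits of two Weyl-invariant elements are centred at the origin, so their supports
  cannot lie strictly on one side.\<close>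

lemma keys_invariant_trivial:
  assumes p: "weyl_invariant p" and q: "weyl_invariant q" and \<sigma>: "\<sigma> \<in> keys q"
    and le: "\<And>h \<tau> \<sigma>. strictly_dominant h \<Longrightarrow> \<tau> \<in> keys p \<Longrightarrow> \<sigma> \<in> keys q \<Longrightarrow> (\<tau> + \<sigma>) \<bullet> h \<le> 0"
  shows "keys p \<subseteq> {0}"
proof
  fix \<tau> assume \<tau>: "\<tau> \<in> keys p"
  have Wpos: "card W > 0" using finite_weyl id_weyl card_gt_0_iff by blast
  have sum0: "(\<Sum>w\<in>W. w x \<bullet> h) = 0" for x h
    using sum_weyl_zero[of x] by (metis inner_sum_left inner_zero_left)
  have orbp: "w \<tau> \<in> keys p" if "w \<in> W" for w
    using p that \<tau> by (simp add: weyl_invariant_def in_keys_iff)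
  have orbq: "w \<sigma> \<in> keys q" if "w \<in> W" for w
    using q that \<sigma> by (simp add: weyl_invariant_def in_keys_iff)
  have np: "w \<tau> \<bullet> h \<le> 0" if h: "strictly_dominant h" and w: "w \<in> W" for w h
  proof -
    \<comment> \<open>Averaging over the orbit of \<open>\<sigma>\<close> removes
      \<open>\<sigma>\<close> and leaves an inequality for \<open>w \<tau>\<close> alone.\<close>
    have "(\<Sum>u\<in>W. (w \<tau> + u \<sigma>) \<bullet> h) \<le> 0"
      by (intro sum_nonpos le h orbp orbq w)
    then have "real (card W) * (w \<tau> \<bullet> h) \<le> 0"
      by (simp add: inner_add_left sum.distrib sum0)
    then show ?thesis using Wpos by (simp add: mult_le_0_iff)
  qed
  have zero: "\<tau> \<bullet> h = 0" if h: "strictly_dominant h" for h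
  proof -
    have "(\<Sum>w\<in>W. - (w \<tau> \<bullet> h)) = 0" by (simp add: sum_negf sum0)
    then have "\<forall>w\<in>W. - (w \<tau> \<bullet> h) = 0"
      using sum_nonneg_eq_0_iff[OF finite_weyl, of "\<lambda>w. - (w \<tau> \<bullet> h)"] np[OF h] by simp
    then show ?thesis using id_weyl by force
  qed
  have "coef \<gamma> \<tau> = 0" if \<gamma>: "\<gamma> \<in> \<Delta>" for \<gamma>
  proof -
    \<comment> \<open>The fundamental weight is a difference of two strictly dominant vectors, so
      the vanishing on those extends to it.\<close>
    have "strictly_dominant (\<rho> + \<omega> \<gamma>)"
      using \<gamma> by (auto simp: strictly_dominant_iff mult_at_add mult_at_rho mult_at_fund_weight)
    then have "\<tau> \<bullet> \<omega> \<gamma> = 0"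
      using zero[of "\<rho> + \<omega> \<gamma>"] zero[OF strictly_dominant_rho] by (simp add: inner_add_right)
    then show ?thesis by (simp add: coef_def inner_commute)
  qed
  then have "\<tau> = 0" by (intro eq_if_coef_eq) simp
  then show "\<tau> \<in> {0}" by simp
qed

lemma dom_le_imp_inner_less:
  assumes "dom_le \<Delta> \<nu> mu" "\<nu> \<noteq> mu" "strictly_dominant h"
  shows "\<nu> \<bullet> h < mu \<bullet> h"
proof -
  obtain c :: "'a \<Rightarrow> nat" where c: "mu - \<nu> = (\<Sum>\<alpha>\<in>\<Delta>. of_nat (c \<alpha>) *\<^sub>R \<alpha>)"
    using assms(1) by (auto simp: dom_le_def)
  have "coef \<gamma> (mu - \<nu>) \<ge> 0" if "\<gamma> \<in> \<Delta>" for \<gamma>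
    unfolding c using coef_sum_base[OF that order_refl, of "\<lambda>\<alpha>. of_nat (c \<alpha>)"] that by simp
  then have "(mu - \<nu>) \<bullet> h > 0"
    using assms(2,3) inner_pos_if_coef_nonneg[of "mu - \<nu>" h] by (simp add: strictly_dominant_def)
  then show ?thesis by (simp add: inner_diff_left)
qed

text \<open>Mutual divisibility bounds the sum of any two exponents of the cofactors by zero.
  Invariance then makes both cofactors constants with product 1, and the positive leading
  coefficient decides the sign.\<close>

lemma altsum_eq_if_mutually_dvd:
  assumes \<nu>: "strictly_dominant \<nu>" and q1: "weyl_invariant q1" "D = S \<nu> * q1"
    and q2: "weyl_invariant q2" "S \<nu> = D * q2" and lead: "pos_lead_coeff \<Delta> D"
  shows "D = S \<nu>"
proof -
  obtain \<kappa> where \<kappa>: "lookup D \<kappa> > 0" "\<And>x. x \<in> keys D \<Longrightarrow> dom_le \<Delta> x \<kappa>"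
    using lead by (auto simp: pos_lead_coeff_def)
  have \<kappa>D: "\<kappa> \<in> keys D" using \<kappa>(1) by (simp add: in_keys_iff)
  have top: "x \<bullet> h < \<kappa> \<bullet> h" if "strictly_dominant h" "x \<in> keys D" "x \<noteq> \<kappa>" for x h
    using dom_le_imp_inner_less[OF \<kappa>(2)] that by blast
  have \<nu>key: "\<nu> \<in> keys (S \<nu>)" using lookup_altsum_self[OF \<nu>] by (simp add: in_keys_iff)
  have b1: "(\<nu> + \<tau>) \<bullet> h \<le> \<kappa> \<bullet> h" if h: "strictly_dominant h" and \<tau>: "\<tau> \<in> keys q1" for \<tau> h
  proof (rule keys_altsum_cofactor_bound[OF \<nu> h _ \<tau>])
    fix x assume "x \<in> keys (S \<nu> * q1)"
    then show "x \<bullet> h \<le> \<kappa> \<bullet> h" using top[OF h, of x] by (cases "x = \<kappa>") (auto simp flip: q1(2))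
  qed
  have b2: "(\<kappa> + \<sigma>) \<bullet> h \<le> \<nu> \<bullet> h" if h: "strictly_dominant h" and \<sigma>: "\<sigma> \<in> keys q2" for \<sigma> h
  proof (rule keys_cofactor_bound[OF _ \<kappa>D _ \<sigma>])
    show "x \<bullet> h < \<kappa> \<bullet> h" if "x \<in> keys D" "x \<noteq> \<kappa>" for x using top[OF h that] .
    fix x assume "x \<in> keys (D * q2)"
    then show "x \<bullet> h \<le> \<nu> \<bullet> h" using altsum_top[OF \<nu> h, of x] by (cases "x = \<nu>") (auto simp flip: q2(2))
  qed
  \<comment> \<open>The highest exponents \<open>\<nu>\<close> of \<open>S \<nu>\<close> and
    \<open>\<kappa>\<close> of \<open>D\<close> cancel when the two bounds are added.\<close>
  have le: "(\<tau> + \<sigma>) \<bullet> h \<le> 0" if "strictly_dominant h" "\<tau> \<in> keys q1" "\<sigma> \<in> keys q2" for h \<tau> \<sigma>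
    using b1[OF that(1,2)] b2[OF that(1,3)] by (simp add: inner_add_left)
  have "q1 \<noteq> 0" using \<kappa>D q1(2) by auto
  moreover have "q2 \<noteq> 0" using \<nu>key q2(2) by auto
  ultimately obtain \<tau> \<sigma> where ts: "\<tau> \<in> keys q1" "\<sigma> \<in> keys q2"
    using keys_eq_empty by (metis all_not_in_conv)
  have k1: "keys q1 \<subseteq> {0}"
    by (rule keys_invariant_trivial[OF q1(1) q2(1) ts(2) le])
  have k2: "keys q2 \<subseteq> {0}"
    by (rule keys_invariant_trivial[OF q2(1) q1(1) ts(1)]) (use le in \<open>metis add.commute\<close>)
  define c where "c = lookup q1 0"
  define d where "d = lookup q2 0"
  have single: "q = single 0 (lookup q 0)" if "keys q \<subseteq> {0}"
    for q :: "'a \<Rightarrow>\<^sub>0 int"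
  proof (rule poly_mapping_eqI)
    fix k
    show "lookup q k = lookup (single 0 (lookup q 0)) k"
      using that by (cases "k = 0") (auto simp: lookup_single in_keys_iff)
  qed
  have e1: "q1 = single 0 c" and e2: "q2 = single 0 d"
    unfolding c_def d_def by (rule single[OF k1], rule single[OF k2])
  have "S \<nu> * (q1 * q2) = S \<nu> * 1"
    unfolding mult.assoc[symmetric] q1(2)[symmetric] by (simp flip: q2(2))
  then have "q1 * q2 = 1" by (rule altsum_mult_cancel[OF \<nu>])
  then have "single (0::'a) (c * d) = 1"
    unfolding e1 e2 mult_single by simp
  then have "c * d = 1" by (metis lookup_one_zero lookup_single_eq)
  then have c: "c = 1 \<or> c = -1" by (auto simp: zmult_eq_1_iff)
  have D: "D = S \<nu> * single 0 c" using q1(2) e1 by simp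
  have "\<kappa> \<bullet> \<rho> \<le> \<nu> \<bullet> \<rho>" using b2[OF strictly_dominant_rho, of 0] ts(2) k2 by auto
  moreover have "\<nu> \<bullet> \<rho> \<le> \<kappa> \<bullet> \<rho>" using b1[OF strictly_dominant_rho, of 0] ts(1) k1 by auto
  moreover have "\<nu> \<in> keys D"
  proof -
    have "lookup D (\<nu> + 0) = c"
      unfolding D using c by (subst lookup_altsum_mult_top[OF \<nu> strictly_dominant_rho]) auto
    then show ?thesis using c by (auto simp: in_keys_iff)
  qed
  ultimately have "\<kappa> = \<nu>" using top[OF strictly_dominant_rho, of \<nu>] by (cases "\<nu> = \<kappa>") auto
  then have "lookup D (\<nu> + 0) > 0" using \<kappa>(1) by simp
  then have "c > 0"
    unfolding D using c by (subst (asm) lookup_altsum_mult_top[OF \<nu> strictly_dominant_rho]) auto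
  then have "c = 1" using c by auto
  then show ?thesis using D by simp
qed

text \<open>The alternating sum of the greatest generator weight divides \<open>D\<close> as one of
  the generators, and it is itself a common multiple of all of them by
  \<open>inv_dvd_altsum\<close>.\<close>

lemma is_D_eq_altsum:
  assumes irr: "irreducible_root_system \<Phi>" and \<nu>: "\<nu> \<in> generator_weights lam"
    and max: "\<And>\<nu>'. \<nu>' \<in> generator_weights lam \<Longrightarrow> weight_dvd \<Delta> \<nu>' \<nu>" and D: "is_D \<Phi> \<Delta> lam D"
  shows "D = S \<nu>"
proof -
  have spec: "special_weight \<nu>'" if "\<nu>' \<in> generator_weights lam" for \<nu>'
    using that by (simp add: generator_weights_def)
  note props = special_weight_props[OF irr spec]
  have "D_generators \<Phi> \<Delta> lam \<noteq> {}" using \<nu> by (auto simp: D_generators_eq)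
  then have D': "\<And>g. g \<in> D_generators \<Phi> \<Delta> lam \<Longrightarrow> inv_dvd \<Phi> g D"
    "\<And>M. in_ZP \<Phi> M \<Longrightarrow> anti_invariant \<Phi> \<Delta> M \<Longrightarrow> (\<And>g. g \<in> D_generators \<Phi> \<Delta> lam \<Longrightarrow> inv_dvd \<Phi> g M) \<Longrightarrow> inv_dvd \<Phi> D M"
    "pos_lead_coeff \<Delta> D"
    using D unfolding is_D_def by presburger+
  have "inv_dvd \<Phi> (S \<nu>) D" using \<nu> by (intro D'(1)) (auto simp: D_generators_eq)
  then obtain q1 where q1: "weyl_invariant q1" "D = S \<nu> * q1"
    by (auto simp: inv_dvd_def weyl_invariant_def)
  have dvd: "inv_dvd \<Phi> g (S \<nu>)" if g: "g \<in> D_generators \<Phi> \<Delta> lam" for g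
  proof -
    obtain \<nu>' where "\<nu>' \<in> generator_weights lam" "g = S \<nu>'"
      using g by (auto simp: D_generators_eq)
    then show ?thesis using inv_dvd_altsum[OF props max] by blast
  qed
  have "keys (S \<nu>) \<subseteq> weight_lattice \<Phi>"
  proof
    fix x assume "x \<in> keys (S \<nu>)"
    then obtain w where w: "w \<in> W" "x = w \<nu>" using keys_altsum by blast
    have "\<nu> \<in> multiples_lattice \<rho>" using props(3)[OF \<nu>] by (simp add: multiples_lattice_def mult_at_rho)
    then have "x \<in> multiples_lattice \<rho>"
      unfolding w(2) by (rule multiples_lattice_weyl[OF strictly_dominant_rho refl_compatible_rho w(1)])
    then show "x \<in> weight_lattice \<Phi>" by (intro weight_latticeI) (simp add: multiples_lattice_def mult_at_rho)
  qed
  then have "inv_dvd \<Phi> D (S \<nu>)"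
    by (intro D'(2) anti_invariant_altsum dvd) (simp add: in_ZP_def)
  then obtain q2 where q2: "weyl_invariant q2" "S \<nu> = D * q2"
    by (auto simp: inv_dvd_def weyl_invariant_def)
  show ?thesis by (rule altsum_eq_if_mutually_dvd[OF props(1)[OF \<nu>] q1 q2 D'(3)])
qed

end

section \<open>Zeros of exponential factors at roots of unity\<close>

lemma exp_root_of_unity_eq_1_iff:
  assumes "k > 0"
  shows "exp (- (2 * of_real pi * \<i> / of_nat k) * of_nat n) = 1 \<longleftrightarrow> k dvd n"
proof -
  let ?z = "- (2 * of_real pi * \<i> / of_nat k) * of_nat n :: complex"
  have "?z = Complex 0 (- (2 * pi * real n / real k))"
    by (simp add: complex_eq_iff)
  then have ReIm: "Re ?z = 0" "Im ?z = - (2 * pi * real n / real k)" by simp_all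
  have "exp ?z = 1 \<longleftrightarrow> (\<exists>i::int. - (2 * pi * real n / real k) = of_int (2 * i) * pi)"
    unfolding exp_eq_1 ReIm by simp
  also have "\<dots> \<longleftrightarrow> (\<exists>i::int. int n = - i * int k)"
  proof (intro ex_cong1)
    fix i :: int
    have "- (2 * pi * real n / real k) = of_int (2 * i) * pi \<longleftrightarrow> (2 * pi) * (- real n) = (2 * pi) * (of_int i * real k)"
      using assms by (simp add: field_simps)
    also have "\<dots> \<longleftrightarrow> - real n = of_int i * real k"
      by (rule mult_cancel_left[THEN trans]) simp
    also have "\<dots> \<longleftrightarrow> real n = - of_int i * real k"
      by auto
    also have "\<dots> \<longleftrightarrow> real_of_int (int n) = real_of_int (- i * int k)" by simp
    also have "\<dots> \<longleftrightarrow> int n = - i * int k" by (rule of_int_eq_iff)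
    finally show "- (2 * pi * real n / real k) = of_int (2 * i) * pi \<longleftrightarrow> int n = - i * int k" .
  qed
  also have "\<dots> \<longleftrightarrow> int k dvd int n"
  proof
    assume "\<exists>i::int. int n = - i * int k"
    then show "int k dvd int n" by (metis dvd_triv_right)
  next
    assume "int k dvd int n"
    then obtain j where "int n = int k * j" by (elim dvdE)
    then show "\<exists>i::int. int n = - i * int k" by (intro exI[of _ "- j"]) simp
  qed
  finally show ?thesis by simp
qed

text \<open>The left-hand side vanishes at a primitive \<open>k\<close>-th root of unity to order two if \<open>k\<close> divides
  \<open>v\<close>, the right-hand side only to order one.\<close>

lemma not_dvd_if_simple_zero:
  fixes R E :: "complex \<Rightarrow> complex"
  assumes eq: "\<And>z. (1 - exp (- z * of_nat a)) * (1 - exp (- z * of_nat v)) * R z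
      = (1 - exp (- z * of_nat b)) * (1 - exp (- z * of_nat n)) * E z"
    and R: "\<And>z. R field_differentiable at z" and E: "\<And>z. E field_differentiable at z" "\<And>z. E z \<noteq> 0"
    and k: "k > 0" "k dvd a" "\<not> k dvd b" "k dvd n" "n > 0"
  shows "\<not> k dvd v"
proof
  assume kv: "k dvd v"
  define z where "z = 2 * of_real pi * \<i> / of_nat k"
  note one = exp_root_of_unity_eq_1_iff[OF k(1), folded z_def]
  obtain R' where R': "(R has_field_derivative R') (at z)"
    using R field_differentiable_def by blast
  obtain E' where E': "(E has_field_derivative E') (at z)"
    using E field_differentiable_def by blast
  \<comment> \<open>Two factors vanish at \<open>z\<close>, so every term of the product rule still
    contains a vanishing factor.\<close>
  have "((\<lambda>z. (1 - exp (- z * of_nat a)) * (1 - exp (- z * of_nat v)) * R z) has_field_derivative 0) (at z)"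
    by (rule derivative_eq_intros R' refl | simp)+ (use one[of a] one[of v] k(2) kv in auto)
  \<comment> \<open>Here only the factor with \<open>n\<close> vanishes; its derivative at
    \<open>z\<close> is \<open>n\<close>, as the exponential equals 1 there.\<close>
  moreover have "((\<lambda>z. (1 - exp (- z * of_nat b)) * (1 - exp (- z * of_nat n)) * E z) has_field_derivative
      (1 - exp (- z * of_nat b)) * of_nat n * E z) (at z)"
    by (rule derivative_eq_intros E' refl | simp)+ (use one[of n] k(4) in auto)
  ultimately have "(1 - exp (- z * of_nat b)) * of_nat n * E z = 0"
    unfolding eq by (rule DERIV_unique[symmetric])
  then show False using one[of b] k(3,5) E(2)[of z] by auto
qed

lemma field_differentiable_exp_mult: "(\<lambda>z::complex. exp (z * c)) field_differentiable at z"
proof -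
  have "((\<lambda>z. exp (z * c)) has_field_derivative exp (z * c) * c) (at z)"
    by (auto intro!: derivative_eq_intros)
  then show ?thesis by (auto simp: field_differentiable_def)
qed

context based_root_system
begin

subsection \<open>Faces in the direction of a simple root\<close>

text \<open>The sum of the other fundamental weights: zero on \<alpha> and positive on the other
  simple roots. On the orbit of a strictly dominant \<open>lam\<close> its maximum is attained
  exactly at \<open>lam\<close> and \<open>refl \<alpha> lam\<close>, the ends of an edge.\<close>

definition face_functional :: "'a \<Rightarrow> 'a" where
  "face_functional \<alpha> = \<rho> - \<omega> \<alpha>"

text \<open>Selects the exponents on one level of the functional and evaluates them through their
  coordinate at \<alpha>. This coordinate may be fractional, so \<open>exp\<close> takes the place
  of powers of a variable.\<close>

definition face_weight :: "'a \<Rightarrow> real \<Rightarrow> complex \<Rightarrow> 'a \<Rightarrow> complex" where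
  "face_weight \<alpha> c z v = (if v \<bullet> face_functional \<alpha> = c then exp (z * of_real (coef \<alpha> v)) else 0)"

lemma inner_face_functional:
  assumes "\<alpha> \<in> \<Delta>" "\<gamma> \<in> \<Delta>"
  shows "\<gamma> \<bullet> face_functional \<alpha> = (if \<gamma> = \<alpha> then 0 else \<gamma> \<bullet> \<gamma> / 2)"
proof -
  have "mult_at \<gamma> (face_functional \<alpha>) = (if \<gamma> = \<alpha> then 0 else 1)"
    using assms by (simp add: face_functional_def mult_at_diff mult_at_rho mult_at_fund_weight)
  then show ?thesis using inner_simple_pos[OF assms(2)] by (auto simp: mult_at_eq split: if_splits)
qed

lemma dominant_face_functional: "\<alpha> \<in> \<Delta> \<Longrightarrow> dominant (face_functional \<alpha>)"
  by (auto simp: dominant_def inner_face_functional)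

text \<open>The coordinates of \<open>lam - w lam\<close> are nonnegative, so a vanishing pairing
  leaves only a multiple of \<alpha>. Equality of norms admits two multiples, those of the identity
  and of the reflection.\<close>

lemma weyl_face_cases:
  assumes \<alpha>: "\<alpha> \<in> \<Delta>" and lam: "strictly_dominant lam" and w: "w \<in> W"
    and eq: "w lam \<bullet> face_functional \<alpha> = lam \<bullet> face_functional \<alpha>"
  shows "w = id \<or> w = refl \<alpha>"
proof -
  let ?d = "lam - w lam"
  have nn: "coef \<gamma> ?d * (\<gamma> \<bullet> face_functional \<alpha>) \<ge> 0" if "\<gamma> \<in> \<Delta>" for \<gamma>
    using coef_diff_weyl_nonneg[OF w strictly_dominant_imp_dominant[OF lam] that] dominant_face_functional[OF \<alpha>] that
    by (simp add: dominant_def)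
  have "(\<Sum>\<gamma>\<in>\<Delta>. coef \<gamma> ?d * (\<gamma> \<bullet> face_functional \<alpha>)) = 0"
    using eq by (simp add: inner_diff_left flip: inner_eq_sum_coef)
  then have "coef \<gamma> ?d * (\<gamma> \<bullet> face_functional \<alpha>) = 0" if "\<gamma> \<in> \<Delta>" for \<gamma>
    using sum_nonneg_eq_0_iff[OF finite_base, of "\<lambda>\<gamma>. coef \<gamma> ?d * (\<gamma> \<bullet> face_functional \<alpha>)"] nn that by simp
  then have zero: "coef \<gamma> ?d = 0" if "\<gamma> \<in> \<Delta>" "\<gamma> \<noteq> \<alpha>" for \<gamma>
    using that inner_simple_pos[OF that(1)] by (force simp: inner_face_functional[OF \<alpha>])
  define c where "c = coef \<alpha> ?d"
  have "?d = c *\<^sub>R \<alpha>"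
    by (rule eq_if_coef_eq) (use zero \<alpha> in \<open>auto simp: coef_scale coef_simple c_def\<close>)
  then have wl: "w lam = lam - c *\<^sub>R \<alpha>" by (simp add: algebra_simps)
  have "(lam - c *\<^sub>R \<alpha>) \<bullet> (lam - c *\<^sub>R \<alpha>) = lam \<bullet> lam"
    using inner_weyl[OF w, of lam lam] by (simp add: wl)
  then have "c * (c * (\<alpha> \<bullet> \<alpha>) - 2 * (\<alpha> \<bullet> lam)) = 0"
    by (simp add: algebra_simps inner_commute)
  then consider "c = 0" | "c * (\<alpha> \<bullet> \<alpha>) = 2 * (\<alpha> \<bullet> lam)" by auto
  then show ?thesis
  proof cases
    case 1
    then show ?thesis using weyl_stabilizer_trivial[OF w lam] wl by simp
  next
    case 2
    then have "c = mult_at \<alpha> lam" using inner_simple_pos[OF \<alpha>] by (simp add: mult_at_eq field_simps)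
    then have "w lam = refl \<alpha> lam" using wl by (simp add: refl_def)
    then show ?thesis using weyl_eq_if_eq_at[OF w refl_weyl[OF simple_root[OF \<alpha>]] lam] by blast
  qed
qed

lemma face_altsum:
  assumes \<alpha>: "\<alpha> \<in> \<Delta>" and lam: "strictly_dominant lam"
  shows "weighted_sum (face_weight \<alpha> (lam \<bullet> face_functional \<alpha>) z) (S lam)
    = exp (z * of_real (coef \<alpha> lam)) * (1 - exp (- z * of_real (mult_at \<alpha> lam)))"
proof -
  let ?f = "\<lambda>w. of_int (sgn_W w) * face_weight \<alpha> (lam \<bullet> face_functional \<alpha>) z (w lam)"
  have r: "refl \<alpha> \<in> W" by (rule refl_weyl[OF simple_root[OF \<alpha>]])
  have "sgn_W id \<noteq> sgn_W (refl \<alpha>)" using weyl_sign_refl[OF \<alpha>] by simp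
  then have ne: "id \<noteq> refl \<alpha>" by metis
  have "weighted_sum (face_weight \<alpha> (lam \<bullet> face_functional \<alpha>) z) (S lam) = sum ?f W"
    by (rule weighted_sum_altsum)
  also have "\<dots> = sum ?f {id, refl \<alpha>}"
    using weyl_face_cases[OF \<alpha> lam] id_weyl r finite_weyl
    by (intro sum.mono_neutral_right) (auto simp: face_weight_def)
  also have "\<dots> = ?f id + ?f (refl \<alpha>)" using ne by simp
  also have "?f id = exp (z * of_real (coef \<alpha> lam))" by (simp add: face_weight_def)
  also have "?f (refl \<alpha>) = - exp (z * of_real (coef \<alpha> lam) - z * of_real (mult_at \<alpha> lam))"
  proof -
    have "refl \<alpha> lam \<bullet> face_functional \<alpha> = lam \<bullet> face_functional \<alpha>"
      using inner_face_functional[OF \<alpha> \<alpha>] by (simp add: refl_def inner_diff_left)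
    then show ?thesis
      by (simp add: face_weight_def weyl_sign_refl \<alpha> coef_refl_same right_diff_distrib)
  qed
  finally show ?thesis by (simp add: exp_diff exp_minus right_diff_distrib field_simps)
qed

text \<open>If \<open>c\<close> and \<open>d\<close> bound the levels of the factors, level
  \<open>c + d\<close> is reached only by exponents on the top level of each factor.\<close>

lemma weighted_sum_face_mult:
  assumes "\<And>\<kappa>. \<kappa> \<in> keys f \<Longrightarrow> \<kappa> \<bullet> face_functional \<alpha> \<le> c"
    and "\<And>\<kappa>. \<kappa> \<in> keys g \<Longrightarrow> \<kappa> \<bullet> face_functional \<alpha> \<le> d"
  shows "weighted_sum (face_weight \<alpha> (c + d) z) (f * g)
    = weighted_sum (face_weight \<alpha> c z) f * weighted_sum (face_weight \<alpha> d z) g"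
proof (rule weighted_sum_mult_split)
  fix x y assume xy: "x \<in> keys f" "y \<in> keys g"
  have "(x + y) \<bullet> face_functional \<alpha> = c + d \<longleftrightarrow> x \<bullet> face_functional \<alpha> = c \<and> y \<bullet> face_functional \<alpha> = d"
    using assms(1)[OF xy(1)] assms(2)[OF xy(2)] by (auto simp: inner_add_left)
  then show "face_weight \<alpha> (c + d) z (x + y) = face_weight \<alpha> c z x * face_weight \<alpha> d z y"
    by (simp add: face_weight_def coef_add distrib_left exp_add)
qed

lemma keys_altsum_inner_le:
  assumes "strictly_dominant lam" "dominant h" "\<kappa> \<in> keys (S lam)"
  shows "\<kappa> \<bullet> h \<le> lam \<bullet> h"
proof -
  obtain w where "w \<in> W" "\<kappa> = w lam" using keys_altsum assms(3) by blast
  then show ?thesis using weyl_inner_le strictly_dominant_imp_dominant assms by blast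
qed

text \<open>Heights are controlled for strictly dominant directions, whereas
  \<open>face_functional\<close> lies on walls of the chamber; a small multiple of \<rho> bridges
  the gap.\<close>

lemma inner_le_dominant_limit:
  assumes "\<And>h. strictly_dominant h \<Longrightarrow> x \<bullet> h \<le> y \<bullet> h" "dominant h"
  shows "x \<bullet> h \<le> y \<bullet> h"
proof (rule ccontr)
  assume "\<not> ?thesis"
  then have d: "(x - y) \<bullet> h > 0" by (simp add: inner_diff_left)
  define r where "r = \<bar>(x - y) \<bullet> \<rho>\<bar> + 1"
  \<comment> \<open>The scale makes the perturbation cost at most half of the supposed gap, since
    \<open>r\<close> exceeds the absolute value of the pairing with \<rho>.\<close>
  define e where "e = (x - y) \<bullet> h / (2 * r)"
  have r: "r > 0" by (simp add: r_def)
  have e: "e > 0" using d r by (simp add: e_def)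
  have "strictly_dominant (h + e *\<^sub>R \<rho>)"
    using assms(2) rho_pos e by (auto simp: strictly_dominant_def dominant_def inner_add_right add_nonneg_pos)
  then have "(x - y) \<bullet> h + e * ((x - y) \<bullet> \<rho>) \<le> 0"
    using assms(1)[of "h + e *\<^sub>R \<rho>"] by (simp add: inner_add_right inner_diff_left algebra_simps)
  moreover have "e * ((x - y) \<bullet> \<rho>) \<ge> - (e * r)"
  proof -
    have "e * (- r) \<le> e * ((x - y) \<bullet> \<rho>)"
      using e unfolding r_def by (intro mult_left_mono) linarith+
    then show ?thesis by (simp only: mult_minus_right)
  qed
  moreover have "e * r = (x - y) \<bullet> h / 2"
    using r by (simp add: e_def)
  ultimately show False using d by linarith
qed

text \<open>Restricting the product equation to its top level gives an equation of functions of one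
  complex variable. The height bound identifies the level on which the cofactor contributes.\<close>

lemma face_identity:
  assumes \<alpha>: "\<alpha> \<in> \<Delta>" and sd: "strictly_dominant l" "strictly_dominant m" "strictly_dominant n"
    and eq: "S l * q = S m * S n"
  shows "\<And>h \<tau>. strictly_dominant h \<Longrightarrow> \<tau> \<in> keys q \<Longrightarrow> \<tau> \<bullet> h \<le> (m + n - l) \<bullet> h"
    and "\<And>z. exp (z * of_real (coef \<alpha> l)) * (1 - exp (- z * of_real (mult_at \<alpha> l)))
        * weighted_sum (face_weight \<alpha> ((m + n - l) \<bullet> face_functional \<alpha>) z) q
      = exp (z * of_real (coef \<alpha> m)) * (1 - exp (- z * of_real (mult_at \<alpha> m)))
        * (exp (z * of_real (coef \<alpha> n)) * (1 - exp (- z * of_real (mult_at \<alpha> n))))"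
proof -
  have bound: "\<tau> \<bullet> h \<le> (m + n - l) \<bullet> h" if h: "strictly_dominant h" and \<tau>: "\<tau> \<in> keys q" for h \<tau>
  proof -
    have "\<kappa> \<bullet> h \<le> (m + n) \<bullet> h" if \<kappa>: "\<kappa> \<in> keys (S l * q)" for \<kappa>
    proof -
      obtain x y where "x \<in> keys (S m)" "y \<in> keys (S n)" "\<kappa> = x + y"
        using \<kappa> keys_mult[of "S m" "S n"] unfolding eq by blast
      then show ?thesis
        using keys_altsum_inner_le[OF sd(2) strictly_dominant_imp_dominant[OF h], of x]
          keys_altsum_inner_le[OF sd(3) strictly_dominant_imp_dominant[OF h], of y]
        by (simp add: inner_add_left)
    qed
    from keys_altsum_cofactor_bound[OF sd(1) h this \<tau>] show ?thesis
      by (simp add: inner_add_left inner_diff_left)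
  qed
  then show "\<And>h \<tau>. strictly_dominant h \<Longrightarrow> \<tau> \<in> keys q \<Longrightarrow> \<tau> \<bullet> h \<le> (m + n - l) \<bullet> h" .
  let ?h = "face_functional \<alpha>"
  note dom = dominant_face_functional[OF \<alpha>]
  have q: "\<tau> \<bullet> ?h \<le> (m + n - l) \<bullet> ?h" if "\<tau> \<in> keys q" for \<tau>
    by (rule inner_le_dominant_limit[OF bound[OF _ that] dom])
  fix z
  have "weighted_sum (face_weight \<alpha> (l \<bullet> ?h + (m + n - l) \<bullet> ?h) z) (S l * q)
    = weighted_sum (face_weight \<alpha> (m \<bullet> ?h + n \<bullet> ?h) z) (S m * S n)"
    by (simp add: eq inner_add_left inner_diff_left)
  moreover have "weighted_sum (face_weight \<alpha> (l \<bullet> ?h + (m + n - l) \<bullet> ?h) z) (S l * q)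
    = weighted_sum (face_weight \<alpha> (l \<bullet> ?h) z) (S l) * weighted_sum (face_weight \<alpha> ((m + n - l) \<bullet> ?h) z) q"
    by (intro weighted_sum_face_mult keys_altsum_inner_le[OF sd(1) dom] q)
  moreover have "weighted_sum (face_weight \<alpha> (m \<bullet> ?h + n \<bullet> ?h) z) (S m * S n)
    = weighted_sum (face_weight \<alpha> (m \<bullet> ?h) z) (S m) * weighted_sum (face_weight \<alpha> (n \<bullet> ?h) z) (S n)"
    by (intro weighted_sum_face_mult keys_altsum_inner_le[OF sd(2) dom] keys_altsum_inner_le[OF sd(3) dom])
  ultimately show "exp (z * of_real (coef \<alpha> l)) * (1 - exp (- z * of_real (mult_at \<alpha> l)))
        * weighted_sum (face_weight \<alpha> ((m + n - l) \<bullet> ?h) z) q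
      = exp (z * of_real (coef \<alpha> m)) * (1 - exp (- z * of_real (mult_at \<alpha> m)))
        * (exp (z * of_real (coef \<alpha> n)) * (1 - exp (- z * of_real (mult_at \<alpha> n))))"
    by (simp only: face_altsum[OF \<alpha>] sd)
qed

text \<open>At \<open>2 pi i / k\<close> the factor belonging to \<open>a\<close> vanishes and that
  belonging to \<open>b\<close> does not, so the factor belonging to \<open>c\<close> must.\<close>

lemma face_dvd:
  assumes \<alpha>: "\<alpha> \<in> \<Delta>" and sd: "strictly_dominant l" "strictly_dominant m" "strictly_dominant n"
    and eq: "S l * q = S m * S n"
    and nats: "mult_at \<alpha> l = real a" "mult_at \<alpha> m = real b" "mult_at \<alpha> n = real c"
    and k: "k > 0" "k dvd a" "\<not> k dvd b"
  shows "k dvd c"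
proof -
  define z where "z = 2 * of_real pi * \<i> / complex_of_nat k"
  note one = exp_root_of_unity_eq_1_iff[OF k(1), folded z_def]
  have "(1 - exp (- z * of_nat b)) * (1 - exp (- z * of_nat c)) = 0"
    using face_identity(2)[OF \<alpha> sd eq, of z] one[of a] k(2) by (simp add: nats)
  then show ?thesis using one[of b] one[of c] k(3) by simp
qed

text \<open>The divisor \<open>S \<nu>\<close> of the cofactor contributes a factor that would
  vanish at \<open>2 pi i / k\<close> if \<open>k\<close> divided \<open>v\<close>, producing a
  double zero against the simple zero on the other side.\<close>

lemma face_not_dvd:
  assumes \<alpha>: "\<alpha> \<in> \<Delta>" and sd: "strictly_dominant l" "strictly_dominant m" "strictly_dominant n" "strictly_dominant \<nu>"
    and eq: "S l * (S \<nu> * q) = S m * S n"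
    and nats: "mult_at \<alpha> l = real a" "mult_at \<alpha> m = real b" "mult_at \<alpha> n = real c" "mult_at \<alpha> \<nu> = real v"
    and k: "k > 0" "k dvd a" "\<not> k dvd b"
  shows "\<not> k dvd v"
proof -
  let ?h = "face_functional \<alpha>"
  note dom = dominant_face_functional[OF \<alpha>]
  define t where "t = m + n - l - \<nu>"
  have bound: "\<tau> \<bullet> h \<le> t \<bullet> h" if h: "strictly_dominant h" and \<tau>: "\<tau> \<in> keys q" for h \<tau>
    using keys_altsum_cofactor_bound[OF sd(4) h face_identity(1)[OF \<alpha> sd(1-3) eq h] \<tau>]
    by (simp add: t_def inner_add_left inner_diff_left)
  have q: "\<tau> \<bullet> ?h \<le> t \<bullet> ?h" if "\<tau> \<in> keys q" for \<tau>
    by (rule inner_le_dominant_limit[OF bound[OF _ that] dom])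
  define F where "F = (\<lambda>z. weighted_sum (face_weight \<alpha> (t \<bullet> ?h) z) q)"
  have split: "weighted_sum (face_weight \<alpha> ((m + n - l) \<bullet> ?h) z) (S \<nu> * q)
    = exp (z * of_real (coef \<alpha> \<nu>)) * (1 - exp (- z * of_real (mult_at \<alpha> \<nu>))) * F z" for z
  proof -
    have "weighted_sum (face_weight \<alpha> (\<nu> \<bullet> ?h + t \<bullet> ?h) z) (S \<nu> * q)
      = weighted_sum (face_weight \<alpha> (\<nu> \<bullet> ?h) z) (S \<nu>) * F z"
      unfolding F_def by (intro weighted_sum_face_mult keys_altsum_inner_le[OF sd(4) dom] q)
    moreover have "\<nu> \<bullet> ?h + t \<bullet> ?h = (m + n - l) \<bullet> ?h"
      by (simp add: t_def inner_add_left inner_diff_left)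
    ultimately show ?thesis by (simp only: face_altsum[OF \<alpha> sd(4)])
  qed
  have diffF: "F field_differentiable at z" for z
  proof -
    have "(\<lambda>z. of_int (lookup q \<kappa>) * face_weight \<alpha> (t \<bullet> ?h) z \<kappa>) field_differentiable at z" for \<kappa>
      unfolding face_weight_def
      by (cases "\<kappa> \<bullet> ?h = t \<bullet> ?h") (auto intro!: derivative_intros field_differentiable_exp_mult)
    then show ?thesis
      unfolding F_def weighted_sum_def by (intro field_differentiable_sum)
  qed
  \<comment> \<open>The exponential prefactors have no zeros; \<open>R\<close> also absorbs the
    unknown face part \<open>F\<close>, about which only differentiability is needed.\<close>
  define E where "E = (\<lambda>z. exp (z * of_real (coef \<alpha> m)) * exp (z * complex_of_real (coef \<alpha> n)))"
  define R where "R = (\<lambda>z. exp (z * of_real (coef \<alpha> l)) * exp (z * complex_of_real (coef \<alpha> \<nu>)) * F z)"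
  show ?thesis
  proof (rule not_dvd_if_simple_zero)
    show "(1 - exp (- z * of_nat a)) * (1 - exp (- z * of_nat v)) * R z
      = (1 - exp (- z * of_nat b)) * (1 - exp (- z * of_nat c)) * E z" for z
      using face_identity(2)[OF \<alpha> sd(1-3) eq, of z]
      unfolding split nats R_def E_def by (simp add: ac_simps)
    show "R field_differentiable at z" for z
      unfolding R_def by (intro field_differentiable_mult field_differentiable_exp_mult diffF)
    show "E field_differentiable at z" for z
      unfolding E_def by (intro field_differentiable_mult field_differentiable_exp_mult)
    show "E z \<noteq> 0" for z by (simp add: E_def)
    show "k dvd c" by (rule face_dvd[OF \<alpha> sd(1-3) eq nats(1-3) k])
    show "c > 0" using sd(3) \<alpha> nats(3) by (force simp: strictly_dominant_iff)
  qed (use k in auto)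
qed

end

subsection \<open>Divisors of weights\<close>

lemma small_divisor:
  fixes j m :: nat
  assumes "m \<in> {1, 2, 3}" "j dvd m"
  shows "j = 1 \<or> j = m"
proof -
  have "m > 0" using assms(1) by auto
  then have "j \<le> m" "j \<noteq> 0" using assms(2) dvd_imp_le[of j m] by (auto intro: Nat.gr0I)
  then have "j \<in> {1, 2, 3}" using assms(1) by auto
  then show ?thesis using assms by auto
qed

lemma coprime_if_small:
  fixes j m :: nat
  assumes "m \<in> {1, 2, 3}" "\<not> m dvd j"
  shows "coprime j m"
proof -
  have "gcd j m = 1 \<or> gcd j m = m" by (rule small_divisor[OF assms(1)]) simp
  then show ?thesis using assms(2) by (metis coprime_iff_gcd_eq_1 gcd_dvd1)
qed

text \<open>The coordinates of \<open>e * rho\<close> and \<open>e * rho_tilde\<close> are \<open>e\<close> and \<open>if long \<alpha> then e else e * m\<close>.\<close>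

lemma maximal_divisor:
  fixes l :: "'b \<Rightarrow> nat" and long :: "'b \<Rightarrow> bool"
  assumes "finite A" "A \<noteq> {}" and l: "\<forall>\<alpha>\<in>A. l \<alpha> > 0" and m: "m \<in> {1, 2, 3}"
  defines "v \<equiv> \<lambda>e \<alpha>. if long \<alpha> then e else e * m"
  shows "(\<exists>g>0. (\<forall>\<alpha>\<in>A. g dvd l \<alpha>) \<and> (\<forall>d. (\<forall>\<alpha>\<in>A. d dvd l \<alpha>) \<longrightarrow> d dvd g) \<and>
      (\<forall>e. (\<forall>\<alpha>\<in>A. v e \<alpha> dvd l \<alpha>) \<longrightarrow> (\<forall>\<alpha>\<in>A. v e \<alpha> dvd g))) \<or>
    (\<exists>e0>0. (\<forall>\<alpha>\<in>A. v e0 \<alpha> dvd l \<alpha>) \<and> (\<forall>d. (\<forall>\<alpha>\<in>A. d dvd l \<alpha>) \<longrightarrow> (\<forall>\<alpha>\<in>A. d dvd v e0 \<alpha>)) \<and>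
      (\<forall>e. (\<forall>\<alpha>\<in>A. v e \<alpha> dvd l \<alpha>) \<longrightarrow> (\<forall>\<alpha>\<in>A. v e \<alpha> dvd v e0 \<alpha>)))"
proof -
  have mpos: "m > 0" using m by auto
  define g where "g = Gcd (l ` A)"
  have gl: "g dvd l \<alpha>" if "\<alpha> \<in> A" for \<alpha> unfolding g_def using that by (intro Gcd_dvd) auto
  have gmax: "d dvd g" if "\<forall>\<alpha>\<in>A. d dvd l \<alpha>" for d
    unfolding g_def using that by (intro Gcd_greatest) auto
  obtain \<alpha>0 where \<alpha>0: "\<alpha>0 \<in> A" using assms(2) by auto
  have gpos: "g > 0" using gl[OF \<alpha>0] bspec[OF l \<alpha>0] by (metis dvd_0_left_iff gr0I less_irrefl)
  \<comment> \<open>If some short coordinate is not divisible by \<open>m\<close>, no multiple of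
    the second kind divides \<open>l\<close>, and the greatest common divisor of the coordinates
    serves.\<close>
  show ?thesis
  proof (cases "\<forall>\<alpha>\<in>A. \<not> long \<alpha> \<longrightarrow> m dvd l \<alpha>")
    case False
    then have "\<not> (\<forall>\<alpha>\<in>A. v e \<alpha> dvd l \<alpha>)" for e
      by (auto simp: v_def dest: dvd_mult_right)
    then show ?thesis using gl gmax gpos by blast
  next
    case True
    \<comment> \<open>The coordinates relative to the second kind of weight, so that divisibility by
      \<open>v e\<close> becomes divisibility of \<open>u\<close> by \<open>e\<close>.\<close>
    define u where "u = (\<lambda>\<alpha>. if long \<alpha> then l \<alpha> else l \<alpha> div m)"
    have lu: "l \<alpha> = (if long \<alpha> then u \<alpha> else u \<alpha> * m)" if "\<alpha> \<in> A" for \<alpha>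
      using True that by (auto simp: u_def)
    have v_iff: "v e \<alpha> dvd l \<alpha> \<longleftrightarrow> e dvd u \<alpha>" if "\<alpha> \<in> A" for e \<alpha>
      using lu[OF that] mpos by (simp add: v_def)
    define e0 where "e0 = Gcd (u ` A)"
    have eu: "e0 dvd u \<alpha>" if "\<alpha> \<in> A" for \<alpha> unfolding e0_def using that by (intro Gcd_dvd) auto
    have emax: "e dvd e0" if "\<forall>\<alpha>\<in>A. e dvd u \<alpha>" for e
      unfolding e0_def using that by (intro Gcd_greatest) auto
    have "e0 dvd l \<alpha>" if "\<alpha> \<in> A" for \<alpha> using eu[OF that] lu[OF that] by auto
    then have "e0 dvd g" by (intro gmax) blast
    then obtain j where j: "g = e0 * j" by (elim dvdE)
    have epos: "e0 > 0" using j gpos by (cases e0) auto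
    have "g dvd m * u \<alpha>" if "\<alpha> \<in> A" for \<alpha>
      using gl[OF that] lu[OF that] by (auto simp: mult.commute split: if_splits)
    then have "g dvd Gcd ((*) m ` u ` A)" by (intro Gcd_greatest) auto
    then have "g dvd m * e0" by (simp add: Gcd_mult e0_def)
    \<comment> \<open>The quotient \<open>j\<close> of the two greatest candidates is 1 or
      \<open>m\<close>. For 1 the candidate \<open>v e0\<close> is divisible by \<open>g\<close>;
      for \<open>m\<close> the candidate \<open>g\<close> is divisible by every coordinate of
      \<open>v e0\<close>.\<close>
    then have "j dvd m" using epos by (simp add: j mult.commute[of m])
    then consider "j = 1" | "j = m" using small_divisor[OF m] by blast
    then show ?thesis
    proof cases
      case 1
      have r1: "d dvd v e0 \<alpha>" if "\<forall>\<alpha>\<in>A. d dvd l \<alpha>" for d \<alpha>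
        using gmax[OF that] j 1 by (simp add: v_def)
      have r2: "v e \<alpha> dvd v e0 \<alpha>" if "\<forall>\<alpha>\<in>A. v e \<alpha> dvd l \<alpha>" for e \<alpha>
      proof -
        have "e dvd e0" using emax[of e] that v_iff by blast
        then show ?thesis by (simp add: v_def)
      qed
      show ?thesis
        by (rule disjI2, rule exI[of _ e0]) (use epos eu v_iff r1 r2 in metis)
    next
      case 2
      have r: "v e \<alpha> dvd g" if "\<forall>\<alpha>\<in>A. v e \<alpha> dvd l \<alpha>" for e \<alpha>
      proof -
        have "e dvd e0" using emax[of e] that v_iff by blast
        then show ?thesis by (auto simp: v_def j 2)
      qed
      show ?thesis
        by (rule disjI1, rule exI[of _ g]) (use gl gmax gpos r in metis)
    qed
  qed
qed

text \<open>Let \<open>j\<close> be the complementary divisor of \<open>a\<close>. If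
  \<open>m\<close> divides \<open>j\<close>, then \<open>a\<close> divides \<open>n\<close>;
  otherwise \<open>j\<close> is coprime to \<open>m\<close>, hence divides \<open>n\<close>, and
  \<open>a\<close> is \<open>m\<close> times a divisor of \<open>n\<close> that the last assumption
  forces to be \<open>n\<close>.\<close>

lemma short_divisor_full:
  fixes a n m :: nat
  assumes m: "m \<in> {1, 2, 3}" and "n > 0" "a dvd n * m" "\<not> a dvd n"
    and no: "\<And>e. e dvd n \<Longrightarrow> e \<noteq> n \<Longrightarrow> \<not> a dvd e * m"
  shows "a = n * m"
proof -
  obtain j where j: "n * m = a * j" using assms(3) by (elim dvdE)
  have mpos: "m > 0" using m by auto
  show ?thesis
  proof (cases "m dvd j")
    case True
    then obtain i where "j = m * i" by (elim dvdE)
    then have "n * m = (a * i) * m" using j by (simp add: ac_simps)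
    then have "n = a * i" using mpos by simp
    then show ?thesis using assms(4) by simp
  next
    case False
    then have "coprime j m" by (rule coprime_if_small[OF m])
    moreover have "j dvd n * m" using j by simp
    ultimately have "j dvd n" by (simp add: coprime_dvd_mult_left_iff)
    then obtain e where e: "n = j * e" by (elim dvdE)
    have jpos: "j > 0" using e assms(2) by (cases j) auto
    have "a * j = n * m" using j by simp
    also have "\<dots> = (e * m) * j" by (subst e) (simp add: ac_simps)
    finally have "a * j = (e * m) * j" .
    then have a: "a = e * m" using jpos by simp
    have "e = n"
    proof (rule ccontr)
      assume "e \<noteq> n"
      then have "\<not> a dvd e * m" using no[of e] e by auto
      then show False using a by simp
    qed
    then show ?thesis using a by simp
  qed
qed

context based_root_system
begin

section \<open>Weights with natural coordinates\<close>

lemma weight_dvd_iff_nat: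
  assumes "\<And>\<alpha>. \<alpha> \<in> \<Delta> \<Longrightarrow> mult_at \<alpha> x = real (a \<alpha>)" "\<And>\<alpha>. \<alpha> \<in> \<Delta> \<Longrightarrow> mult_at \<alpha> y = real (b \<alpha>)"
  shows "weight_dvd \<Delta> x y \<longleftrightarrow> (\<forall>\<alpha>\<in>\<Delta>. a \<alpha> dvd b \<alpha>)"
proof -
  have "(\<exists>k::int. real (b \<alpha>) = of_int k * real (a \<alpha>)) \<longleftrightarrow> a \<alpha> dvd b \<alpha>" for \<alpha>
  proof
    assume "\<exists>k::int. real (b \<alpha>) = of_int k * real (a \<alpha>)"
    then obtain k where "real_of_int (int (b \<alpha>)) = real_of_int (k * int (a \<alpha>))" by auto
    then have "int (b \<alpha>) = k * int (a \<alpha>)" by (simp only: of_int_eq_iff)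
    then have "int (a \<alpha>) dvd int (b \<alpha>)" by simp
    then show "a \<alpha> dvd b \<alpha>" by simp
  next
    assume "a \<alpha> dvd b \<alpha>"
    then obtain k where "b \<alpha> = a \<alpha> * k" by (elim dvdE)
    then show "\<exists>k::int. real (b \<alpha>) = of_int k * real (a \<alpha>)" by (intro exI[of _ "int k"]) simp
  qed
  then show ?thesis using assms by (simp add: weight_dvd_def)
qed

lemma dominant_regular_strictly_dominant: "dominant_regular \<Phi> \<Delta> lam \<Longrightarrow> strictly_dominant lam"
  by (simp add: dominant_regular_def strictly_dominant_iff)

lemma dominant_regular_nat:
  assumes "dominant_regular \<Phi> \<Delta> lam"
  obtains l :: "'a \<Rightarrow> nat" where "\<And>\<alpha>. \<alpha> \<in> \<Delta> \<Longrightarrow> mult_at \<alpha> lam = real (l \<alpha>)" "\<And>\<alpha>. \<alpha> \<in> \<Delta> \<Longrightarrow> l \<alpha> > 0"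
proof
  fix \<alpha> assume \<alpha>: "\<alpha> \<in> \<Delta>"
  have pos: "mult_at \<alpha> lam > 0" and "mult_at \<alpha> lam \<in> \<int>"
    using assms \<alpha> simple_root[OF \<alpha>] by (auto simp: dominant_regular_def weight_lattice_def)
  then obtain i where i: "mult_at \<alpha> lam = of_int i" "i > 0" by (auto elim!: Ints_cases)
  then show "mult_at \<alpha> lam = real (nat \<lfloor>mult_at \<alpha> lam\<rfloor>)" "nat \<lfloor>mult_at \<alpha> lam\<rfloor> > 0" by auto
qed

end

text \<open>Fixes the data that \<open>root_lengths\<close> provides for an irreducible system. In
  the simply laced case \<open>m\<close> is 1, and every simple root counts as both long and
  short.\<close>

locale simple_root_system = based_root_system +
  fixes m :: nat
  assumes irr: "irreducible_root_system \<Phi>"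
    and m: "m \<in> {1, 2, 3}" and mPhi: "mPhi \<Phi> = real m"
    and lengths: "\<And>\<alpha>. \<alpha> \<in> \<Delta> \<Longrightarrow> \<alpha> \<bullet> \<alpha> = long_sqlen \<Phi> \<or> real m * (\<alpha> \<bullet> \<alpha>) = long_sqlen \<Phi>"
    and ex_long: "\<exists>\<alpha>\<in>\<Delta>. \<alpha> \<bullet> \<alpha> = long_sqlen \<Phi>"
    and ex_short: "\<exists>\<alpha>\<in>\<Delta>. real m * (\<alpha> \<bullet> \<alpha>) = long_sqlen \<Phi>"
begin

definition tilde_coord :: "nat \<Rightarrow> 'a \<Rightarrow> nat" where
  "tilde_coord e \<alpha> = (if \<alpha> \<bullet> \<alpha> = long_sqlen \<Phi> then e else e * m)"

lemma mult_at_multiple_rho: "\<alpha> \<in> \<Delta> \<Longrightarrow> mult_at \<alpha> (real d *\<^sub>R \<rho>) = real d"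
  by (simp add: mult_at_scale mult_at_rho)

lemma mult_at_multiple_rho_tilde: "\<alpha> \<in> \<Delta> \<Longrightarrow> mult_at \<alpha> (real e *\<^sub>R \<rho>t) = real (tilde_coord e \<alpha>)"
  by (simp add: mult_at_scale mult_at_rho_tilde mPhi tilde_coord_def)

lemma tilde_coord_long: "\<exists>\<alpha>\<in>\<Delta>. \<forall>e. tilde_coord e \<alpha> = e"
  using ex_long by (auto simp: tilde_coord_def)

lemma tilde_coord_short: "\<exists>\<alpha>\<in>\<Delta>. \<forall>e. tilde_coord e \<alpha> = e * m"
proof -
  obtain \<alpha> where \<alpha>: "\<alpha> \<in> \<Delta>" "real m * (\<alpha> \<bullet> \<alpha>) = long_sqlen \<Phi>" using ex_short by auto
  have "m = 1" if "\<alpha> \<bullet> \<alpha> = long_sqlen \<Phi>"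
    using \<alpha>(2) inner_simple_pos[OF \<alpha>(1)] unfolding that[symmetric] by simp
  then show ?thesis using \<alpha>(1) by (auto simp: tilde_coord_def)
qed

lemma rho_tilde_eq_rho:
  assumes "m = 1"
  shows "\<rho>t = \<rho>"
proof (rule eq_if_mult_at_eq)
  fix \<alpha> assume \<alpha>: "\<alpha> \<in> \<Delta>"
  have "mult_at \<alpha> \<rho>t = real (tilde_coord 1 \<alpha>)"
    using mult_at_multiple_rho_tilde[OF \<alpha>, of 1] by simp
  also have "\<dots> = 1" unfolding tilde_coord_def by (simp add: assms)
  finally show "mult_at \<alpha> \<rho>t = mult_at \<alpha> \<rho>" by (simp add: mult_at_rho[OF \<alpha>])
qed

lemma special_weight_rho: "d > 0 \<Longrightarrow> special_weight (real d *\<^sub>R \<rho>)"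
  and special_weight_rho_tilde: "d > 0 \<Longrightarrow> special_weight (real d *\<^sub>R \<rho>t)"
  by (auto simp: special_weight_def)

lemma weight_dvd_generators:
  assumes lam: "\<And>\<alpha>. \<alpha> \<in> \<Delta> \<Longrightarrow> mult_at \<alpha> lam = real (l \<alpha>)" and \<nu>: "\<And>\<alpha>. \<alpha> \<in> \<Delta> \<Longrightarrow> mult_at \<alpha> \<nu> = real (b \<alpha>)"
    and rho: "\<And>d. d > 0 \<Longrightarrow> \<forall>\<alpha>\<in>\<Delta>. d dvd l \<alpha> \<Longrightarrow> real d *\<^sub>R \<rho> \<noteq> lam \<Longrightarrow> \<forall>\<alpha>\<in>\<Delta>. d dvd b \<alpha>"
    and rho_tilde: "\<And>e. e > 0 \<Longrightarrow> \<forall>\<alpha>\<in>\<Delta>. tilde_coord e \<alpha> dvd l \<alpha> \<Longrightarrow> real e *\<^sub>R \<rho>t \<noteq> lam \<Longrightarrow>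
      \<forall>\<alpha>\<in>\<Delta>. tilde_coord e \<alpha> dvd b \<alpha>"
    and \<nu>': "\<nu>' \<in> generator_weights lam"
  shows "weight_dvd \<Delta> \<nu>' \<nu>"
proof -
  obtain k :: nat where k: "k > 0" "\<nu>' = real k *\<^sub>R \<rho> \<or> \<nu>' = real k *\<^sub>R \<rho>t"
    and dvd: "weight_dvd \<Delta> \<nu>' lam" and ne: "\<nu>' \<noteq> lam"
    using \<nu>' by (auto simp: generator_weights_def special_weight_def)
  from k(2) show ?thesis
  proof
    assume r: "\<nu>' = real k *\<^sub>R \<rho>"
    show ?thesis
      using rho[OF k(1)] dvd ne
        weight_dvd_iff_nat[of \<nu>' "\<lambda>_. k" lam l] weight_dvd_iff_nat[of \<nu>' "\<lambda>_. k" \<nu> b]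
      unfolding r by (simp add: mult_at_multiple_rho lam \<nu>)
  next
    assume r: "\<nu>' = real k *\<^sub>R \<rho>t"
    show ?thesis
      using rho_tilde[OF k(1)] dvd ne
        weight_dvd_iff_nat[of \<nu>' "tilde_coord k" lam l] weight_dvd_iff_nat[of \<nu>' "tilde_coord k" \<nu> b]
      unfolding r by (simp add: mult_at_multiple_rho_tilde lam \<nu>)
  qed
qed

lemma generator_rho:
  assumes "\<And>\<alpha>. \<alpha> \<in> \<Delta> \<Longrightarrow> mult_at \<alpha> lam = real (l \<alpha>)" "d > 0" "\<And>\<alpha>. \<alpha> \<in> \<Delta> \<Longrightarrow> d dvd l \<alpha>" "real d *\<^sub>R \<rho> \<noteq> lam"
  shows "real d *\<^sub>R \<rho> \<in> generator_weights lam"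
  using weight_dvd_iff_nat[of "real d *\<^sub>R \<rho>" "\<lambda>_. d" lam l] assms special_weight_rho[of d]
  by (simp add: generator_weights_def mult_at_multiple_rho)

lemma generator_rho_tilde:
  assumes "\<And>\<alpha>. \<alpha> \<in> \<Delta> \<Longrightarrow> mult_at \<alpha> lam = real (l \<alpha>)" "e > 0" "\<And>\<alpha>. \<alpha> \<in> \<Delta> \<Longrightarrow> tilde_coord e \<alpha> dvd l \<alpha>" "real e *\<^sub>R \<rho>t \<noteq> lam"
  shows "real e *\<^sub>R \<rho>t \<in> generator_weights lam"
  using weight_dvd_iff_nat[of "real e *\<^sub>R \<rho>t" "tilde_coord e" lam l] assms special_weight_rho_tilde[of e]
  by (simp add: generator_weights_def mult_at_multiple_rho_tilde)

text \<open>\<open>maximal_divisor\<close> yields a greatest element among all special divisors of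
  \<open>lam\<close>; as \<open>lam\<close> is not a multiple itself, this element differs from
  \<open>lam\<close> and is a generator weight.\<close>

lemma maximal_generator_nonmultiple:
  assumes "dominant_regular \<Phi> \<Delta> lam" and nm: "\<not> (\<exists>c::real. lam = c *\<^sub>R \<rho>)" "\<not> (\<exists>c::real. lam = c *\<^sub>R \<rho>t)"
  shows "\<exists>\<nu>\<in>generator_weights lam. \<forall>\<nu>'\<in>generator_weights lam. weight_dvd \<Delta> \<nu>' \<nu>"
proof -
  obtain l where l: "\<And>\<alpha>. \<alpha> \<in> \<Delta> \<Longrightarrow> mult_at \<alpha> lam = real (l \<alpha>)" "\<And>\<alpha>. \<alpha> \<in> \<Delta> \<Longrightarrow> l \<alpha> > 0"
    using dominant_regular_nat[OF assms(1)] by metis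
  have ne: "\<Delta> \<noteq> {}" and lpos: "\<forall>\<alpha>\<in>\<Delta>. l \<alpha> > 0" using ex_long l(2) by auto
  from maximal_divisor[where l = l and long = "\<lambda>\<alpha>. \<alpha> \<bullet> \<alpha> = long_sqlen \<Phi>", OF finite_base ne lpos m, folded tilde_coord_def]
  show ?thesis
  proof (elim disjE exE conjE)
    fix g assume g: "g > 0" "\<forall>\<alpha>\<in>\<Delta>. g dvd l \<alpha>" "\<forall>d. (\<forall>\<alpha>\<in>\<Delta>. d dvd l \<alpha>) \<longrightarrow> d dvd g"
      "\<forall>e. (\<forall>\<alpha>\<in>\<Delta>. tilde_coord e \<alpha> dvd l \<alpha>) \<longrightarrow> (\<forall>\<alpha>\<in>\<Delta>. tilde_coord e \<alpha> dvd g)"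
    have "real g *\<^sub>R \<rho> \<in> generator_weights lam"
      by (rule generator_rho[OF l(1) g(1)]) (use g(2) nm(1) in auto)
    moreover have "weight_dvd \<Delta> \<nu>' (real g *\<^sub>R \<rho>)" if "\<nu>' \<in> generator_weights lam" for \<nu>'
      by (rule weight_dvd_generators[OF l(1) mult_at_multiple_rho _ _ that]) (use g in auto)
    ultimately show ?thesis by blast
  next
    fix e0 assume e: "e0 > 0" "\<forall>\<alpha>\<in>\<Delta>. tilde_coord e0 \<alpha> dvd l \<alpha>" "\<forall>d. (\<forall>\<alpha>\<in>\<Delta>. d dvd l \<alpha>) \<longrightarrow> (\<forall>\<alpha>\<in>\<Delta>. d dvd tilde_coord e0 \<alpha>)"
      "\<forall>e. (\<forall>\<alpha>\<in>\<Delta>. tilde_coord e \<alpha> dvd l \<alpha>) \<longrightarrow> (\<forall>\<alpha>\<in>\<Delta>. tilde_coord e \<alpha> dvd tilde_coord e0 \<alpha>)"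
    have "real e0 *\<^sub>R \<rho>t \<in> generator_weights lam"
      by (rule generator_rho_tilde[OF l(1) e(1)]) (use e(2) nm(2) in auto)
    moreover have "weight_dvd \<Delta> \<nu>' (real e0 *\<^sub>R \<rho>t)" if "\<nu>' \<in> generator_weights lam" for \<nu>'
      by (rule weight_dvd_generators[OF l(1) mult_at_multiple_rho_tilde _ _ that]) (use e in auto)
    ultimately show ?thesis by blast
  qed
qed

text \<open>In the next two lemmas \<open>a\<close> and \<open>b\<close> are the coordinates at \<open>\<alpha>\<close> of the numerator and the
  denominator of a quotient; \<open>fact1\<close> and \<open>fact2\<close> come from comparing zeros of the face polynomials.\<close>

lemma maximal_generator_multiple_rho:
  fixes n :: nat
  assumes "n > 0" "\<alpha> \<in> \<Delta>" and ab: "b dvd a" "a \<noteq> b" "a > 0"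
    and fact1: "\<And>k. k > 0 \<Longrightarrow> k dvd a \<Longrightarrow> \<not> k dvd b \<Longrightarrow> k dvd n"
    and fact2: "\<And>k \<nu> v. k > 0 \<Longrightarrow> k dvd a \<Longrightarrow> \<not> k dvd b \<Longrightarrow> \<nu> \<in> generator_weights (real n *\<^sub>R \<rho>) \<Longrightarrow>
      mult_at \<alpha> \<nu> = real v \<Longrightarrow> \<not> k dvd v"
  shows "\<exists>\<nu>\<in>generator_weights (real n *\<^sub>R \<rho>). \<forall>\<nu>'\<in>generator_weights (real n *\<^sub>R \<rho>). weight_dvd \<Delta> \<nu>' \<nu>"
proof -
  let ?lam = "real n *\<^sub>R \<rho>"
  have nab: "\<not> a dvd b" using ab by (metis dvd_antisym)
  have neq: "real d *\<^sub>R \<rho> \<noteq> ?lam" if "d \<noteq> n" for d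
    using that mult_at_multiple_rho[OF \<open>\<alpha> \<in> \<Delta>\<close>] by (metis of_nat_eq_iff)
  have gen: "real d *\<^sub>R \<rho> \<in> generator_weights ?lam" if "d dvd n" "d \<noteq> n" for d
    using that neq[of d] dvd_pos_nat[OF \<open>n > 0\<close>] by (intro generator_rho[OF mult_at_multiple_rho]) auto
  have "a dvd n" using fact1[OF ab(3) dvd_refl nab] .
  \<comment> \<open>Otherwise \<open>a\<close> is a proper divisor of \<open>n\<close>, its multiple
    of \<rho> is a generator weight, and \<open>fact2\<close> with \<open>k = a\<close> is
    violated.\<close>
  have an: "a = n"
  proof (rule ccontr)
    assume "a \<noteq> n"
    from fact2[OF ab(3) dvd_refl nab gen[OF \<open>a dvd n\<close> this] mult_at_multiple_rho[OF \<open>\<alpha> \<in> \<Delta>\<close>]]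
    show False by simp
  qed
  have b: "b dvd n" "b \<noteq> n" "b > 0" using ab an dvd_pos_nat by auto
  \<comment> \<open>So \<open>b\<close> is a greatest proper divisor of \<open>n\<close>: a proper
    divisor \<open>d\<close> not dividing \<open>b\<close> could be taken as \<open>k\<close> in
    \<open>fact2\<close> for the generator weight given by \<open>d\<close> itself.\<close>
  have proper: "d dvd b" if "d dvd n" "d \<noteq> n" for d
  proof (rule ccontr)
    assume "\<not> d dvd b"
    then show False
      using fact2[OF _ _ _ gen[OF that] mult_at_multiple_rho[OF \<open>\<alpha> \<in> \<Delta>\<close>], of d] that an dvd_pos_nat[OF \<open>n > 0\<close>]
      by auto
  qed
  obtain s where s: "s \<in> \<Delta>" "\<And>e. tilde_coord e s = e * m" using tilde_coord_short by auto
  have dvd_n: "e * m dvd n" if "\<forall>\<alpha>\<in>\<Delta>. tilde_coord e \<alpha> dvd n" for e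
    using that s by metis
  have coord_dvd: "tilde_coord e \<gamma> dvd c" if "e * m dvd c" for e c \<gamma>
    using that by (auto simp: tilde_coord_def dest: dvd_mult_left)
  \<comment> \<open>The competitors are the multiples \<open>e\<close> of \<open>\<rho>t\<close>,
    which divide through their short coordinate \<open>e * m\<close>. If this is a proper divisor of
    \<open>n\<close>, it divides \<open>b\<close>; the exception is \<open>e * m = n\<close>, where
    \<open>e\<close> turns out to equal \<open>b\<close> and the multiple of \<open>\<rho>t\<close>
    is the greatest generator.\<close>
  show ?thesis
  proof (cases "\<exists>e. e * m = n \<and> real e *\<^sub>R \<rho>t \<noteq> ?lam")
    case True
    then obtain e where e: "e * m = n" "real e *\<^sub>R \<rho>t \<noteq> ?lam" by auto
    have "m \<noteq> 1" using e rho_tilde_eq_rho by auto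
    then have "e \<noteq> n" using e(1) \<open>n > 0\<close> by auto
    have epos: "e > 0" using e(1) \<open>n > 0\<close> by (cases e) auto
    have "e dvd b" using proper[of e] \<open>e \<noteq> n\<close> e(1) by auto
    then obtain j where j: "b = e * j" by (elim dvdE)
    have "j dvd m" using b(1) epos unfolding j e(1)[symmetric] by simp
    then have "j = 1" using small_divisor[OF m, of j] b(2) j e(1) by auto
    then have be: "b = e" using j by simp
    have "real e *\<^sub>R \<rho>t \<in> generator_weights ?lam"
      using e(2) epos coord_dvd[of e n] e(1) by (intro generator_rho_tilde[OF mult_at_multiple_rho]) auto
    moreover have "weight_dvd \<Delta> \<nu>' (real e *\<^sub>R \<rho>t)" if "\<nu>' \<in> generator_weights ?lam" for \<nu>'
    proof (rule weight_dvd_generators[OF mult_at_multiple_rho mult_at_multiple_rho_tilde _ _ that])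
      fix d assume "\<forall>\<alpha>\<in>\<Delta>. d dvd n" "real d *\<^sub>R \<rho> \<noteq> ?lam"
      then have "d dvd e" using proper[of d] s(1) be by auto
      then show "\<forall>\<alpha>\<in>\<Delta>. d dvd tilde_coord e \<alpha>" by (simp add: tilde_coord_def)
    next
      fix e' assume "\<forall>\<alpha>\<in>\<Delta>. tilde_coord e' \<alpha> dvd n"
      then have "e' * m dvd e * m" using dvd_n e(1) by simp
      then have "e' dvd e" using m by auto
      then show "\<forall>\<alpha>\<in>\<Delta>. tilde_coord e' \<alpha> dvd tilde_coord e \<alpha>" by (simp add: tilde_coord_def)
    qed
    ultimately show ?thesis by blast
  next
    case False
    have "weight_dvd \<Delta> \<nu>' (real b *\<^sub>R \<rho>)" if "\<nu>' \<in> generator_weights ?lam" for \<nu>'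
    proof (rule weight_dvd_generators[OF mult_at_multiple_rho mult_at_multiple_rho _ _ that])
      fix d assume "\<forall>\<alpha>\<in>\<Delta>. d dvd n" "real d *\<^sub>R \<rho> \<noteq> ?lam"
      then show "\<forall>\<alpha>\<in>\<Delta>. d dvd b" using proper[of d] s(1) by auto
    next
      fix e assume e: "\<forall>\<alpha>\<in>\<Delta>. tilde_coord e \<alpha> dvd n" "real e *\<^sub>R \<rho>t \<noteq> ?lam"
      then have "e * m dvd b" using proper[of "e * m"] dvd_n[OF e(1)] False by auto
      then show "\<forall>\<alpha>\<in>\<Delta>. tilde_coord e \<alpha> dvd b" using coord_dvd by blast
    qed
    then show ?thesis using gen[OF b(1,2)] by blast
  qed
qed

lemma maximal_generator_multiple_rho_tilde:
  fixes n :: nat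
  assumes "n > 0" "m \<noteq> 1" and \<alpha>: "\<alpha> \<in> \<Delta>" and ab: "b dvd a" "a \<noteq> b" "a > 0"
    and fact1: "\<And>k. k > 0 \<Longrightarrow> k dvd a \<Longrightarrow> \<not> k dvd b \<Longrightarrow> k dvd tilde_coord n \<alpha>"
    and fact2: "\<And>k \<nu> v. k > 0 \<Longrightarrow> k dvd a \<Longrightarrow> \<not> k dvd b \<Longrightarrow> \<nu> \<in> generator_weights (real n *\<^sub>R \<rho>t) \<Longrightarrow>
      mult_at \<alpha> \<nu> = real v \<Longrightarrow> \<not> k dvd v"
  shows "\<exists>\<nu>\<in>generator_weights (real n *\<^sub>R \<rho>t). \<forall>\<nu>'\<in>generator_weights (real n *\<^sub>R \<rho>t). weight_dvd \<Delta> \<nu>' \<nu>"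
proof -
  let ?lam = "real n *\<^sub>R \<rho>t"
  have nab: "\<not> a dvd b" using ab by (metis dvd_antisym)
  obtain s where s: "s \<in> \<Delta>" "\<And>e. tilde_coord e s = e * m" using tilde_coord_short by auto
  obtain lg where lg: "lg \<in> \<Delta>" "\<And>e. tilde_coord e lg = e" using tilde_coord_long by auto
  have "real n *\<^sub>R \<rho> \<noteq> ?lam"
  proof
    assume eq: "real n *\<^sub>R \<rho> = ?lam"
    have "real n = mult_at s (real n *\<^sub>R \<rho>)" by (simp only: mult_at_multiple_rho[OF s(1)])
    also have "\<dots> = real (n * m)" by (simp only: eq mult_at_multiple_rho_tilde[OF s(1)] s(2))
    finally show False using assms(1,2) by (metis mult.right_neutral nat_mult_eq_cancel1 of_nat_eq_iff)
  qed
  then have gn: "real n *\<^sub>R \<rho> \<in> generator_weights ?lam"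
    using assms(1) by (intro generator_rho[OF mult_at_multiple_rho_tilde]) (auto simp: tilde_coord_def)
  have neq: "real e *\<^sub>R \<rho>t \<noteq> ?lam" if "e \<noteq> n" for e
    using that mult_at_multiple_rho_tilde[OF lg(1)] lg(2) by (metis of_nat_eq_iff)
  have ge: "real e *\<^sub>R \<rho>t \<in> generator_weights ?lam" if "e dvd n" "e \<noteq> n" for e
    using that neq[of e] dvd_pos_nat[OF \<open>n > 0\<close>]
    by (intro generator_rho_tilde[OF mult_at_multiple_rho_tilde]) (auto simp: tilde_coord_def)
  have "\<not> a dvd n" using fact2[OF ab(3) dvd_refl nab gn mult_at_multiple_rho[OF \<alpha>]] .
  moreover have "a dvd tilde_coord n \<alpha>" by (rule fact1[OF ab(3) dvd_refl nab])
  \<comment> \<open>At a long root the coordinate would be \<open>n\<close>, which \<open>a\<close>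
    does not divide because the multiple \<open>n\<close> of \<rho> is a generator weight.\<close>
  ultimately have short: "\<alpha> \<bullet> \<alpha> \<noteq> long_sqlen \<Phi>" by (auto simp: tilde_coord_def)
  then have coord: "tilde_coord e \<alpha> = e * m" for e by (simp add: tilde_coord_def)
  note fact2' = fact2[OF _ _ _ ge mult_at_multiple_rho_tilde[OF \<alpha>], unfolded coord]
  have a: "a = n * m"
  proof (rule short_divisor_full[OF m assms(1)])
    show "a dvd n * m" using \<open>a dvd tilde_coord n \<alpha>\<close> by (simp add: coord)
    show "\<not> a dvd e * m" if "e dvd n" "e \<noteq> n" for e
      by (rule fact2'[OF ab(3) dvd_refl nab that])
  qed fact
  \<comment> \<open>Otherwise \<open>k = n\<close> contradicts \<open>fact2\<close> for the
    generator weight \<open>real n *\<^sub>R \<rho>\<close>. As \<open>b\<close> is a proper divisor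
    of \<open>n * m\<close>, it follows that \<open>b\<close> equals \<open>n\<close>.\<close>
  have "n dvd b"
    using fact2[OF assms(1) _ _ gn mult_at_multiple_rho[OF \<alpha>]] a by auto
  then obtain j where j: "b = n * j" by (elim dvdE)
  have "j dvd m" using ab(1) assms(1) unfolding j a by simp
  then have "j = 1" using small_divisor[OF m, of j] ab(2) j a by auto
  then have bn: "b = n" using j by simp
  \<comment> \<open>The number \<open>e * m\<close> divides \<open>a\<close>; if it did not divide
    \<open>b = n\<close>, it would be a forbidden \<open>k\<close> for the generator weight given by
    \<open>e\<close>.\<close>
  have em: "e * m dvd n" if "e dvd n" "e \<noteq> n" for e
  proof (rule ccontr)
    assume no: "\<not> e * m dvd n"
    have "e * m > 0" using dvd_pos_nat[OF assms(1) that(1)] m by auto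
    then show False using fact2'[of "e * m" e] no that unfolding a bn by auto
  qed
  have "weight_dvd \<Delta> \<nu>' (real n *\<^sub>R \<rho>)" if "\<nu>' \<in> generator_weights ?lam" for \<nu>'
  proof (rule weight_dvd_generators[OF mult_at_multiple_rho_tilde mult_at_multiple_rho _ _ that])
    fix d assume "\<forall>\<alpha>\<in>\<Delta>. d dvd tilde_coord n \<alpha>"
    then show "\<forall>\<alpha>\<in>\<Delta>. d dvd n" using lg by metis
  next
    fix e assume e: "\<forall>\<alpha>\<in>\<Delta>. tilde_coord e \<alpha> dvd tilde_coord n \<alpha>" "real e *\<^sub>R \<rho>t \<noteq> ?lam"
    have "e dvd n" using e(1) lg by metis
    moreover from this have "e * m dvd n" using em e(2) by blast
    ultimately show "\<forall>\<alpha>\<in>\<Delta>. tilde_coord e \<alpha> dvd n" by (simp add: tilde_coord_def)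
  qed
  then show ?thesis using gn by blast
qed

text \<open>\<open>D1\<close> is an alternating sum, while for a multiple \<open>lam2\<close> the
  same is not known of \<open>D2\<close> in advance. The equation
  \<open>S lam1 * D2 = S mu * S lam2\<close>, restricted to one edge, supplies the arithmetic from
  which a greatest generator weight of \<open>lam2\<close> is found.\<close>

lemma quotient_by_lcm_unique:
  assumes reg: "dominant_regular \<Phi> \<Delta> lam1" "dominant_regular \<Phi> \<Delta> lam2"
    and nm: "\<not> (\<exists>c::real. lam1 = c *\<^sub>R \<rho>)" "\<not> (\<exists>c::real. lam1 = c *\<^sub>R \<rho>t)"
    and D: "is_D \<Phi> \<Delta> lam1 D1" "is_D \<Phi> \<Delta> lam2 D2"
    and eq: "S lam1 = C * D1" "S lam2 = C * D2"
  shows "lam1 = lam2"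
proof -
  obtain mu where mu: "mu \<in> generator_weights lam1" "\<forall>\<nu>'\<in>generator_weights lam1. weight_dvd \<Delta> \<nu>' mu"
    using maximal_generator_nonmultiple[OF reg(1) nm] by auto
  have D1: "D1 = S mu" by (rule is_D_eq_altsum[OF irr mu(1) _ D(1)]) (use mu(2) in auto)
  have ne: "lam1 \<noteq> mu" using mu(1) by (auto simp: generator_weights_def)
  have sd: "strictly_dominant \<nu>" if "\<nu> \<in> generator_weights lam" for \<nu> lam
    using special_weight_props(1)[OF irr] that by (simp add: generator_weights_def)
  note sd1 = dominant_regular_strictly_dominant[OF reg(1)] and sd2 = dominant_regular_strictly_dominant[OF reg(2)]
  have main: "S lam1 * D2 = S mu * S lam2"
    by (simp add: eq D1 ac_simps)
  have conclude: "lam1 = lam2"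
    if max: "\<exists>\<nu>\<in>generator_weights lam2. \<forall>\<nu>'\<in>generator_weights lam2. weight_dvd \<Delta> \<nu>' \<nu>"
  proof -
    obtain \<nu> where \<nu>: "\<nu> \<in> generator_weights lam2" "\<forall>\<nu>'\<in>generator_weights lam2. weight_dvd \<Delta> \<nu>' \<nu>"
      using max by auto
    have "D2 = S \<nu>" by (rule is_D_eq_altsum[OF irr \<nu>(1) _ D(2)]) (use \<nu>(2) in auto)
    then have "S lam1 * S \<nu> = S lam2 * S mu" using main by (simp add: mult.commute)
    then show ?thesis
      \<comment> \<open>The alternative \<open>lam1 = mu\<close> is impossible, as a generator
        weight of \<open>lam1\<close> differs from \<open>lam1\<close>.\<close>
      using altsum_mult_eq_imp[OF irr _ sd1 sd2 sd[OF mu(1)] sd[OF \<nu>(1)]] ne by blast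
  qed
  obtain l where l: "\<And>\<alpha>. \<alpha> \<in> \<Delta> \<Longrightarrow> mult_at \<alpha> lam1 = real (l \<alpha>)" "\<And>\<alpha>. \<alpha> \<in> \<Delta> \<Longrightarrow> l \<alpha> > 0"
    using dominant_regular_nat[OF reg(1)] by metis
  have mu_int: "dominant_regular \<Phi> \<Delta> mu"
    using special_weight_props[OF irr, of mu] mu(1) weight_latticeI[of mu]
    by (simp add: generator_weights_def dominant_regular_def strictly_dominant_iff)
  obtain b where b: "\<And>\<alpha>. \<alpha> \<in> \<Delta> \<Longrightarrow> mult_at \<alpha> mu = real (b \<alpha>)"
    using dominant_regular_nat[OF mu_int] by metis
  \<comment> \<open>The edge is chosen where \<open>mu\<close> is a proper divisor of
    \<open>lam1\<close>, so that numbers \<open>k\<close> dividing \<open>l \<alpha>\<close> but not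
    \<open>b \<alpha>\<close> exist.\<close>
  obtain \<alpha> where \<alpha>: "\<alpha> \<in> \<Delta>" "mult_at \<alpha> lam1 \<noteq> mult_at \<alpha> mu"
    using ne eq_if_mult_at_eq by blast
  have "weight_dvd \<Delta> mu lam1" using mu(1) by (simp add: generator_weights_def)
  then have bl: "b \<alpha> dvd l \<alpha>" using weight_dvd_iff_nat[OF b l(1)] \<alpha>(1) by blast
  have nl: "l \<alpha> \<noteq> b \<alpha>" using \<alpha> l(1) b by auto
  have fact1: "k dvd n" if "k > 0" "k dvd l \<alpha>" "\<not> k dvd b \<alpha>" "mult_at \<alpha> lam2 = real n" for k n
    by (rule face_dvd[OF \<alpha>(1) sd1 sd[OF mu(1)] sd2 main l(1)[OF \<alpha>(1)] b[OF \<alpha>(1)] that(4,1-3)])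
  obtain n2 where n2: "\<And>\<alpha>. \<alpha> \<in> \<Delta> \<Longrightarrow> mult_at \<alpha> lam2 = real (n2 \<alpha>)" "\<And>\<alpha>. \<alpha> \<in> \<Delta> \<Longrightarrow> n2 \<alpha> > 0"
    using dominant_regular_nat[OF reg(2)] by metis
  have fact2: "\<not> k dvd v"
    if k: "k > 0" "k dvd l \<alpha>" "\<not> k dvd b \<alpha>" and \<nu>: "\<nu> \<in> generator_weights lam2" "mult_at \<alpha> \<nu> = real v" for k \<nu> v
  proof -
    have "S \<nu> \<in> D_generators \<Phi> \<Delta> lam2" using \<nu>(1) by (auto simp: D_generators_eq)
    \<comment> \<open>A generator is at hand, so the convention \<open>D = 1\<close> for the empty
      set does not apply.\<close>
    then have "inv_dvd \<Phi> (S \<nu>) D2" using D(2) unfolding is_D_def by (metis empty_iff)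
    then obtain q where "D2 = S \<nu> * q" by (auto simp: inv_dvd_def)
    then have "S lam1 * (S \<nu> * q) = S mu * S lam2" using main by simp
    from face_not_dvd[OF \<alpha>(1) sd1 sd[OF mu(1)] sd2 sd[OF \<nu>(1)] this l(1)[OF \<alpha>(1)] b[OF \<alpha>(1)] n2(1)[OF \<alpha>(1)] \<nu>(2) k]
    show ?thesis .
  qed
  consider (rho) c where "lam2 = c *\<^sub>R \<rho>" | (tilde) c where "lam2 = c *\<^sub>R \<rho>t" "m \<noteq> 1"
    | (none) "\<not> (\<exists>c::real. lam2 = c *\<^sub>R \<rho>)" "\<not> (\<exists>c::real. lam2 = c *\<^sub>R \<rho>t)"
    using rho_tilde_eq_rho by metis
  then show ?thesis
  proof cases
    case rho
    define n where "n = n2 \<alpha>"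
    have "c = real n" using n2(1)[OF \<alpha>(1)] by (simp add: rho n_def mult_at_scale mult_at_rho[OF \<alpha>(1)])
    then have lam2: "lam2 = real n *\<^sub>R \<rho>" using rho by simp
    have "n > 0" using n2(2)[OF \<alpha>(1)] by (simp add: n_def)
    have val: "mult_at \<alpha> lam2 = real n" unfolding lam2 by (rule mult_at_multiple_rho[OF \<alpha>(1)])
    have "\<exists>\<nu>\<in>generator_weights lam2. \<forall>\<nu>'\<in>generator_weights lam2. weight_dvd \<Delta> \<nu>' \<nu>"
      unfolding lam2
    proof (rule maximal_generator_multiple_rho[OF \<open>n > 0\<close> \<alpha>(1) bl nl l(2)[OF \<alpha>(1)]])
      show "k dvd n" if "k > 0" "k dvd l \<alpha>" "\<not> k dvd b \<alpha>" for k
        by (rule fact1[OF that val])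
    qed (rule fact2, simp_all add: lam2)
    then show ?thesis by (rule conclude)
  next
    case tilde
    obtain lg where lg: "lg \<in> \<Delta>" "\<And>e. tilde_coord e lg = e" using tilde_coord_long by auto
    define n where "n = n2 lg"
    have "mult_at lg \<rho>t = 1" using mult_at_multiple_rho_tilde[OF lg(1), of 1] lg(2) by simp
    then have "c = real n" using n2(1)[OF lg(1)] by (simp add: tilde n_def mult_at_scale)
    then have lam2: "lam2 = real n *\<^sub>R \<rho>t" using tilde by simp
    have "n > 0" using n2(2)[OF lg(1)] by (simp add: n_def)
    have val: "mult_at \<alpha> lam2 = real (tilde_coord n \<alpha>)"
      unfolding lam2 by (rule mult_at_multiple_rho_tilde[OF \<alpha>(1)])
    have "\<exists>\<nu>\<in>generator_weights lam2. \<forall>\<nu>'\<in>generator_weights lam2. weight_dvd \<Delta> \<nu>' \<nu>"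
      unfolding lam2
    proof (rule maximal_generator_multiple_rho_tilde[OF \<open>n > 0\<close> tilde(2) \<alpha>(1) bl nl l(2)[OF \<alpha>(1)]])
      show "k dvd tilde_coord n \<alpha>" if "k > 0" "k dvd l \<alpha>" "\<not> k dvd b \<alpha>" for k
        by (rule fact1[OF that val])
    qed (rule fact2, simp_all add: lam2)
    then show ?thesis by (rule conclude)
  next
    case none
    then show ?thesis by (intro conclude maximal_generator_nonmultiple reg(2))
  qed
qed

end

theorem theorem2p5:
  fixes \<Phi> \<Delta> :: "'a::euclidean_space set"
  assumes "simple_based_root_system \<Phi> \<Delta>"
  shows "(\<forall>lam1 lam2 mu1 mu2 f.
            dominant_regular \<Phi> \<Delta> lam1 \<and> dominant_regular \<Phi> \<Delta> lam2 \<and>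
            dominant_regular \<Phi> \<Delta> mu1 \<and> dominant_regular \<Phi> \<Delta> mu2 \<and>
            (\<exists>k::nat. k > 0 \<and> (mu1 = real k *\<^sub>R rho \<Delta> \<or> mu1 = real k *\<^sub>R rho_tilde \<Phi> \<Delta>)) \<and>
            (\<exists>k::nat. k > 0 \<and> (mu2 = real k *\<^sub>R rho \<Delta> \<or> mu2 = real k *\<^sub>R rho_tilde \<Phi> \<Delta>)) \<and>
            weight_dvd \<Delta> mu1 lam1 \<and> weight_dvd \<Delta> mu2 lam2 \<and>
            in_ZP \<Phi> f \<and>
            altsum \<Phi> \<Delta> lam1 = f * altsum \<Phi> \<Delta> mu1 \<and>
            altsum \<Phi> \<Delta> lam2 = f * altsum \<Phi> \<Delta> mu2 \<and>
            f \<noteq> 1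
          \<longrightarrow> lam1 = lam2 \<and> mu1 = mu2)
       \<and>
         (\<forall>lam1 lam2 D1 D2 C.
            dominant_regular \<Phi> \<Delta> lam1 \<and> dominant_regular \<Phi> \<Delta> lam2 \<and>
            \<not> (\<exists>c::real. lam1 = c *\<^sub>R rho \<Delta>) \<and>
            \<not> (\<exists>c::real. lam1 = c *\<^sub>R rho_tilde \<Phi> \<Delta>) \<and>
            is_D \<Phi> \<Delta> lam1 D1 \<and> is_D \<Phi> \<Delta> lam2 D2 \<and>
            in_ZP \<Phi> C \<and>
            altsum \<Phi> \<Delta> lam1 = C * D1 \<and> altsum \<Phi> \<Delta> lam2 = C * D2
          \<longrightarrow> lam1 = lam2)"
proof -
  interpret based_root_system \<Phi> \<Delta>
    using assms by unfold_locales (auto simp: simple_based_root_system_def)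
  have irr: "irreducible_root_system \<Phi>"
    using assms by (simp add: simple_based_root_system_def)
  obtain m where m: "m \<in> {1, 2, 3}" "mPhi \<Phi> = real m"
    "\<And>\<alpha>. \<alpha> \<in> \<Delta> \<Longrightarrow> \<alpha> \<bullet> \<alpha> = long_sqlen \<Phi> \<or> real m * (\<alpha> \<bullet> \<alpha>) = long_sqlen \<Phi>"
    "\<exists>\<alpha>\<in>\<Delta>. \<alpha> \<bullet> \<alpha> = long_sqlen \<Phi>" "\<exists>\<alpha>\<in>\<Delta>. real m * (\<alpha> \<bullet> \<alpha>) = long_sqlen \<Phi>"
    using root_lengths[OF irr] by metis
  interpret simple_root_system \<Phi> \<Delta> m
    by unfold_locales (use irr m in auto)
  have "lam1 = lam2 \<and> mu1 = mu2"
    if reg: "dominant_regular \<Phi> \<Delta> lam1" "dominant_regular \<Phi> \<Delta> lam2"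
      "dominant_regular \<Phi> \<Delta> mu1" "dominant_regular \<Phi> \<Delta> mu2"
      and eq: "S lam1 = f * S mu1" "S lam2 = f * S mu2" and f: "f \<noteq> 1" for lam1 lam2 mu1 mu2 f
  proof -
    note sd = reg[THEN dominant_regular_strictly_dominant]
    have "S lam1 * S mu2 = S lam2 * S mu1" by (simp add: eq ac_simps)
    from altsum_mult_eq_imp[OF irr this sd] show ?thesis
    proof
      \<comment> \<open>The crossed solution makes the quotient trivial, after cancelling the
        alternating sum.\<close>
      assume "lam1 = mu1 \<and> lam2 = mu2"
      then have "S mu1 * f = S mu1 * 1" using eq(1) by (simp add: mult.commute)
      then have "f = 1" by (rule altsum_mult_cancel[OF sd(3)])
      then show ?thesis using f by simp
    qed
  qed
  then show ?thesis using quotient_by_lcm_unique by blast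
qed

end
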